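(* Let $n\ge 1$ be an integer, let $p<q$ be odd primes and let $p^a\,\|\,q-1$ (that is, $p^a\mid q-1$ and $p^{a+1}\nmid q-1$). For $1\le b\le\min\{n,a\}$, let $G_b$ denote the unique (up to isomorphism) nonabelian group of the form $\mathbb{Z}_q\rtimes\mathbb{Z}_{p^n}$ determined by $b$, that is, in which the image of the action $\mathbb{Z}_{p^n}\to\mathrm{Aut}(\mathbb{Z}_q)$ has order $p^b$. Let $C$ denote the cyclic group of order $p^nq$. Then for all $b,b_1,b_2\in\{1,\dots,\min\{n,a\}\}$: (1) $e'(G_b,G_b)=e(G_b,G_b)=2\left(p^{n-b}+q\left(\varphi(p^n)-p^{n-b}\right)\right)$; (2) $e'(G_{b_1},G_{b_2})=2qp^{n+b_1-b_2-1}(p-1)$ and $e(G_{b_1},G_{b_2})=2qp^{n-1}(p-1)$ for $b_1\ne b_2$; (3) $e'(C,G_b)=2p^{n-b}q$ and $e(C,G_b)=2(p-1)p^{n-1}$; (4) $e'(G_b,C)=p^{n+b-2}(p-1)$ and $e(G_b,C)=p^{n-1}q$.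
   Context: $\mathbb{Z}_m$ denotes the cyclic group of order $m$ and $\varphi$ is the Euler totient function. The group $G_b$ has presentation $\langle x,y\mid x^{p^n}=y^q=1,\ xyx^{-1}=y^k\rangle$, where $k$ is an element of order $p^b$ in $\mathbb{Z}_q^{\times}$. For a finite group $N$, the holomorph is $\mathrm{Hol}(N)=N\rtimes\mathrm{Aut}(N)$ (with $\mathrm{Aut}(N)$ acting naturally on $N$), which acts on $N$ by $(a,\zeta)\cdot b=a\,\zeta(b)$. A subgroup $\Gamma\le\mathrm{Hol}(N)$ is regular if it acts simply transitively on $N$; for $|\Gamma|=|N|$ this is equivalent to requiring that the only element of $\Gamma$ of the form $(1_N,\zeta)$ is the one with $\zeta=\mathrm{id}$. A Hopf-Galois structure on a finite Galois field extension $L/K$ is a $K$-Hopf algebra $\mathcal{H}$ with an action on $L$ making $L$ an $\mathcal{H}$-module algebra and an $\mathcal{H}$-Galois extension of $K$; it has type $N$ if $L\otimes_K\mathcal{H}\cong L[N]$ as $L$-Hopf algebras. For finite groups $G,N$ of the same order, $e(G,N)$ is the number of Hopf-Galois structures of type $N$ on a finite Galois extension with Galois group isomorphic to $G$; equivalently (Greither-Pareigis), the number of regular subgroups of $\mathrm{Perm}(G)$ that are isomorphic to $N$ and normalised by the left regular representation $\lambda(G)$. The number of regular subgroups of $\mathrm{Hol}(N)$ isomorphic to $G$ is denoted $e'(G,N)$. By Byott, $e(G,N)=\frac{|\mathrm{Aut}(G)|}{|\mathrm{Aut}(N)|}\,e'(G,N)$. *)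

theory Defs
  imports
    "HOL-Algebra.Bij"
    "HOL-Algebra.Elementary_Groups"
    "HOL-Algebra.Algebraic_Closure_Type"
    "HOL-Number_Theory.Totient"
begin

section \<open>Semidirect products, holomorphs and regular subgroups\<close>

definition semidirect_product ::
    "('a, 'm) monoid_scheme \<Rightarrow> ('b, 'k) monoid_scheme \<Rightarrow> ('b \<Rightarrow> 'a \<Rightarrow> 'a) \<Rightarrow> ('a \<times> 'b) monoid" where
  "semidirect_product N H \<theta> =
    \<lparr>carrier = carrier N \<times> carrier H,
     monoid.mult = (\<lambda>(a, h) (b, k). (a \<otimes>\<^bsub>N\<^esub> \<theta> h b, h \<otimes>\<^bsub>H\<^esub> k)),
     one = (\<one>\<^bsub>N\<^esub>, \<one>\<^bsub>H\<^esub>)\<rparr>"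

definition holomorph :: "('a, 'm) monoid_scheme \<Rightarrow> ('a \<times> ('a \<Rightarrow> 'a)) monoid" where
  "holomorph N = semidirect_product N (AutoGroup N) (\<lambda>\<zeta>. \<zeta>)"

definition hol_act :: "('a, 'm) monoid_scheme \<Rightarrow> 'a \<times> ('a \<Rightarrow> 'a) \<Rightarrow> 'a \<Rightarrow> 'a" where
  "hol_act N = (\<lambda>(a, \<zeta>) b. a \<otimes>\<^bsub>N\<^esub> \<zeta> b)"

definition regular_subgroup :: "('a \<times> ('a \<Rightarrow> 'a)) set \<Rightarrow> ('a, 'm) monoid_scheme \<Rightarrow> bool" where
  "regular_subgroup \<Gamma> N \<longleftrightarrow>
     subgroup \<Gamma> (holomorph N) \<and>
     (\<forall>x\<in>carrier N. \<forall>y\<in>carrier N. \<exists>!\<gamma>. \<gamma> \<in> \<Gamma> \<and> hol_act N \<gamma> x = y)"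

text \<open>The number $e'(G,N)$.\<close>

definition e' :: "('g, 'm) monoid_scheme \<Rightarrow> ('a, 'k) monoid_scheme \<Rightarrow> nat" where
  "e' G N = card {\<Gamma>. regular_subgroup \<Gamma> N \<and> (holomorph N)\<lparr>carrier := \<Gamma>\<rparr> \<cong> G}"


section \<open>Hopf algebras\<close>

text \<open>
  A finite-dimensional Hopf algebra over a field $K$ is given, on a chosen basis $(e_i)_{i \in I}$,
  by the coordinates of its structure maps:
  $e_i e_j = \sum_k \mathit{hmult}\,i\,j\,k\; e_k$, \quad
  $1 = \sum_k \mathit{hunit}\,k\; e_k$, \quad
  $\Delta(e_i) = \sum_{j,k} \mathit{hcomult}\,i\,j\,k\; e_j \otimes e_k$, \quad
  $\varepsilon(e_i) = \mathit{hcounit}\,i$, \quad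
  $S(e_i) = \sum_k \mathit{hantipode}\,i\,k\; e_k$.
  The field $K$ is a subset of an ambient field type. With this encoding, extension of scalars
  along $K \subseteq L$ leaves the data unchanged: the constants of $H$, read over $L$, are those
  of $L \otimes_K H$ in the basis $1 \otimes e_i$.
\<close>

record ('i, 'l) hopf =
  hbasis :: "'i set"
  hmult :: "'i \<Rightarrow> 'i \<Rightarrow> 'i \<Rightarrow> 'l"
  hunit :: "'i \<Rightarrow> 'l"
  hcomult :: "'i \<Rightarrow> 'i \<Rightarrow> 'i \<Rightarrow> 'l"
  hcounit :: "'i \<Rightarrow> 'l"
  hantipode :: "'i \<Rightarrow> 'i \<Rightarrow> 'l"

locale hopf_algebra =
  fixes K :: "'l::field set" and H :: "('i, 'l) hopf"
  assumes finite_basis: "finite (hbasis H)"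
    and hmult_in: "\<lbrakk>i \<in> hbasis H; j \<in> hbasis H; k \<in> hbasis H\<rbrakk> \<Longrightarrow> hmult H i j k \<in> K"
    and hunit_in: "i \<in> hbasis H \<Longrightarrow> hunit H i \<in> K"
    and hcomult_in: "\<lbrakk>i \<in> hbasis H; j \<in> hbasis H; k \<in> hbasis H\<rbrakk> \<Longrightarrow> hcomult H i j k \<in> K"
    and hcounit_in: "i \<in> hbasis H \<Longrightarrow> hcounit H i \<in> K"
    and hantipode_in: "\<lbrakk>i \<in> hbasis H; j \<in> hbasis H\<rbrakk> \<Longrightarrow> hantipode H i j \<in> K"
    and assoc:
      "\<lbrakk>i \<in> hbasis H; j \<in> hbasis H; k \<in> hbasis H; t \<in> hbasis H\<rbrakk> \<Longrightarrow>
        (\<Sum>s\<in>hbasis H. hmult H i j s * hmult H s k t) =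
        (\<Sum>s\<in>hbasis H. hmult H j k s * hmult H i s t)"
    and unit_left:
      "\<lbrakk>i \<in> hbasis H; t \<in> hbasis H\<rbrakk> \<Longrightarrow>
        (\<Sum>s\<in>hbasis H. hunit H s * hmult H s i t) = (if i = t then 1 else 0)"
    and unit_right:
      "\<lbrakk>i \<in> hbasis H; t \<in> hbasis H\<rbrakk> \<Longrightarrow>
        (\<Sum>s\<in>hbasis H. hunit H s * hmult H i s t) = (if i = t then 1 else 0)"
    and coassoc:
      "\<lbrakk>i \<in> hbasis H; j \<in> hbasis H; k \<in> hbasis H; l \<in> hbasis H\<rbrakk> \<Longrightarrow>
        (\<Sum>s\<in>hbasis H. hcomult H i s l * hcomult H s j k) =
        (\<Sum>s\<in>hbasis H. hcomult H i j s * hcomult H s k l)"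
    and counit_left:
      "\<lbrakk>i \<in> hbasis H; j \<in> hbasis H\<rbrakk> \<Longrightarrow>
        (\<Sum>s\<in>hbasis H. hcounit H s * hcomult H i s j) = (if i = j then 1 else 0)"
    and counit_right:
      "\<lbrakk>i \<in> hbasis H; j \<in> hbasis H\<rbrakk> \<Longrightarrow>
        (\<Sum>s\<in>hbasis H. hcomult H i j s * hcounit H s) = (if i = j then 1 else 0)"
    and comult_mult:
      "\<lbrakk>i \<in> hbasis H; j \<in> hbasis H; k \<in> hbasis H; l \<in> hbasis H\<rbrakk> \<Longrightarrow>
        (\<Sum>s\<in>hbasis H. hmult H i j s * hcomult H s k l) =
        (\<Sum>a\<in>hbasis H. \<Sum>b\<in>hbasis H. \<Sum>c\<in>hbasis H. \<Sum>d\<in>hbasis H.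
           hcomult H i a b * hcomult H j c d * hmult H a c k * hmult H b d l)"
    and comult_unit:
      "\<lbrakk>k \<in> hbasis H; l \<in> hbasis H\<rbrakk> \<Longrightarrow>
        (\<Sum>s\<in>hbasis H. hunit H s * hcomult H s k l) = hunit H k * hunit H l"
    and counit_mult:
      "\<lbrakk>i \<in> hbasis H; j \<in> hbasis H\<rbrakk> \<Longrightarrow>
        (\<Sum>s\<in>hbasis H. hmult H i j s * hcounit H s) = hcounit H i * hcounit H j"
    and counit_unit: "(\<Sum>s\<in>hbasis H. hunit H s * hcounit H s) = 1"
    and antipode_left:
      "\<lbrakk>i \<in> hbasis H; t \<in> hbasis H\<rbrakk> \<Longrightarrow>
        (\<Sum>a\<in>hbasis H. \<Sum>b\<in>hbasis H. \<Sum>c\<in>hbasis H.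
           hcomult H i a b * hantipode H a c * hmult H c b t) = hcounit H i * hunit H t"
    and antipode_right:
      "\<lbrakk>i \<in> hbasis H; t \<in> hbasis H\<rbrakk> \<Longrightarrow>
        (\<Sum>a\<in>hbasis H. \<Sum>b\<in>hbasis H. \<Sum>c\<in>hbasis H.
           hcomult H i a b * hantipode H b c * hmult H a c t) = hcounit H i * hunit H t"

text \<open>
  \<open>is_hopf_iso F H H' P\<close>: the $F$-linear map $e_i \mapsto \sum_j P\,i\,j\; e'_j$ is an isomorphism of
  Hopf algebras over $F$.
\<close>

definition is_hopf_iso ::
    "'l::field set \<Rightarrow> ('i, 'l) hopf \<Rightarrow> ('j, 'l) hopf \<Rightarrow> ('i \<Rightarrow> 'j \<Rightarrow> 'l) \<Rightarrow> bool" where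
  "is_hopf_iso F H H' P \<longleftrightarrow>
     (\<forall>i\<in>hbasis H. \<forall>j\<in>hbasis H'. P i j \<in> F) \<and>
     (\<exists>Q. (\<forall>j\<in>hbasis H'. \<forall>i\<in>hbasis H. Q j i \<in> F) \<and>
        (\<forall>i\<in>hbasis H. \<forall>k\<in>hbasis H.
           (\<Sum>j\<in>hbasis H'. P i j * Q j k) = (if i = k then 1 else 0)) \<and>
        (\<forall>j\<in>hbasis H'. \<forall>k\<in>hbasis H'.
           (\<Sum>i\<in>hbasis H. Q j i * P i k) = (if j = k then 1 else 0))) \<and>
     (\<forall>i\<in>hbasis H. \<forall>j\<in>hbasis H. \<forall>t\<in>hbasis H'.
        (\<Sum>s\<in>hbasis H. hmult H i j s * P s t) =
        (\<Sum>a\<in>hbasis H'. \<Sum>b\<in>hbasis H'. P i a * P j b * hmult H' a b t)) \<and>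
     (\<forall>t\<in>hbasis H'. (\<Sum>s\<in>hbasis H. hunit H s * P s t) = hunit H' t) \<and>
     (\<forall>i\<in>hbasis H. \<forall>c\<in>hbasis H'. \<forall>d\<in>hbasis H'.
        (\<Sum>j\<in>hbasis H. \<Sum>k\<in>hbasis H. hcomult H i j k * P j c * P k d) =
        (\<Sum>a\<in>hbasis H'. P i a * hcomult H' a c d)) \<and>
     (\<forall>i\<in>hbasis H. hcounit H i = (\<Sum>a\<in>hbasis H'. P i a * hcounit H' a)) \<and>
     (\<forall>i\<in>hbasis H. \<forall>t\<in>hbasis H'.
        (\<Sum>s\<in>hbasis H. hantipode H i s * P s t) = (\<Sum>a\<in>hbasis H'. P i a * hantipode H' a t))"

definition group_hopf :: "('g, 'm) monoid_scheme \<Rightarrow> ('g, 'l::field) hopf" where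
  "group_hopf N =
    \<lparr>hbasis = carrier N,
     hmult = (\<lambda>g h k. if k = g \<otimes>\<^bsub>N\<^esub> h then 1 else 0),
     hunit = (\<lambda>g. if g = \<one>\<^bsub>N\<^esub> then 1 else 0),
     hcomult = (\<lambda>g h k. if h = g \<and> k = g then 1 else 0),
     hcounit = (\<lambda>g. 1),
     hantipode = (\<lambda>g h. if h = inv\<^bsub>N\<^esub> g then 1 else 0)\<rparr>"


section \<open>Galois extensions\<close>

text \<open>
  An extension $L/K$ is given by the type \<open>'l\<close> of elements of $L$ and the subset $K$.
\<close>

definition Gal :: "'l::field set \<Rightarrow> ('l \<Rightarrow> 'l) monoid" where
  "Gal K =
    \<lparr>carrier = {\<sigma>. bij \<sigma> \<and> (\<forall>x y. \<sigma> (x + y) = \<sigma> x + \<sigma> y) \<and> (\<forall>x y. \<sigma> (x * y) = \<sigma> x * \<sigma> y) \<and>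
                   (\<forall>x\<in>K. \<sigma> x = x)},
     monoid.mult = (\<circ>),
     one = id\<rparr>"

definition finite_galois_extension :: "'l::field set \<Rightarrow> bool" where
  "finite_galois_extension K \<longleftrightarrow>
     subfield K (ring_of_type_algebra :: 'l ring) \<and>
     (\<exists>B. finite B \<and> (\<forall>x. \<exists>c. (\<forall>b\<in>B. c b \<in> K) \<and> x = (\<Sum>b\<in>B. c b * b))) \<and>
     {x. \<forall>\<sigma>\<in>carrier (Gal K). \<sigma> x = x} = K"

definition galois_extension_with_group :: "'l::field set \<Rightarrow> ('g, 'm) monoid_scheme \<Rightarrow> bool" where
  "galois_extension_with_group K G \<longleftrightarrow> finite_galois_extension K \<and> Gal K \<cong> G"


section \<open>Hopf-Galois structures\<close>

definition End :: "'l::field set \<Rightarrow> ('l \<Rightarrow> 'l) set" where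
  "End K = {f. (\<forall>x y. f (x + y) = f x + f y) \<and> (\<forall>c\<in>K. \<forall>x. f (c * x) = c * f x)}"

text \<open>
  \<open>act i\<close> is the action of the basis element $e_i$ on $L$. The assumptions \<open>act_mult\<close> to
  \<open>act_of_one\<close> say that $L$ is an $H$-module algebra, i.e. a module with
  $h(xy) = \sum h_{(1)}(x)\,h_{(2)}(y)$ and $h(1) = \varepsilon(h)1$. The assumption \<open>galois\<close> says
  that $L \otimes_K H \to \mathrm{End}_K(L)$, $l \otimes h \mapsto (x \mapsto l\,h(x))$ is
  bijective, where $\sum_i l_i \otimes e_i$ is represented by the family $(l_i)_{i \in I}$.
  It forces $\dim_K H = [L:K]$, so it is no restriction to consider finite-dimensional $H$ only.
\<close>

locale hopf_galois_structure = hopf_algebra K H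
  for K :: "'l::field set" and H :: "('i, 'l) hopf" +
  fixes act :: "'i \<Rightarrow> 'l \<Rightarrow> 'l"
  assumes act_End: "i \<in> hbasis H \<Longrightarrow> act i \<in> End K"
    and act_mult:
      "\<lbrakk>i \<in> hbasis H; j \<in> hbasis H\<rbrakk> \<Longrightarrow>
        act i (act j x) = (\<Sum>s\<in>hbasis H. hmult H i j s * act s x)"
    and act_unit: "(\<Sum>s\<in>hbasis H. hunit H s * act s x) = x"
    and act_of_mult:
      "i \<in> hbasis H \<Longrightarrow>
        act i (x * y) = (\<Sum>j\<in>hbasis H. \<Sum>k\<in>hbasis H. hcomult H i j k * act j x * act k y)"
    and act_of_one: "i \<in> hbasis H \<Longrightarrow> act i 1 = hcounit H i"
    and galois:
      "bij_betw (\<lambda>l x. \<Sum>i\<in>hbasis H. l i * act i x) (hbasis H \<rightarrow>\<^sub>E UNIV) (End K)"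

definition has_type :: "('i, 'l::field) hopf \<Rightarrow> ('g, 'm) monoid_scheme \<Rightarrow> bool" where
  "has_type H N \<longleftrightarrow> (\<exists>P. is_hopf_iso UNIV H (group_hopf N :: ('g, 'l) hopf) P)"

text \<open>
  Hopf-Galois structures are counted up to $K$-linear isomorphism of Hopf algebras compatible with
  the actions on $L$. Every finite basis can be indexed by natural numbers, so all isomorphism
  classes are represented with index type \<open>nat\<close>.
\<close>

definition hopf_galois_structures ::
    "'l::field set \<Rightarrow> ('g, 'm) monoid_scheme \<Rightarrow> ((nat, 'l) hopf \<times> (nat \<Rightarrow> 'l \<Rightarrow> 'l)) set" where
  "hopf_galois_structures K N = {(H, act). hopf_galois_structure K H act \<and> has_type H N}"

definition hopf_galois_iso ::
    "'l::field set \<Rightarrow> ('g, 'm) monoid_scheme \<Rightarrow> ((nat, 'l) hopf \<times> (nat \<Rightarrow> 'l \<Rightarrow> 'l)) rel" where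
  "hopf_galois_iso K N =
    {((H, act), (H', act')).
       (H, act) \<in> hopf_galois_structures K N \<and> (H', act') \<in> hopf_galois_structures K N \<and>
       (\<exists>P. is_hopf_iso K H H' P \<and>
            (\<forall>i\<in>hbasis H. \<forall>x. act i x = (\<Sum>j\<in>hbasis H'. P i j * act' j x)))}"

text \<open>
  The number of Hopf-Galois structures of type $N$ on $L/K$. It is written $e(G,N)$ when $L/K$ is
  Galois with group isomorphic to $G$.
\<close>

definition hopf_galois_count :: "'l::field set \<Rightarrow> ('g, 'm) monoid_scheme \<Rightarrow> nat" where
  "hopf_galois_count K N = card (hopf_galois_structures K N // hopf_galois_iso K N)"

end

theory Submission
  imports Defs "HOL-Number_Theory.Pocklington"
begin

text \<open>
  Call a homomorphism $\beta : G \to \mathrm{Hol}(N)$ regular if $g \mapsto \beta(g) \cdot 1$ is a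
  bijection $G \to N$. The group $\mathrm{Aut}(G)$ acts freely on these homomorphisms and its orbits are
  the regular subgroups isomorphic to $G$, so their number is $e'(G,N)\,|\mathrm{Aut}(G)|$. It is also
  $e(G,N)\,|\mathrm{Aut}(N)|$: an isomorphism $L \otimes_K H \cong L[N]$ makes $N$ act on $L$ through a
  bijection onto $\mathrm{Gal}(L/K)$, and $\mathrm{Gal}(L/K)$ acts semilinearly on $L \otimes_K H$,
  permuting the grouplike elements $N$. Together this is a regular homomorphism, determined by the
  structure up to $\mathrm{Aut}(N)$, and Galois descent of $L[N]$ produces a structure from
  every regular homomorphism.

  For $N = \mathbb{Z}_q \rtimes \mathbb{Z}_{p^n}$ the holomorph has explicit coordinates. A homomorphism
  from $G$ is a pair of images of the two generators subject to the defining relations, and by the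
  lifting-the-exponent lemma regularity becomes a condition on few of the coordinates, so that the pairs can be
  counted.
\<close>

section \<open>Regular subgroups and regular embeddings\<close>

text \<open>Byott's formula is not invoked: $e$ and $e'$ share the numerator, the number of regular
  embeddings, and embeddings of a presented group are easier to count than subgroups. Dimension
  arguments over \<open>K\<close> are replaced by Galois coordinates, which give independence of the
  Galois elements, spanning of \<open>End K\<close> and descent alike. For noncyclic
  \<open>N\<close> the Sylow \<open>q\<close>-subgroup of the holomorph is a plane over the field
  with \<open>q\<close> elements. In suitable coordinates the image \<open>S\<close> of the
  generator of order \<open>p ^ n\<close> scales its two axes by \<open>D * K s\<close> and
  \<open>D\<close>. These scalars differ, as \<open>s\<close> is prime to \<open>p\<close>, so the
  image of the generator of order \<open>q\<close> lies on one of the two axes. Hence the factor 2,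
  and its absence for cyclic \<open>N\<close>, where one axis disappears. Triviality of the
  \<open>p ^ n\<close>-th power of \<open>S\<close> kills the coordinate of \<open>S\<close> along
  an axis with scalar 1. If both groups are \<open>G_b\<close>, this happens in each family exactly
  for the \<open>p ^ (n - b)\<close> units \<open>s\<close> in one residue class modulo
  \<open>p ^ b\<close>, which yields the two terms of the first formula.\<close>

lemma auto_closed: "\<zeta> \<in> auto N \<Longrightarrow> x \<in> carrier N \<Longrightarrow> \<zeta> x \<in> carrier N"
  by (auto simp: auto_def hom_def)

lemma auto_mult:
  "\<zeta> \<in> auto N \<Longrightarrow> x \<in> carrier N \<Longrightarrow> y \<in> carrier N \<Longrightarrow> \<zeta> (x \<otimes>\<^bsub>N\<^esub> y) = \<zeta> x \<otimes>\<^bsub>N\<^esub> \<zeta> y"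
  by (auto simp: auto_def hom_def)

lemma auto_one: "group N \<Longrightarrow> \<zeta> \<in> auto N \<Longrightarrow> \<zeta> \<one>\<^bsub>N\<^esub> = \<one>\<^bsub>N\<^esub>"
  by (auto simp: auto_def intro: hom_one)

lemma auto_bij: "\<zeta> \<in> auto N \<Longrightarrow> bij_betw \<zeta> (carrier N) (carrier N)"
  by (auto simp: auto_def Bij_def)

lemma auto_extensional: "\<zeta> \<in> auto N \<Longrightarrow> \<zeta> \<in> extensional (carrier N)"
  by (auto simp: auto_def Bij_def)

lemma autoI:
  "\<zeta> \<in> iso N N \<Longrightarrow> \<zeta> \<in> extensional (carrier N) \<Longrightarrow> \<zeta> \<in> auto N"
  by (auto simp: auto_def Bij_def iso_def)

lemma auto_iso: "\<zeta> \<in> auto N \<Longrightarrow> \<zeta> \<in> iso N N"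
  by (auto simp: auto_def Bij_def iso_def)

lemma carrier_AutoGroup [simp]: "carrier (AutoGroup N) = auto N"
  by (simp add: AutoGroup_def)

lemma one_AutoGroup [simp]: "\<one>\<^bsub>AutoGroup N\<^esub> = (\<lambda>x\<in>carrier N. x)"
  by (simp add: AutoGroup_def BijGroup_def)

lemma mult_AutoGroup:
  "\<zeta> \<in> auto N \<Longrightarrow> \<xi> \<in> auto N \<Longrightarrow> \<zeta> \<otimes>\<^bsub>AutoGroup N\<^esub> \<xi> = compose (carrier N) \<zeta> \<xi>"
  by (simp add: AutoGroup_def BijGroup_def auto_def)

lemma finite_auto: "finite (carrier N) \<Longrightarrow> finite (auto N)"
  by (rule finite_subset[of _ "carrier N \<rightarrow>\<^sub>E carrier N"])
     (auto simp: PiE_iff auto_closed dest: auto_extensional[THEN extensional_arb] intro!: finite_PiE)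

lemma carrier_semidirect [simp]: "carrier (semidirect_product N H \<theta>) = carrier N \<times> carrier H"
  by (simp add: semidirect_product_def)

lemma mult_semidirect [simp]:
  "(a, h) \<otimes>\<^bsub>semidirect_product N H \<theta>\<^esub> (b, k) = (a \<otimes>\<^bsub>N\<^esub> \<theta> h b, h \<otimes>\<^bsub>H\<^esub> k)"
  by (simp add: semidirect_product_def)

lemma one_semidirect [simp]: "\<one>\<^bsub>semidirect_product N H \<theta>\<^esub> = (\<one>\<^bsub>N\<^esub>, \<one>\<^bsub>H\<^esub>)"
  by (simp add: semidirect_product_def)

lemma group_semidirect:
  assumes N: "group N" and H: "group H" and \<theta>: "\<theta> \<in> hom H (AutoGroup N)"
  shows "group (semidirect_product N H \<theta>)"
proof -
  interpret N: group N by fact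
  interpret H: group H by fact
  have mem: "\<theta> h \<in> auto N" if "h \<in> carrier H" for h
    using \<theta> that by (auto simp: hom_def)
  have clo: "\<theta> h a \<in> carrier N" if "h \<in> carrier H" "a \<in> carrier N" for h a
    by (rule auto_closed[OF mem]) (use that in auto)
  have mul: "\<theta> (h \<otimes>\<^bsub>H\<^esub> k) a = \<theta> h (\<theta> k a)" if "h \<in> carrier H" "k \<in> carrier H" "a \<in> carrier N" for h k a
    using \<theta> that mem by (auto simp: hom_def mult_AutoGroup compose_def)
  have one: "\<theta> \<one>\<^bsub>H\<^esub> a = a" if "a \<in> carrier N" for a
  proof -
    have "\<theta> \<one>\<^bsub>H\<^esub> = \<one>\<^bsub>AutoGroup N\<^esub>"
      by (rule hom_one[OF \<theta> H N.AutoGroup])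
    then show ?thesis using that by simp
  qed
  show ?thesis
  proof (rule groupI)
    fix x assume "x \<in> carrier (semidirect_product N H \<theta>)"
    then obtain a h where x: "x = (a, h)" "a \<in> carrier N" "h \<in> carrier H" by auto
    let ?y = "(\<theta> (inv\<^bsub>H\<^esub> h) (inv\<^bsub>N\<^esub> a), inv\<^bsub>H\<^esub> h)"
    have "\<theta> (inv\<^bsub>H\<^esub> h) (inv\<^bsub>N\<^esub> a) \<otimes>\<^bsub>N\<^esub> \<theta> (inv\<^bsub>H\<^esub> h) a = \<one>\<^bsub>N\<^esub>"
      using x auto_mult[OF mem, of "inv\<^bsub>H\<^esub> h" "inv\<^bsub>N\<^esub> a" a] auto_one[OF N mem] by simp
    then show "\<exists>y\<in>carrier (semidirect_product N H \<theta>). y \<otimes>\<^bsub>semidirect_product N H \<theta>\<^esub> x = \<one>\<^bsub>semidirect_product N H \<theta>\<^esub>"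
      using x clo by (intro bexI[of _ ?y]) auto
  qed (auto simp: clo mul one N.m_assoc H.m_assoc auto_mult[OF mem])
qed

lemma group_holomorph: "group N \<Longrightarrow> group (holomorph N)"
  unfolding holomorph_def
  by (rule group_semidirect) (auto simp: group.AutoGroup hom_def group.is_monoid monoid.m_closed
      intro: monoid.m_closed[OF group.is_monoid[OF group.AutoGroup], simplified])

lemma carrier_holomorph [simp]: "carrier (holomorph N) = carrier N \<times> auto N"
  by (simp add: holomorph_def)

lemma mult_holomorph:
  "\<zeta> \<in> auto N \<Longrightarrow> \<xi> \<in> auto N \<Longrightarrow>
   (a, \<zeta>) \<otimes>\<^bsub>holomorph N\<^esub> (b, \<xi>) = (a \<otimes>\<^bsub>N\<^esub> \<zeta> b, compose (carrier N) \<zeta> \<xi>)"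
  by (simp add: holomorph_def mult_AutoGroup)

lemma one_holomorph [simp]: "\<one>\<^bsub>holomorph N\<^esub> = (\<one>\<^bsub>N\<^esub>, \<lambda>x\<in>carrier N. x)"
  by (simp add: holomorph_def)

lemma hol_act_one: "group N \<Longrightarrow> g \<in> carrier (holomorph N) \<Longrightarrow> hol_act N g \<one>\<^bsub>N\<^esub> = fst g"
  by (cases g) (auto simp: hol_act_def auto_one group.is_monoid monoid.r_one)

lemma hol_act_mult:
  assumes "group N" "g \<in> carrier (holomorph N)" "h \<in> carrier (holomorph N)" "x \<in> carrier N"
  shows "hol_act N (g \<otimes>\<^bsub>holomorph N\<^esub> h) x = hol_act N g (hol_act N h x)"
proof -
  interpret group N by fact
  show ?thesis
    using assms by (cases g; cases h)
      (auto simp: hol_act_def mult_holomorph auto_closed auto_mult m_assoc compose_def)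
qed

text \<open>\<open>fst (\<beta> g)\<close> is the image of the identity of \<open>N\<close> under
  \<open>\<beta> g\<close>. Restricting to \<open>extensional\<close> functions makes
  \<open>card\<close> count homomorphisms.\<close>

definition regular_embeddings ::
    "('g, 'm) monoid_scheme \<Rightarrow> ('a, 'k) monoid_scheme \<Rightarrow> ('g \<Rightarrow> 'a \<times> ('a \<Rightarrow> 'a)) set" where
  "regular_embeddings G N =
     {\<beta> \<in> hom G (holomorph N) \<inter> extensional (carrier G).
        bij_betw (\<lambda>g. fst (\<beta> g)) (carrier G) (carrier N)}"

text \<open>Simple transitivity can be tested at the identity, whose image under an element is the
  first component: if \<open>gx\<close> and \<open>gy\<close> carry the identity to \<open>x\<close>
  and \<open>y\<close>, an element of \<open>\<Gamma>\<close> sends \<open>x\<close> to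
  \<open>y\<close> exactly if it is \<open>gy\<close> times the inverse of
  \<open>gx\<close>.\<close>

lemma regular_subgroup_iff:
  assumes N: "group N" and \<Gamma>: "subgroup \<Gamma> (holomorph N)"
  shows "regular_subgroup \<Gamma> N \<longleftrightarrow> bij_betw fst \<Gamma> (carrier N)"
proof
  interpret N: group N by fact
  interpret H: group "holomorph N" by (rule group_holomorph[OF N])
  have sub: "\<Gamma> \<subseteq> carrier (holomorph N)" by (rule subgroup.subset[OF \<Gamma>])
  {
    assume "regular_subgroup \<Gamma> N"
    then have *: "\<exists>!\<gamma>. \<gamma> \<in> \<Gamma> \<and> hol_act N \<gamma> \<one>\<^bsub>N\<^esub> = y" if "y \<in> carrier N" for y
      using that by (auto simp: regular_subgroup_def)
    have *: "\<exists>!\<gamma>. \<gamma> \<in> \<Gamma> \<and> fst \<gamma> = y" if "y \<in> carrier N" for y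
      using *[OF that] hol_act_one[OF N] sub by (metis (no_types, lifting) subsetD)
    have "fst \<gamma> \<in> carrier N" if "\<gamma> \<in> \<Gamma>" for \<gamma>
      using that sub by auto
    then show "bij_betw fst \<Gamma> (carrier N)"
      using * unfolding bij_betw_def inj_on_def by (metis (no_types, lifting) image_eqI subsetI subset_antisym image_subsetI)
  }
  {
    assume bij: "bij_betw fst \<Gamma> (carrier N)"
    have ex1: "\<exists>!\<gamma>. \<gamma> \<in> \<Gamma> \<and> hol_act N \<gamma> x = y" if x: "x \<in> carrier N" and y: "y \<in> carrier N" for x y
    proof -
      obtain gx where gx: "gx \<in> \<Gamma>" "fst gx = x" using bij x unfolding bij_betw_def by force
      obtain gy where gy: "gy \<in> \<Gamma>" "fst gy = y" using bij y unfolding bij_betw_def by force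
      have gxc: "gx \<in> carrier (holomorph N)" and gyc: "gy \<in> carrier (holomorph N)"
        using gx gy sub by auto
      have key: "hol_act N \<gamma> x = y \<longleftrightarrow> \<gamma> = gy \<otimes>\<^bsub>holomorph N\<^esub> inv\<^bsub>holomorph N\<^esub> gx" if g: "\<gamma> \<in> \<Gamma>" for \<gamma>
      proof -
        have gc: "\<gamma> \<in> carrier (holomorph N)" using g sub by auto
        have "hol_act N \<gamma> x = hol_act N \<gamma> (hol_act N gx \<one>\<^bsub>N\<^esub>)"
          using hol_act_one[OF N gxc] gx by simp
        also have "\<dots> = hol_act N (\<gamma> \<otimes>\<^bsub>holomorph N\<^esub> gx) \<one>\<^bsub>N\<^esub>"
          using hol_act_mult[OF N gc gxc] by simp
        also have "\<dots> = fst (\<gamma> \<otimes>\<^bsub>holomorph N\<^esub> gx)"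
          using hol_act_one[OF N] gc gxc by blast
        finally have "hol_act N \<gamma> x = y \<longleftrightarrow> fst (\<gamma> \<otimes>\<^bsub>holomorph N\<^esub> gx) = fst gy"
          using gy by simp
        also have "\<dots> \<longleftrightarrow> \<gamma> \<otimes>\<^bsub>holomorph N\<^esub> gx = gy"
          using bij subgroup.m_closed[OF \<Gamma> g gx(1)] gy unfolding bij_betw_def inj_on_def by blast
        also have "\<dots> \<longleftrightarrow> \<gamma> = gy \<otimes>\<^bsub>holomorph N\<^esub> inv\<^bsub>holomorph N\<^esub> gx"
          using H.inv_solve_right'[OF gc gyc gxc] by (metis H.inv_solve_right gc gxc gyc)
        finally show ?thesis .
      qed
      have "gy \<otimes>\<^bsub>holomorph N\<^esub> inv\<^bsub>holomorph N\<^esub> gx \<in> \<Gamma>"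
        using \<Gamma> gx gy by (simp add: subgroup.m_closed subgroup.m_inv_closed)
      then show ?thesis using key by metis
    qed
    then show "regular_subgroup \<Gamma> N"
      using \<Gamma> by (auto simp: regular_subgroup_def)
  }
qed

lemma finite_regular_embeddings:
  "finite (carrier G) \<Longrightarrow> finite (carrier N) \<Longrightarrow> finite (regular_embeddings G N)"
  by (rule finite_subset[of _ "carrier G \<rightarrow>\<^sub>E carrier (holomorph N)"])
     (auto simp: regular_embeddings_def hom_def finite_auto PiE_iff dest: extensional_arb intro!: finite_PiE)

lemma restrict_compose_hom:
  assumes "group G" "f \<in> hom G H" "h \<in> hom H I"
  shows "compose (carrier G) h f \<in> hom G I"
  using assms by (auto simp: hom_def compose_def Pi_iff group.is_monoid monoid.m_closed)

lemma iso_compose: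
  assumes "group G" "a \<in> iso G J" "b \<in> iso J I"
  shows "compose (carrier G) b a \<in> iso G I"
  using iso_set_trans[OF assms(2,3)] group.iso_eq[OF assms(1), of "b \<circ> a" I "compose (carrier G) b a"]
  by (auto simp: compose_def)

text \<open>Composition with the fixed \<open>f\<close> turns automorphisms of \<open>G\<close> into
  isomorphisms onto \<open>H\<close>. This is the size of a fibre when embeddings are sorted by
  their image.\<close>

lemma card_isos:
  assumes G: "group G" and f: "f \<in> iso G H" "f \<in> extensional (carrier G)"
  shows "card {h \<in> iso G H. h \<in> extensional (carrier G)} = card (auto G)"
proof -
  interpret group G by fact
  have fb: "bij_betw f (carrier G) (carrier H)" using f by (auto simp: iso_def)
  define f' where "f' = inv_into (carrier G) f"
  have f': "f' \<in> iso H G" unfolding f'_def by (rule iso_set_sym[OF f(1)])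
  have ff': "f (f' y) = y" if "y \<in> carrier H" for y
    using fb that unfolding f'_def by (simp add: bij_betw_inv_into_right)
  have f'f: "f' (f x) = x" if "x \<in> carrier G" for x
    using fb that unfolding f'_def by (simp add: bij_betw_inv_into_left)
  have clo: "f x \<in> carrier H" if "x \<in> carrier G" for x using fb that by (auto simp: bij_betw_def)
  have clo': "f' x \<in> carrier G" if "x \<in> carrier H" for x
    using f' that by (auto simp: iso_def hom_def)
  have "bij_betw (\<lambda>\<alpha>. compose (carrier G) f \<alpha>) (auto G) {h \<in> iso G H. h \<in> extensional (carrier G)}"
  proof (rule bij_betw_byWitness[where f' = "\<lambda>h. compose (carrier G) f' h"])
    show "\<forall>\<alpha>\<in>auto G. compose (carrier G) f' (compose (carrier G) f \<alpha>) = \<alpha>"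
    proof
      fix \<alpha> assume "\<alpha> \<in> auto G"
      then show "compose (carrier G) f' (compose (carrier G) f \<alpha>) = \<alpha>"
        by (intro extensionalityI[of _ "carrier G"]) (auto simp: compose_eq auto_closed f'f auto_extensional)
    qed
    show "\<forall>h\<in>{h \<in> iso G H. h \<in> extensional (carrier G)}. compose (carrier G) f (compose (carrier G) f' h) = h"
    proof clarify
      fix h assume "h \<in> iso G H" "h \<in> extensional (carrier G)"
      then show "compose (carrier G) f (compose (carrier G) f' h) = h"
        by (intro extensionalityI[of _ "carrier G"]) (auto simp: compose_eq ff' iso_def hom_def Pi_iff)
    qed
    show "compose (carrier G) f ` auto G \<subseteq> {h \<in> iso G H. h \<in> extensional (carrier G)}"
      using iso_compose[OF G auto_iso f(1)] by auto
    show "compose (carrier G) f' ` {h \<in> iso G H. h \<in> extensional (carrier G)} \<subseteq> auto G"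
      using iso_compose[OF G _ f'] by (auto intro!: autoI)
  qed
  then show ?thesis by (rule bij_betw_same_card[symmetric])
qed

text \<open>Bijectivity of the first components makes an embedding injective, so it is an
  isomorphism onto its image, and the image passes the test for regularity at the identity.\<close>

lemma regular_embeddings_eq:
  assumes G: "group G" and N: "group N"
  shows "regular_embeddings G N =
    (\<Union>\<Gamma>\<in>{\<Gamma>. regular_subgroup \<Gamma> N \<and> (holomorph N)\<lparr>carrier := \<Gamma>\<rparr> \<cong> G}.
       {\<beta> \<in> iso G ((holomorph N)\<lparr>carrier := \<Gamma>\<rparr>). \<beta> \<in> extensional (carrier G)})" (is "?L = ?R")
proof
  interpret G: group G by fact
  interpret H: group "holomorph N" by (rule group_holomorph[OF N])
  show "?L \<subseteq> ?R"
  proof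
    fix \<beta> assume "\<beta> \<in> ?L"
    then have b: "\<beta> \<in> hom G (holomorph N)" "\<beta> \<in> extensional (carrier G)"
      "bij_betw (\<lambda>g. fst (\<beta> g)) (carrier G) (carrier N)"
      by (auto simp: regular_embeddings_def)
    interpret gh: group_hom G "holomorph N" \<beta>
      using G H.is_group b(1) by (simp add: group_hom_def group_hom_axioms_def)
    let ?\<Gamma> = "\<beta> ` carrier G"
    have sub: "subgroup ?\<Gamma> (holomorph N)" by (rule gh.img_is_subgroup)
    have inj: "inj_on \<beta> (carrier G)" using b(3) unfolding bij_betw_def inj_on_def by metis
    have "bij_betw fst ?\<Gamma> (carrier N)"
      using b(3) by (auto simp: bij_betw_def inj_on_def image_image)
    then have reg: "regular_subgroup ?\<Gamma> N" using regular_subgroup_iff[OF N sub] by simp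
    have iso: "\<beta> \<in> iso G ((holomorph N)\<lparr>carrier := ?\<Gamma>\<rparr>)"
      using inj b by (auto simp: iso_def hom_def bij_betw_def)
    have "(holomorph N)\<lparr>carrier := ?\<Gamma>\<rparr> \<cong> G"
      using iso G.iso_sym unfolding is_iso_def by blast
    then show "\<beta> \<in> ?R" using reg iso b by blast
  qed
  show "?R \<subseteq> ?L"
  proof clarify
    fix \<Gamma> \<beta> assume reg: "regular_subgroup \<Gamma> N" and
      b: "\<beta> \<in> iso G ((holomorph N)\<lparr>carrier := \<Gamma>\<rparr>)" "\<beta> \<in> extensional (carrier G)"
    have sub: "subgroup \<Gamma> (holomorph N)" using reg by (simp add: regular_subgroup_def)
    have bb: "bij_betw \<beta> (carrier G) \<Gamma>" using b by (auto simp: iso_def)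
    have "bij_betw fst \<Gamma> (carrier N)" using reg regular_subgroup_iff[OF N sub] by simp
    then have "bij_betw (\<lambda>g. fst (\<beta> g)) (carrier G) (carrier N)"
      using bij_betw_trans[OF bb] by (simp add: comp_def)
    moreover have "\<beta> \<in> hom G (holomorph N)"
      using b subgroup.subset[OF sub] by (auto simp: iso_def hom_def Pi_iff)
    ultimately show "\<beta> \<in> ?L" using b by (simp add: regular_embeddings_def)
  qed
qed

lemma card_regular_embeddings:
  assumes G: "group G" "finite (carrier G)" and N: "group N" "finite (carrier N)"
  shows "card (regular_embeddings G N) = e' G N * card (auto G)"
proof -
  interpret G: group G by fact
  let ?S = "{\<Gamma>. regular_subgroup \<Gamma> N \<and> (holomorph N)\<lparr>carrier := \<Gamma>\<rparr> \<cong> G}"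
  let ?I = "\<lambda>\<Gamma>. {\<beta> \<in> iso G ((holomorph N)\<lparr>carrier := \<Gamma>\<rparr>). \<beta> \<in> extensional (carrier G)}"
  have "?S \<subseteq> Pow (carrier (holomorph N))"
    unfolding regular_subgroup_def by (blast dest: subgroup.subset)
  moreover have "finite (carrier (holomorph N))"
    using N finite_auto by auto
  ultimately have fin: "finite ?S" by (meson finite_Pow_iff finite_subset)
  have cardI: "card (?I \<Gamma>) = card (auto G)" if "\<Gamma> \<in> ?S" for \<Gamma>
  proof -
    have sub: "subgroup \<Gamma> (holomorph N)" using that by (auto simp: regular_subgroup_def)
    have isoG: "(holomorph N)\<lparr>carrier := \<Gamma>\<rparr> \<cong> G" using that by auto
    interpret g: group "(holomorph N)\<lparr>carrier := \<Gamma>\<rparr>"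
      using sub group_holomorph[OF N(1)] by (rule subgroup.subgroup_is_group)
    obtain f where f: "f \<in> iso G ((holomorph N)\<lparr>carrier := \<Gamma>\<rparr>)"
      using g.iso_sym[OF isoG] unfolding is_iso_def by blast
    show ?thesis
      by (rule card_isos[OF G(1), of "restrict f (carrier G)"])
         (use f G.iso_eq[OF f, of "restrict f (carrier G)"] in auto)
  qed
  have finI: "finite (?I \<Gamma>)" if "\<Gamma> \<in> ?S" for \<Gamma>
    by (rule finite_subset[OF _ finite_regular_embeddings[OF G(2) N(2)]])
       (use regular_embeddings_eq[OF G(1) N(1)] that in blast)
  have "card (regular_embeddings G N) = (\<Sum>\<Gamma>\<in>?S. card (?I \<Gamma>))"
    unfolding regular_embeddings_eq[OF G(1) N(1)]
  proof (rule card_UN_disjoint[OF fin])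
    show "\<forall>\<Gamma>\<in>?S. finite (?I \<Gamma>)" using finI by blast
    show "\<forall>i\<in>?S. \<forall>j\<in>?S. i \<noteq> j \<longrightarrow> ?I i \<inter> ?I j = {}"
      by (auto simp: iso_def bij_betw_def)
  qed
  also have "\<dots> = card ?S * card (auto G)" using cardI by simp
  finally show ?thesis by (simp add: e'_def)
qed

section \<open>Invariance of the counts under isomorphism\<close>

lemma card_regular_embeddings_le_left:
  assumes G: "group G" "finite (carrier G)" and N: "finite (carrier N)" and f: "f \<in> iso G G'"
  shows "card (regular_embeddings G' N) \<le> card (regular_embeddings G N)"
proof (rule card_inj_on_le[where f = "\<lambda>\<beta>. compose (carrier G) \<beta> f"])
  have fb: "bij_betw f (carrier G) (carrier G')" using f by (auto simp: iso_def)
  show "inj_on (\<lambda>\<beta>. compose (carrier G) \<beta> f) (regular_embeddings G' N)"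
  proof (rule inj_onI)
    fix \<beta> \<gamma> assume b: "\<beta> \<in> regular_embeddings G' N" "\<gamma> \<in> regular_embeddings G' N"
      and eq: "compose (carrier G) \<beta> f = compose (carrier G) \<gamma> f"
    show "\<beta> = \<gamma>"
    proof (rule extensionalityI[of _ "carrier G'"])
      show "\<beta> \<in> extensional (carrier G')" "\<gamma> \<in> extensional (carrier G')"
        using b by (auto simp: regular_embeddings_def)
      fix y assume "y \<in> carrier G'"
      then obtain x where "x \<in> carrier G" "y = f x" using fb by (auto simp: bij_betw_def)
      then show "\<beta> y = \<gamma> y" using fun_cong[OF eq, of x] by (simp add: compose_def)
    qed
  qed
  show "(\<lambda>\<beta>. compose (carrier G) \<beta> f) ` regular_embeddings G' N \<subseteq> regular_embeddings G N"
  proof clarify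
    fix \<beta> assume "\<beta> \<in> regular_embeddings G' N"
    then have b: "\<beta> \<in> hom G' (holomorph N)" "bij_betw (\<lambda>g. fst (\<beta> g)) (carrier G') (carrier N)"
      by (auto simp: regular_embeddings_def)
    have "bij_betw (\<lambda>g. fst (compose (carrier G) \<beta> f g)) (carrier G) (carrier N)"
      using bij_betw_trans[OF fb b(2)] by (rule bij_betw_cong[THEN iffD1, rotated]) (simp add: compose_def)
    moreover have "compose (carrier G) \<beta> f \<in> hom G (holomorph N)"
      using restrict_compose_hom[OF G(1) _ b(1), of f] f by (auto simp: iso_def)
    ultimately show "compose (carrier G) \<beta> f \<in> regular_embeddings G N"
      by (simp add: regular_embeddings_def)
  qed
  show "finite (regular_embeddings G N)" by (rule finite_regular_embeddings[OF G(2) N])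
qed

text \<open>Two inequalities, from an isomorphism and from one in the other direction, save
  inverting the composition map.\<close>

lemma card_regular_embeddings_cong_left:
  assumes "group G" "group G'" "finite (carrier G)" "finite (carrier N)" "G \<cong> G'"
  shows "card (regular_embeddings G N) = card (regular_embeddings G' N)"
proof -
  have fin': "finite (carrier G')" using assms(3) iso_finite[OF assms(5)] by simp
  obtain f g where f: "f \<in> iso G G'" and g: "g \<in> iso G' G"
    using assms(5) group.iso_sym[OF assms(1,5)] unfolding is_iso_def by blast
  show ?thesis
    by (rule le_antisym[OF card_regular_embeddings_le_left[OF assms(2) fin' assms(4) g]
          card_regular_embeddings_le_left[OF assms(1,3,4) f]])
qed

text \<open>Transport of structure along \<open>f\<close>. For \<open>N' = N\<close> and an
  automorphism \<open>f\<close> it is conjugation in the automorphism group, which provides the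
  action of \<open>auto N\<close> on embeddings in the count of Hopf-Galois structures.\<close>

definition conj_auto :: "('a, 'm) monoid_scheme \<Rightarrow> ('b, 'k) monoid_scheme \<Rightarrow> ('a \<Rightarrow> 'b) \<Rightarrow> ('a \<Rightarrow> 'a) \<Rightarrow> 'b \<Rightarrow> 'b" where
  "conj_auto N N' f \<zeta> = (\<lambda>y\<in>carrier N'. f (\<zeta> (inv_into (carrier N) f y)))"

lemma conj_auto_apply:
  assumes "f \<in> iso N N'" "x \<in> carrier N"
  shows "conj_auto N N' f \<zeta> (f x) = f (\<zeta> x)"
proof -
  have fb: "bij_betw f (carrier N) (carrier N')" using assms by (auto simp: iso_def)
  then show ?thesis using assms(2)
    by (auto simp: conj_auto_def bij_betw_inv_into_left bij_betw_apply)
qed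

lemma conj_auto_in_auto:
  assumes N: "group N" and N': "group N'" and f: "f \<in> iso N N'" and z: "\<zeta> \<in> auto N"
  shows "conj_auto N N' f \<zeta> \<in> auto N'"
proof (rule autoI)
  have "f \<circ> (\<zeta> \<circ> inv_into (carrier N) f) \<in> iso N' N'"
    using iso_set_trans[OF iso_set_trans[OF group.iso_set_sym[OF N f] auto_iso[OF z]] f] by (simp add: comp_assoc)
  then have "f \<circ> \<zeta> \<circ> inv_into (carrier N) f \<in> iso N' N'" by (simp add: comp_assoc)
  with N' show "conj_auto N N' f \<zeta> \<in> iso N' N'"
    by (rule group.iso_eq) (simp add: conj_auto_def)
  show "conj_auto N N' f \<zeta> \<in> extensional (carrier N')" by (simp add: conj_auto_def)
qed

lemma conj_auto_compose:
  assumes N: "group N" and f: "f \<in> iso N N'" and z: "\<zeta> \<in> auto N" "\<xi> \<in> auto N"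
  shows "conj_auto N N' f (compose (carrier N) \<zeta> \<xi>) =
    compose (carrier N') (conj_auto N N' f \<zeta>) (conj_auto N N' f \<xi>)"
proof (rule extensionalityI[of _ "carrier N'"])
  fix y assume "y \<in> carrier N'"
  then obtain x where x: "x \<in> carrier N" "y = f x" using f by (auto simp: iso_def bij_betw_def)
  have "f x \<in> carrier N'" using x f by (auto simp: iso_def bij_betw_def)
  then show "conj_auto N N' f (compose (carrier N) \<zeta> \<xi>) y = compose (carrier N') (conj_auto N N' f \<zeta>) (conj_auto N N' f \<xi>) y"
    using x z auto_closed by (simp add: compose_eq conj_auto_apply[OF f] auto_closed)
qed (auto simp: conj_auto_def)

lemma conj_hol_hom:
  assumes N: "group N" and N': "group N'" and f: "f \<in> iso N N'"
  shows "map_prod f (conj_auto N N' f) \<in> hom (holomorph N) (holomorph N')"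
  using f conj_auto_in_auto[OF N N' f] conj_auto_compose[OF N f]
  by (auto simp: hom_def mult_holomorph iso_def Pi_iff conj_auto_apply[OF f] auto_closed)

lemma conj_auto_inj:
  assumes f: "f \<in> iso N N'" and z: "\<zeta> \<in> auto N" "\<xi> \<in> auto N"
    and eq: "conj_auto N N' f \<zeta> = conj_auto N N' f \<xi>"
  shows "\<zeta> = \<xi>"
proof (rule extensionalityI[of _ "carrier N"])
  fix x assume x: "x \<in> carrier N"
  have "f (\<zeta> x) = f (\<xi> x)" using conj_auto_apply[OF f x] eq by metis
  then show "\<zeta> x = \<xi> x" using f x z auto_closed by (auto simp: iso_def bij_betw_def dest!: inj_onD)
qed (use z auto_extensional in auto)

lemma conj_regular_embedding:
  assumes G: "group G" and N: "group N" and N': "group N'" and f: "f \<in> iso N N'" and b: "\<beta> \<in> regular_embeddings G N"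
  shows "compose (carrier G) (map_prod f (conj_auto N N' f)) \<beta> \<in> regular_embeddings G N'"
proof -
  have b': "\<beta> \<in> hom G (holomorph N)" "bij_betw (\<lambda>g. fst (\<beta> g)) (carrier G) (carrier N)"
    using b by (auto simp: regular_embeddings_def)
  have fb: "bij_betw f (carrier N) (carrier N')" using f by (auto simp: iso_def)
  have "bij_betw (\<lambda>g. fst (compose (carrier G) (map_prod f (conj_auto N N' f)) \<beta> g)) (carrier G) (carrier N')"
    using bij_betw_trans[OF b'(2) fb] by (rule bij_betw_cong[THEN iffD1, rotated]) (simp add: compose_def)
  then show ?thesis
    using restrict_compose_hom[OF G b'(1) conj_hol_hom[OF N N' f]] by (simp add: regular_embeddings_def)
qed

lemma inj_conj_regular_embedding:
  assumes f: "f \<in> iso N N'"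
  shows "inj_on (\<lambda>\<beta>. compose (carrier G) (map_prod f (conj_auto N N' f)) \<beta>) (regular_embeddings G N)"
proof (rule inj_onI)
  fix \<beta> \<gamma> assume b: "\<beta> \<in> regular_embeddings G N" "\<gamma> \<in> regular_embeddings G N"
    and eq: "compose (carrier G) (map_prod f (conj_auto N N' f)) \<beta> = compose (carrier G) (map_prod f (conj_auto N N' f)) \<gamma>"
  show "\<beta> = \<gamma>"
  proof (rule extensionalityI[of _ "carrier G"])
    show "\<beta> \<in> extensional (carrier G)" "\<gamma> \<in> extensional (carrier G)"
      using b by (auto simp: regular_embeddings_def)
    fix x assume x: "x \<in> carrier G"
    then have mem: "\<beta> x \<in> carrier N \<times> auto N" "\<gamma> x \<in> carrier N \<times> auto N"
      using b by (auto simp: regular_embeddings_def hom_def)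
    have "map_prod f (conj_auto N N' f) (\<beta> x) = map_prod f (conj_auto N N' f) (\<gamma> x)"
      using fun_cong[OF eq, of x] x by (simp add: compose_def)
    then show "\<beta> x = \<gamma> x"
      using mem conj_auto_inj[OF f] f
      by (cases "\<beta> x"; cases "\<gamma> x") (auto simp: iso_def bij_betw_def dest!: inj_onD)
  qed
qed

lemma card_regular_embeddings_cong_right:
  assumes "group N" "group N'" "group G" "finite (carrier G)" "finite (carrier N)" "N \<cong> N'"
  shows "card (regular_embeddings G N) = card (regular_embeddings G N')"
proof -
  \<comment> \<open>The types are left free, so that the inequality applies in both
    directions.\<close>
  have le: "card (regular_embeddings G N) \<le> card (regular_embeddings G N')"
    if "group N" "group N'" "finite (carrier N')" "f \<in> iso N N'" 
    for f and N :: "('x, 'y) monoid_scheme" and N' :: "('z, 'w) monoid_scheme"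
    by (rule card_inj_on_le[OF inj_conj_regular_embedding[OF that(4)]])
       (use conj_regular_embedding[OF assms(3) that(1,2,4)] finite_regular_embeddings[OF assms(4) that(3)] in auto)
  obtain f g where f: "f \<in> iso N N'" and g: "g \<in> iso N' N"
    using assms(6) group.iso_sym[OF assms(1,6)] unfolding is_iso_def by blast
  have fin': "finite (carrier N')" using assms(5) iso_finite[OF assms(6)] by simp
  show ?thesis by (rule le_antisym[OF le[OF assms(1,2) fin' f] le[OF assms(2,1,5) g]])
qed

lemma card_auto_cong:
  assumes "group N" "group N'" "finite (carrier N)" "N \<cong> N'"
  shows "card (auto N) = card (auto N')"
proof -
  have le: "card (auto N) \<le> card (auto N')"
    if "group N" "group N'" "finite (carrier N')" "f \<in> iso N N'" 
    for f and N :: "('x, 'y) monoid_scheme" and N' :: "('z, 'w) monoid_scheme"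
    by (rule card_inj_on_le[of "conj_auto N N' f"])
       (use conj_auto_inj[OF that(4)] conj_auto_in_auto[OF that(1,2,4)] finite_auto[OF that(3)] in \<open>auto intro!: inj_onI\<close>)
  obtain f g where f: "f \<in> iso N N'" and g: "g \<in> iso N' N"
    using assms(4) group.iso_sym[OF assms(1,4)] unfolding is_iso_def by blast
  have fin': "finite (carrier N')" using assms(3) iso_finite[OF assms(4)] by simp
  show ?thesis by (rule le_antisym[OF le[OF assms(1,2) fin' f] le[OF assms(2,1,3) g]])
qed

section \<open>Galois coordinates\<close>

lemma mem_Gal:
  "\<sigma> \<in> carrier (Gal K) \<longleftrightarrow> bij \<sigma> \<and> (\<forall>x y. \<sigma> (x + y) = \<sigma> x + \<sigma> y) \<and>
     (\<forall>x y. \<sigma> (x * y) = \<sigma> x * \<sigma> y) \<and> (\<forall>x\<in>K. \<sigma> x = x)"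
  by (simp add: Gal_def)

lemma mult_Gal [simp]: "\<sigma> \<otimes>\<^bsub>Gal K\<^esub> \<tau> = \<sigma> \<circ> \<tau>"
  by (simp add: Gal_def)

lemma one_Gal [simp]: "\<one>\<^bsub>Gal K\<^esub> = id"
  by (simp add: Gal_def)

lemma Gal_inv: "\<sigma> \<in> carrier (Gal K) \<Longrightarrow> inv_into UNIV \<sigma> \<in> carrier (Gal K)"
proof -
  assume s: "\<sigma> \<in> carrier (Gal K)"
  then have b: "bij \<sigma>" by (simp add: mem_Gal)
  let ?\<tau> = "inv_into UNIV \<sigma>"
  have st: "\<sigma> (?\<tau> x) = x" for x using b by (simp add: bij_is_surj surj_f_inv_f)
  have ts: "?\<tau> (\<sigma> x) = x" for x using b by (simp add: bij_is_inj)
  have "?\<tau> (x + y) = ?\<tau> x + ?\<tau> y" "?\<tau> (x * y) = ?\<tau> x * ?\<tau> y" for x y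
    using ts[of "?\<tau> x + ?\<tau> y"] ts[of "?\<tau> x * ?\<tau> y"] s st by (simp_all add: mem_Gal)
  moreover have "?\<tau> x = x" if "x \<in> K" for x
    using ts[of x] s that by (simp add: mem_Gal)
  ultimately show ?thesis using b by (simp add: mem_Gal bij_imp_bij_inv)
qed

lemma group_Gal: "group (Gal K)"
proof (rule groupI)
  fix \<sigma> assume "\<sigma> \<in> carrier (Gal K)"
  then show "\<exists>\<tau>\<in>carrier (Gal K). \<tau> \<otimes>\<^bsub>Gal K\<^esub> \<sigma> = \<one>\<^bsub>Gal K\<^esub>"
    using Gal_inv[of \<sigma>] by (intro bexI[of _ "inv_into UNIV \<sigma>"]) (auto simp: mem_Gal bij_is_inj)
qed (auto simp: mem_Gal bij_comp comp_assoc intro!: bij_comp)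

text \<open>Bijectivity is left out on purpose: the operators \<open>v n\<close> of a Hopf-Galois
  structure are seen to be ring endomorphisms before they are seen to be surjective.\<close>

locale field_endo =
  fixes \<sigma> :: "'l::field \<Rightarrow> 'l"
  assumes add: "\<sigma> (x + y) = \<sigma> x + \<sigma> y" and mult: "\<sigma> (x * y) = \<sigma> x * \<sigma> y" and one: "\<sigma> 1 = 1"
begin

lemma zero: "\<sigma> 0 = 0"
proof -
  have "\<sigma> 0 + \<sigma> 0 = \<sigma> 0 + 0" using add[of 0 0] by (simp only: add_0_right)
  then show ?thesis by (rule add_left_imp_eq)
qed

lemma uminus: "\<sigma> (- x) = - \<sigma> x"
  using add[of "- x" x] zero by (simp add: eq_neg_iff_add_eq_0)

lemma diff: "\<sigma> (x - y) = \<sigma> x - \<sigma> y"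
  using add[of x "- y"] uminus by simp

lemma sum: "\<sigma> (\<Sum>i\<in>A. f i) = (\<Sum>i\<in>A. \<sigma> (f i))"
  by (induction A rule: infinite_finite_induct) (auto simp: zero add)

lemma nonzero: "x \<noteq> 0 \<Longrightarrow> \<sigma> x \<noteq> 0"
  using mult[of x "inverse x"] one by auto

lemma inj: "inj \<sigma>"
  using nonzero diff by (metis eq_iff_diff_eq_0 injI)

end

lemma Gal_field_endo: "\<sigma> \<in> carrier (Gal K) \<Longrightarrow> field_endo \<sigma>"
proof
  assume s: "\<sigma> \<in> carrier (Gal K)"
  then show "\<sigma> (x + y) = \<sigma> x + \<sigma> y" "\<sigma> (x * y) = \<sigma> x * \<sigma> y" for x y
    unfolding mem_Gal by blast+
  have "\<sigma> (0 + 0) = \<sigma> 0 + \<sigma> 0" using s unfolding mem_Gal by blast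
  then have "\<sigma> 0 = 0" unfolding add_0_right by (metis add_cancel_right_right)
  then have "\<sigma> 1 \<noteq> 0" using s unfolding mem_Gal by (metis bij_pointE zero_neq_one)
  moreover have "\<sigma> (1 * 1) = \<sigma> 1 * \<sigma> 1" using s unfolding mem_Gal by blast
  ultimately show "\<sigma> 1 = 1" by simp
qed

lemma Gal_mult: "\<sigma> \<in> carrier (Gal K) \<Longrightarrow> \<sigma> (x * y) = \<sigma> x * \<sigma> y"
  unfolding mem_Gal by blast

lemma Gal_comp: "\<sigma> \<in> carrier (Gal K) \<Longrightarrow> \<tau> \<in> carrier (Gal K) \<Longrightarrow> \<sigma> \<circ> \<tau> \<in> carrier (Gal K)"
  using group.is_monoid[OF group_Gal, THEN monoid.m_closed, of \<sigma> K \<tau>] by simp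

lemma id_Gal: "id \<in> carrier (Gal K)"
  by (auto simp: mem_Gal)

lemma Gal_comp_inj:
  "\<sigma> \<in> carrier (Gal K) \<Longrightarrow> \<tau> \<in> carrier (Gal K) \<Longrightarrow> inv_into UNIV \<tau> \<circ> \<sigma> = id \<longleftrightarrow> \<sigma> = \<tau>"
  unfolding mem_Gal fun_eq_iff comp_def id_def by (metis bij_inv_eq_iff)

text \<open>
  Given \<open>\<tau>\<close> and \<open>b\<close> with \<open>\<tau> b \<noteq> b\<close>, passing from the family \<open>Z\<close> to the one below multiplies
  \<open>\<Sum> x \<rho>(y)\<close> by \<open>(\<rho> b - \<tau> b) / (b - \<tau> b)\<close>.
\<close>

lemma galois_coordinates_aux:
  fixes K :: "'l::field set"
  assumes "finite S" "S \<subseteq> carrier (Gal K)" "id \<notin> S"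
  shows "\<exists>Z :: ('l \<times> 'l) list. sum_list (map (\<lambda>(x, y). x * y) (Z)) = 1 \<and> (\<forall>\<sigma>\<in>S. sum_list (map (\<lambda>(x, y). x * \<sigma> y) (Z)) = 0)"
  using assms
proof (induction S rule: finite_induct)
  case empty
  show ?case by (intro exI[of _ "[(1, 1)]"]) simp
next
  case (insert \<tau> S)
  then obtain Z :: "('l \<times> 'l) list" where Z: "sum_list (map (\<lambda>(x, y). x * y) (Z)) = 1"
    "\<And>\<sigma>. \<sigma> \<in> S \<Longrightarrow> sum_list (map (\<lambda>(x, y). x * \<sigma> y) (Z)) = 0" by auto
  obtain b where b: "\<tau> b \<noteq> b" using insert.prems by (metis ext id_apply insertI1)
  define u where "u = inverse (b - \<tau> b)"
  define Y where "Y = map (\<lambda>(x, y). (- u * \<tau> b * x, y)) Z @ map (\<lambda>(x, y). (u * x, b * y)) Z"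
  have Y: "sum_list (map (\<lambda>(x, y). x * \<rho> y) (Y)) = u * (\<rho> b - \<tau> b) * sum_list (map (\<lambda>(x, y). x * \<rho> y) (Z))"
    if "\<And>x y. \<rho> (x * y) = \<rho> x * \<rho> y" for \<rho>
  proof -
    have "sum_list (map (\<lambda>(x, y). x * \<rho> y) (map (\<lambda>(x, y). (c * x, y)) Z))
        = c * sum_list (map (\<lambda>(x, y). x * \<rho> y) Z)" for c
      by (induction Z) (auto simp: algebra_simps)
    moreover have "sum_list (map (\<lambda>(x, y). x * \<rho> y) (map (\<lambda>(x, y). (u * x, b * y)) Z))
        = u * \<rho> b * sum_list (map (\<lambda>(x, y). x * \<rho> y) Z)"
      by (induction Z) (auto simp: that algebra_simps)
    ultimately show ?thesis
      by (simp only: Y_def map_append sum_list_append) (simp add: algebra_simps)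
  qed
  show ?case
  proof (intro exI[of _ Y] conjI ballI)
    show "sum_list (map (\<lambda>(x, y). x * y) (Y)) = 1" using Y[of "\<lambda>x. x"] Z b by (simp add: u_def)
    fix \<sigma> assume s: "\<sigma> \<in> insert \<tau> S"
    then have "\<sigma> \<in> carrier (Gal K)" using insert.prems by auto
    then show "sum_list (map (\<lambda>(x, y). x * \<sigma> y) (Y)) = 0"
      using Y[of \<sigma>] Z(2) s by (auto simp: mem_Gal)
  qed
qed

locale finite_galois =
  fixes K :: "'l::field set"
  assumes gal: "finite_galois_extension K" and fin: "finite (carrier (Gal K))"
begin

lemma fixed: "(\<And>\<sigma>. \<sigma> \<in> carrier (Gal K) \<Longrightarrow> \<sigma> x = x) \<Longrightarrow> x \<in> K"
  using gal by (auto simp: finite_galois_extension_def)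

lemma Gal_fixes: "\<sigma> \<in> carrier (Gal K) \<Longrightarrow> x \<in> K \<Longrightarrow> \<sigma> x = x"
  by (auto simp: mem_Gal)

lemma sum_Gal_comp:
  assumes "\<tau> \<in> carrier (Gal K)"
  shows "(\<Sum>\<sigma>\<in>carrier (Gal K). f (\<tau> \<circ> \<sigma>)) = (\<Sum>\<sigma>\<in>carrier (Gal K). f \<sigma>)"
  by (rule sum.reindex_bij_witness[of _ "\<lambda>\<sigma>. inv_into UNIV \<tau> \<circ> \<sigma>" "\<lambda>\<sigma>. \<tau> \<circ> \<sigma>"])
     (use assms in \<open>auto simp: Gal_comp Gal_inv comp_assoc[symmetric], 
        auto simp: mem_Gal bij_is_inj bij_is_surj fun_eq_iff surj_f_inv_f\<close>)

lemma trace_in_K: "(\<Sum>\<sigma>\<in>carrier (Gal K). \<sigma> x) \<in> K"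
proof (rule fixed)
  fix \<tau> assume t: "\<tau> \<in> carrier (Gal K)"
  have "\<tau> (\<Sum>\<sigma>\<in>carrier (Gal K). \<sigma> x) = (\<Sum>\<sigma>\<in>carrier (Gal K). (\<tau> \<circ> \<sigma>) x)"
    using field_endo.sum[OF Gal_field_endo[OF t]] by simp
  then show "\<tau> (\<Sum>\<sigma>\<in>carrier (Gal K). \<sigma> x) = (\<Sum>\<sigma>\<in>carrier (Gal K). \<sigma> x)"
    using sum_Gal_comp[OF t, of "\<lambda>\<sigma>. \<sigma> x"] by simp
qed

text \<open>The case of a single Galois element is \<open>galois_coordinates_aux\<close>; it is used
  for the composite of the inverse of \<open>\<tau>\<close> with \<open>\<sigma>\<close>, and
  \<open>\<tau>\<close> is applied to the result. The families of all \<open>\<tau> (x i)\<close>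
  and all \<open>\<sigma> (y i)\<close> are thus dual to each other.\<close>

lemma galois_coordinates:
  "\<exists>m (x :: nat \<Rightarrow> 'l) y. \<forall>\<sigma>\<in>carrier (Gal K). \<forall>\<tau>\<in>carrier (Gal K).
     (\<Sum>i<m. \<tau> (x i) * \<sigma> (y i)) = (if \<sigma> = \<tau> then 1 else 0)"
proof -
  obtain Z :: "('l \<times> 'l) list" where Z: "sum_list (map (\<lambda>(x, y). x * y) (Z)) = 1"
    "\<And>\<sigma>. \<sigma> \<in> carrier (Gal K) - {id} \<Longrightarrow> sum_list (map (\<lambda>(x, y). x * \<sigma> y) (Z)) = 0"
    using galois_coordinates_aux[OF finite_Diff[OF fin] Diff_subset, of "{id}"] by auto
  have conv: "sum_list (map (\<lambda>(x, y). x * \<rho> y) (Z)) = (\<Sum>i<length Z. fst (Z ! i) * \<rho> (snd (Z ! i)))" for \<rho>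
    by (simp add: sum_list_sum_nth atLeast0LessThan case_prod_unfold)
  have Z': "(\<Sum>i<length Z. fst (Z ! i) * \<sigma> (snd (Z ! i))) = (if \<sigma> = id then 1 else 0)"
    if "\<sigma> \<in> carrier (Gal K)" for \<sigma>
    using Z(2)[of \<sigma>] Z(1) that conv[of \<sigma>] conv[of id] by auto
  show ?thesis
  proof (intro exI ballI)
    fix \<sigma> \<tau> assume s: "\<sigma> \<in> carrier (Gal K)" and t: "\<tau> \<in> carrier (Gal K)"
    interpret t: field_endo \<tau> by (rule Gal_field_endo[OF t])
    have "(\<Sum>i<length Z. \<tau> (fst (Z ! i)) * \<sigma> (snd (Z ! i)))
        = \<tau> (\<Sum>i<length Z. fst (Z ! i) * (inv_into UNIV \<tau> \<circ> \<sigma>) (snd (Z ! i)))"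
      using t by (simp add: t.sum t.mult mem_Gal bij_is_surj surj_f_inv_f)
    also have "\<dots> = (if \<sigma> = \<tau> then 1 else 0)"
      using Z'[OF Gal_comp[OF Gal_inv[OF t] s]] Gal_comp_inj[OF s t] by (simp add: t.zero t.one)
    finally show "(\<Sum>i<length Z. \<tau> (fst (Z ! i)) * \<sigma> (snd (Z ! i))) = (if \<sigma> = \<tau> then 1 else 0)" .
  qed
qed

text \<open>Dedekind's independence of characters: pairing the relation at the points
  \<open>y i\<close> with the dual vector \<open>\<tau> (x i)\<close> isolates the coefficient of
  \<open>\<tau>\<close>.\<close>

lemma Gal_independent:
  assumes "\<And>z. (\<Sum>\<sigma>\<in>carrier (Gal K). a \<sigma> * \<sigma> z) = 0" "\<tau> \<in> carrier (Gal K)"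
  shows "a \<tau> = 0"
proof -
  obtain m and x y :: "nat \<Rightarrow> 'l" where c: "\<forall>\<sigma>\<in>carrier (Gal K). \<forall>\<tau>\<in>carrier (Gal K).
     (\<Sum>i<m. \<tau> (x i) * \<sigma> (y i)) = (if \<sigma> = \<tau> then 1 else 0)"
    using galois_coordinates by blast
  have "0 = (\<Sum>i<m. \<tau> (x i) * (\<Sum>\<sigma>\<in>carrier (Gal K). a \<sigma> * \<sigma> (y i)))"
    by (simp only: assms(1) mult_zero_right sum.neutral_const)
  also have "\<dots> = (\<Sum>\<sigma>\<in>carrier (Gal K). a \<sigma> * (\<Sum>i<m. \<tau> (x i) * \<sigma> (y i)))"
    unfolding sum_distrib_left by (subst sum.swap) (simp add: mult_ac)
  also have "\<dots> = (\<Sum>\<sigma>\<in>carrier (Gal K). if \<sigma> = \<tau> then a \<sigma> else 0)"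
    using c assms(2) by (intro sum.cong) auto
  also have "\<dots> = a \<tau>" using fin assms(2) by simp
  finally show ?thesis by simp
qed

text \<open>By \<open>rep\<close>, the \<open>x i\<close> generate the field over \<open>K\<close>
  with traces as coefficients. A \<open>K\<close>-linear \<open>f\<close> is therefore determined by
  the values \<open>f (x i)\<close>, and writing out the traces exhibits it as a combination of
  Galois elements.\<close>

lemma End_in_span_Gal:
  assumes "f \<in> End K"
  shows "\<exists>a. \<forall>z. f z = (\<Sum>\<sigma>\<in>carrier (Gal K). a \<sigma> * \<sigma> z)"
proof -
  obtain m and x y :: "nat \<Rightarrow> 'l" where c: "\<forall>\<sigma>\<in>carrier (Gal K). \<forall>\<tau>\<in>carrier (Gal K).
     (\<Sum>i<m. \<tau> (x i) * \<sigma> (y i)) = (if \<sigma> = \<tau> then 1 else 0)"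
    using galois_coordinates by blast
  have f0: "f 0 = 0" using assms unfolding End_def by (metis (mono_tags, lifting) add_cancel_right_right mem_Collect_eq)
  have fadd: "f (\<Sum>i\<in>A. g i) = (\<Sum>i\<in>A. f (g i))" for A :: "nat set" and g
    by (induction A rule: infinite_finite_induct) (use assms f0 in \<open>auto simp: End_def\<close>)
  \<comment> \<open>The dual basis formula for the trace form; it is the duality relation for
    \<open>\<tau> = id\<close>.\<close>
  have rep: "z = (\<Sum>i<m. (\<Sum>\<sigma>\<in>carrier (Gal K). \<sigma> (z * y i)) * x i)" for z
  proof -
    have "(\<Sum>i<m. (\<Sum>\<sigma>\<in>carrier (Gal K). \<sigma> (z * y i)) * x i)
        = (\<Sum>i<m. \<Sum>\<sigma>\<in>carrier (Gal K). \<sigma> z * (id (x i) * \<sigma> (y i)))"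
      unfolding sum_distrib_right by (intro sum.cong) (simp_all add: Gal_mult mult_ac)
    also have "\<dots> = (\<Sum>\<sigma>\<in>carrier (Gal K). \<sigma> z * (\<Sum>i<m. id (x i) * \<sigma> (y i)))"
      unfolding sum_distrib_left by (rule sum.swap)
    also have "\<dots> = (\<Sum>\<sigma>\<in>carrier (Gal K). if \<sigma> = id then \<sigma> z else 0)"
      using bspec[OF bspec[OF c] id_Gal] by (intro sum.cong) auto
    finally show ?thesis using fin id_Gal[of K] by simp
  qed
  show ?thesis
  proof (intro exI allI)
    fix z
    have "f z = (\<Sum>i<m. (\<Sum>\<sigma>\<in>carrier (Gal K). \<sigma> (z * y i)) * f (x i))"
      using assms trace_in_K by (subst rep[of z], subst fadd) (auto simp: End_def)
    also have "\<dots> = (\<Sum>i<m. \<Sum>\<sigma>\<in>carrier (Gal K). (\<sigma> (y i) * f (x i)) * \<sigma> z)"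
      unfolding sum_distrib_right by (intro sum.cong) (simp_all add: Gal_mult mult_ac)
    also have "\<dots> = (\<Sum>\<sigma>\<in>carrier (Gal K). (\<Sum>i<m. \<sigma> (y i) * f (x i)) * \<sigma> z)"
      unfolding sum_distrib_right by (rule sum.swap)
    finally show "f z = (\<Sum>\<sigma>\<in>carrier (Gal K). (\<Sum>i<m. \<sigma> (y i) * f (x i)) * \<sigma> z)" .
  qed
qed

lemma Gal_sub_End: "\<sigma> \<in> carrier (Gal K) \<Longrightarrow> \<sigma> \<in> End K"
  by (auto simp: mem_Gal End_def)

end

section \<open>Isomorphisms of Hopf algebras in coordinates\<close>

text \<open>An isomorphism without a field of coefficients and with its inverse \<open>Q\<close>
  named. For \<open>H' = group_hopf N\<close>, row \<open>Q n\<close> lists the coordinates of the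
  group element \<open>n\<close> in the basis of \<open>H\<close>; these rows are the grouplike
  vectors on which everything below rests.\<close>

definition hopf_mats ::
    "('i, 'l::field) hopf \<Rightarrow> ('j, 'l) hopf \<Rightarrow> ('i \<Rightarrow> 'j \<Rightarrow> 'l) \<Rightarrow> ('j \<Rightarrow> 'i \<Rightarrow> 'l) \<Rightarrow> bool" where
  "hopf_mats H H' P Q \<longleftrightarrow>
     (\<forall>i\<in>hbasis H. \<forall>k\<in>hbasis H.
        (\<Sum>j\<in>hbasis H'. P i j * Q j k) = (if i = k then 1 else 0)) \<and>
     (\<forall>j\<in>hbasis H'. \<forall>k\<in>hbasis H'.
        (\<Sum>i\<in>hbasis H. Q j i * P i k) = (if j = k then 1 else 0)) \<and>
     (\<forall>i\<in>hbasis H. \<forall>j\<in>hbasis H. \<forall>t\<in>hbasis H'.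
        (\<Sum>s\<in>hbasis H. hmult H i j s * P s t) =
        (\<Sum>a\<in>hbasis H'. \<Sum>b\<in>hbasis H'. P i a * P j b * hmult H' a b t)) \<and>
     (\<forall>t\<in>hbasis H'. (\<Sum>s\<in>hbasis H. hunit H s * P s t) = hunit H' t) \<and>
     (\<forall>i\<in>hbasis H. \<forall>c\<in>hbasis H'. \<forall>d\<in>hbasis H'.
        (\<Sum>j\<in>hbasis H. \<Sum>k\<in>hbasis H. hcomult H i j k * P j c * P k d) =
        (\<Sum>a\<in>hbasis H'. P i a * hcomult H' a c d)) \<and>
     (\<forall>i\<in>hbasis H. hcounit H i = (\<Sum>a\<in>hbasis H'. P i a * hcounit H' a)) \<and>
     (\<forall>i\<in>hbasis H. \<forall>t\<in>hbasis H'.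
        (\<Sum>s\<in>hbasis H. hantipode H i s * P s t) = (\<Sum>a\<in>hbasis H'. P i a * hantipode H' a t))"

lemma is_hopf_iso_iff:
  fixes H :: "('i, 'l::field) hopf" and H' :: "('j, 'l) hopf"
  shows
  "is_hopf_iso F H H' P \<longleftrightarrow>
     (\<forall>i\<in>hbasis H. \<forall>j\<in>hbasis H'. P i j \<in> F) \<and>
     (\<exists>Q. (\<forall>j\<in>hbasis H'. \<forall>i\<in>hbasis H. Q j i \<in> F) \<and> hopf_mats H H' P Q)"
proof -
  have *: "(A \<and> (\<exists>Q. a Q \<and> b Q \<and> c Q) \<and> R) = (A \<and> (\<exists>Q. a Q \<and> b Q \<and> c Q \<and> R))"
    for A R :: bool and a b c :: "('j \<Rightarrow> 'i \<Rightarrow> 'l) \<Rightarrow> bool"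
    by blast
  show ?thesis unfolding is_hopf_iso_def hopf_mats_def by (rule *)
qed

lemmas hopf_mats_inv_left = hopf_mats_def[THEN iffD1, THEN conjunct1, THEN bspec, THEN bspec]
lemmas hopf_mats_inv_right = hopf_mats_def[THEN iffD1, THEN conjunct2, THEN conjunct1, THEN bspec, THEN bspec]
lemmas hopf_mats_mult = hopf_mats_def[THEN iffD1, THEN conjunct2, THEN conjunct2, THEN conjunct1, THEN bspec, THEN bspec, THEN bspec]
lemmas hopf_mats_unit = hopf_mats_def[THEN iffD1, THEN conjunct2, THEN conjunct2, THEN conjunct2, THEN conjunct1, THEN bspec]
lemmas hopf_mats_comult = hopf_mats_def[THEN iffD1, THEN conjunct2, THEN conjunct2, THEN conjunct2, THEN conjunct2, THEN conjunct1, THEN bspec, THEN bspec, THEN bspec]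
lemmas hopf_mats_counit = hopf_mats_def[THEN iffD1, THEN conjunct2, THEN conjunct2, THEN conjunct2, THEN conjunct2, THEN conjunct2, THEN conjunct1, THEN bspec]
lemmas hopf_mats_antipode = hopf_mats_def[THEN iffD1, THEN conjunct2, THEN conjunct2, THEN conjunct2, THEN conjunct2, THEN conjunct2, THEN conjunct2, THEN bspec, THEN bspec]

lemma hopf_matsI:
  assumes
    "\<And>i k. i \<in> hbasis H \<Longrightarrow> k \<in> hbasis H \<Longrightarrow> (\<Sum>j\<in>hbasis H'. P i j * Q j k) = (if i = k then 1 else 0)"
    "\<And>j k. j \<in> hbasis H' \<Longrightarrow> k \<in> hbasis H' \<Longrightarrow> (\<Sum>i\<in>hbasis H. Q j i * P i k) = (if j = k then 1 else 0)"
    "\<And>i j t. i \<in> hbasis H \<Longrightarrow> j \<in> hbasis H \<Longrightarrow> t \<in> hbasis H' \<Longrightarrow>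
       (\<Sum>s\<in>hbasis H. hmult H i j s * P s t) =
       (\<Sum>a\<in>hbasis H'. \<Sum>b\<in>hbasis H'. P i a * P j b * hmult H' a b t)"
    "\<And>t. t \<in> hbasis H' \<Longrightarrow> (\<Sum>s\<in>hbasis H. hunit H s * P s t) = hunit H' t"
    "\<And>i c d. i \<in> hbasis H \<Longrightarrow> c \<in> hbasis H' \<Longrightarrow> d \<in> hbasis H' \<Longrightarrow>
       (\<Sum>j\<in>hbasis H. \<Sum>k\<in>hbasis H. hcomult H i j k * P j c * P k d) =
       (\<Sum>a\<in>hbasis H'. P i a * hcomult H' a c d)"
    "\<And>i. i \<in> hbasis H \<Longrightarrow> hcounit H i = (\<Sum>a\<in>hbasis H'. P i a * hcounit H' a)"
    "\<And>i t. i \<in> hbasis H \<Longrightarrow> t \<in> hbasis H' \<Longrightarrow>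
       (\<Sum>s\<in>hbasis H. hantipode H i s * P s t) = (\<Sum>a\<in>hbasis H'. P i a * hantipode H' a t)"
  shows "hopf_mats H H' P Q"
  unfolding hopf_mats_def by (intro conjI ballI assms)

lemma sum_delta_left:
  "finite A \<Longrightarrow> a \<in> A \<Longrightarrow> (\<Sum>c\<in>A. (if a = c then 1 else 0) * f c) = (f a :: 'l::comm_ring_1)"
  "finite A \<Longrightarrow> a \<in> A \<Longrightarrow> (\<Sum>c\<in>A. (if c = a then 1 else 0) * f c) = f a"
  "finite A \<Longrightarrow> a \<in> A \<Longrightarrow> (\<Sum>c\<in>A. f c * (if a = c then 1 else 0)) = f a"
  "finite A \<Longrightarrow> a \<in> A \<Longrightarrow> (\<Sum>c\<in>A. f c * (if c = a then 1 else 0)) = f a"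
  by (simp_all add: if_distrib[of "\<lambda>x. x * _"] if_distrib[of "\<lambda>x. _ * x"] cong: if_cong)

lemma sum_bilinear:
  fixes x y :: "_ \<Rightarrow> 'l::comm_ring_1"
  shows "(\<Sum>i\<in>A. \<Sum>j\<in>B. x i * y j * (\<Sum>c\<in>C. \<Sum>d\<in>D. P i c * R j d * Z c d)) =
    (\<Sum>c\<in>C. \<Sum>d\<in>D. (\<Sum>i\<in>A. x i * P i c) * (\<Sum>j\<in>B. y j * R j d) * Z c d)"
proof -
  have "(\<Sum>i\<in>A. \<Sum>j\<in>B. x i * y j * (\<Sum>c\<in>C. \<Sum>d\<in>D. P i c * R j d * Z c d))
      = (\<Sum>i\<in>A. \<Sum>j\<in>B. \<Sum>c\<in>C. \<Sum>d\<in>D. x i * y j * P i c * R j d * Z c d)"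
    by (simp add: sum_distrib_left mult_ac)
  also have "\<dots> = (\<Sum>i\<in>A. \<Sum>c\<in>C. \<Sum>j\<in>B. \<Sum>d\<in>D. x i * y j * P i c * R j d * Z c d)"
    by (intro sum.cong refl sum.swap)
  also have "\<dots> = (\<Sum>c\<in>C. \<Sum>i\<in>A. \<Sum>j\<in>B. \<Sum>d\<in>D. x i * y j * P i c * R j d * Z c d)"
    by (rule sum.swap)
  also have "\<dots> = (\<Sum>c\<in>C. \<Sum>i\<in>A. \<Sum>d\<in>D. \<Sum>j\<in>B. x i * y j * P i c * R j d * Z c d)"
    by (intro sum.cong refl sum.swap)
  also have "\<dots> = (\<Sum>c\<in>C. \<Sum>d\<in>D. \<Sum>i\<in>A. \<Sum>j\<in>B. x i * y j * P i c * R j d * Z c d)"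
    by (intro sum.cong refl sum.swap)
  also have "\<dots> = (\<Sum>c\<in>C. \<Sum>d\<in>D. (\<Sum>i\<in>A. x i * P i c) * (\<Sum>j\<in>B. y j * R j d) * Z c d)"
    unfolding sum_product unfolding sum_distrib_right by (simp add: mult_ac)
  finally show ?thesis .
qed

lemma sum_linear:
  fixes x :: "_ \<Rightarrow> 'l::comm_ring_1"
  shows "(\<Sum>i\<in>A. x i * (\<Sum>c\<in>C. P i c * Z c)) = (\<Sum>c\<in>C. (\<Sum>i\<in>A. x i * P i c) * Z c)"
  by (simp add: sum_distrib_left sum_distrib_right mult_ac) (rule sum.swap)

lemma sum_delta2:
  assumes "finite A" "a \<in> A" "finite B" "b \<in> B"
  shows "(\<Sum>c\<in>A. \<Sum>d\<in>B. (if a = c then 1 else 0) * (if b = d then 1 else 0) * Z c d) = (Z a b :: 'l::comm_ring_1)"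
  using assms by (simp add: mult.assoc sum_distrib_left[symmetric] sum_delta_left)

lemma sum_tensor:
  fixes x :: "_ \<Rightarrow> _ \<Rightarrow> 'l::comm_ring_1"
  shows "(\<Sum>c\<in>C. \<Sum>d\<in>D. (\<Sum>j\<in>A. \<Sum>k\<in>B. x j k * P j c * R k d) * S c * T d) =
    (\<Sum>j\<in>A. \<Sum>k\<in>B. x j k * (\<Sum>c\<in>C. P j c * S c) * (\<Sum>d\<in>D. R k d * T d))"
proof -
  have "(\<Sum>c\<in>C. \<Sum>d\<in>D. (\<Sum>j\<in>A. \<Sum>k\<in>B. x j k * P j c * R k d) * S c * T d)
      = (\<Sum>c\<in>C. \<Sum>d\<in>D. \<Sum>j\<in>A. \<Sum>k\<in>B. x j k * P j c * R k d * S c * T d)"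
    by (simp add: sum_distrib_right)
  also have "\<dots> = (\<Sum>c\<in>C. \<Sum>j\<in>A. \<Sum>d\<in>D. \<Sum>k\<in>B. x j k * P j c * R k d * S c * T d)"
    by (intro sum.cong refl sum.swap)
  also have "\<dots> = (\<Sum>j\<in>A. \<Sum>c\<in>C. \<Sum>d\<in>D. \<Sum>k\<in>B. x j k * P j c * R k d * S c * T d)"
    by (rule sum.swap)
  also have "\<dots> = (\<Sum>j\<in>A. \<Sum>c\<in>C. \<Sum>k\<in>B. \<Sum>d\<in>D. x j k * P j c * R k d * S c * T d)"
    by (intro sum.cong refl sum.swap)
  also have "\<dots> = (\<Sum>j\<in>A. \<Sum>k\<in>B. \<Sum>c\<in>C. \<Sum>d\<in>D. x j k * P j c * R k d * S c * T d)"
    by (intro sum.cong refl sum.swap)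
  also have "\<dots> = (\<Sum>j\<in>A. \<Sum>k\<in>B. x j k * ((\<Sum>c\<in>C. P j c * S c) * (\<Sum>d\<in>D. R k d * T d)))"
    unfolding sum_product unfolding sum_distrib_left by (simp add: mult_ac)
  finally show ?thesis by (simp add: mult.assoc)
qed

lemma sum_inverse_comp:
  fixes U :: "'u \<Rightarrow> 'b \<Rightarrow> 'l::comm_ring_1" and Y :: "'b \<Rightarrow> 'x \<Rightarrow> 'l"
  assumes "finite B"
    and "\<And>i k. i \<in> B \<Longrightarrow> k \<in> B \<Longrightarrow> (\<Sum>j\<in>C. Y i j * Z j k) = (if i = k then 1 else 0)"
  shows "(\<Sum>k\<in>C. (\<Sum>j\<in>B. U i j * Y j k) * (\<Sum>j\<in>B. Z k j * W j l)) = (\<Sum>j\<in>B. U i j * W j l)"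
proof -
  have "(\<Sum>k\<in>C. (\<Sum>j\<in>B. U i j * Y j k) * (\<Sum>j\<in>B. Z k j * W j l))
     = (\<Sum>j\<in>B. U i j * (\<Sum>m\<in>B. (\<Sum>k\<in>C. Y j k * Z k m) * W m l))"
    by (simp only: sum_linear[symmetric])
  then show ?thesis using assms by (simp add: sum_delta_left)
qed

text \<open>Each law for \<open>Q\<close> arises from the law for \<open>P\<close> by inserting a
  product of \<open>P\<close> and \<open>Q\<close> equal to the identity matrix;
  \<open>expand\<close> and \<open>contract\<close> are the two insertions.\<close>

lemma hopf_mats_sym:
  assumes fin: "finite (hbasis H)" "finite (hbasis H')" and h: "hopf_mats H H' P Q"
  shows "hopf_mats H' H Q P"
proof -
  let ?B = "hbasis H" and ?B' = "hbasis H'"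
  have PQ: "(\<Sum>j\<in>?B'. P i j * Q j k) = (if i = k then 1 else 0)" if "i \<in> ?B" "k \<in> ?B" for i k
    using hopf_mats_inv_left[OF h] that by simp
  have QP: "(\<Sum>i\<in>?B. Q j i * P i k) = (if j = k then 1 else 0)" if "j \<in> ?B'" "k \<in> ?B'" for j k
    using hopf_mats_inv_right[OF h] that by simp
  have mul: "(\<Sum>s\<in>?B. hmult H i j s * P s t) = (\<Sum>a\<in>?B'. \<Sum>b\<in>?B'. P i a * P j b * hmult H' a b t)"
    if "i \<in> ?B" "j \<in> ?B" "t \<in> ?B'" for i j t using hopf_mats_mult[OF h] that by simp
  have unit: "(\<Sum>s\<in>?B. hunit H s * P s t) = hunit H' t" if "t \<in> ?B'" for t using hopf_mats_unit[OF h] that by simp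
  have com: "(\<Sum>j\<in>?B. \<Sum>k\<in>?B. hcomult H i j k * P j c * P k d) = (\<Sum>a\<in>?B'. P i a * hcomult H' a c d)"
    if "i \<in> ?B" "c \<in> ?B'" "d \<in> ?B'" for i c d using hopf_mats_comult[OF h] that by simp
  have cou: "hcounit H i = (\<Sum>a\<in>?B'. P i a * hcounit H' a)" if "i \<in> ?B" for i using hopf_mats_counit[OF h] that by simp
  have anti: "(\<Sum>s\<in>?B. hantipode H i s * P s t) = (\<Sum>a\<in>?B'. P i a * hantipode H' a t)"
    if "i \<in> ?B" "t \<in> ?B'" for i t using hopf_mats_antipode[OF h] that by simp
  have expand: "(\<Sum>u\<in>?B'. (\<Sum>s\<in>?B. w s * P s u) * Q u t) = w t" if "t \<in> ?B" for w t
    using that fin by (simp add: sum_linear[symmetric] PQ sum_delta_left)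
  have contract: "(\<Sum>i\<in>?B. Q a i * (\<Sum>c\<in>?B'. P i c * w c)) = w a" if "a \<in> ?B'" for w a
    using that fin by (simp add: sum_linear QP sum_delta_left)
  have "(\<Sum>s\<in>?B'. hmult H' a b s * Q s t) = (\<Sum>i\<in>?B. \<Sum>j\<in>?B. Q a i * Q b j * hmult H i j t)"
    if "a \<in> ?B'" "b \<in> ?B'" "t \<in> ?B" for a b t
  proof -
    have red: "(\<Sum>u\<in>?B'. (\<Sum>c\<in>?B'. \<Sum>d\<in>?B'. P i c * P j d * hmult H' c d u) * Q u t)
         = (\<Sum>c\<in>?B'. \<Sum>d\<in>?B'. P i c * P j d * (\<Sum>u\<in>?B'. hmult H' c d u * Q u t))" for i j
    proof -
      have "(\<Sum>u\<in>?B'. (\<Sum>c\<in>?B'. \<Sum>d\<in>?B'. P i c * P j d * hmult H' c d u) * Q u t)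
         = (\<Sum>u\<in>?B'. \<Sum>c\<in>?B'. \<Sum>d\<in>?B'. P i c * P j d * hmult H' c d u * Q u t)"
        by (simp add: sum_distrib_right)
      also have "\<dots> = (\<Sum>c\<in>?B'. \<Sum>u\<in>?B'. \<Sum>d\<in>?B'. P i c * P j d * hmult H' c d u * Q u t)"
        by (rule sum.swap)
      also have "\<dots> = (\<Sum>c\<in>?B'. \<Sum>d\<in>?B'. \<Sum>u\<in>?B'. P i c * P j d * hmult H' c d u * Q u t)"
        by (intro sum.cong refl sum.swap)
      finally show ?thesis by (simp add: sum_distrib_left mult_ac)
    qed
    have "(\<Sum>i\<in>?B. \<Sum>j\<in>?B. Q a i * Q b j * hmult H i j t)
        = (\<Sum>i\<in>?B. \<Sum>j\<in>?B. Q a i * Q b j * (\<Sum>u\<in>?B'. (\<Sum>c\<in>?B'. \<Sum>d\<in>?B'. P i c * P j d * hmult H' c d u) * Q u t))"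
      using that by (simp add: expand mul[symmetric])
    also have "\<dots> = (\<Sum>i\<in>?B. \<Sum>j\<in>?B. Q a i * Q b j * (\<Sum>c\<in>?B'. \<Sum>d\<in>?B'. P i c * P j d * (\<Sum>u\<in>?B'. hmult H' c d u * Q u t)))"
      by (simp only: red)
    also have "\<dots> = (\<Sum>u\<in>?B'. hmult H' a b u * Q u t)"
      unfolding sum_bilinear using that fin by (simp add: QP sum_delta2)
    finally show ?thesis by simp
  qed
  moreover have "(\<Sum>s\<in>?B'. hunit H' s * Q s t) = hunit H t" if "t \<in> ?B" for t
    using expand[OF that, of "hunit H"] unit by simp
  moreover have "(\<Sum>c\<in>?B'. \<Sum>d\<in>?B'. hcomult H' a c d * Q c j * Q d k) = (\<Sum>i\<in>?B. Q a i * hcomult H i j k)"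
    if "a \<in> ?B'" "j \<in> ?B" "k \<in> ?B" for a j k
  proof -
    have "(\<Sum>c\<in>?B'. \<Sum>d\<in>?B'. hcomult H' a c d * Q c j * Q d k)
       = (\<Sum>c\<in>?B'. \<Sum>d\<in>?B'. (\<Sum>i\<in>?B. Q a i * (\<Sum>j\<in>?B. \<Sum>k\<in>?B. hcomult H i j k * P j c * P k d)) * Q c j * Q d k)"
      using that by (simp add: com contract)
    also have "\<dots> = (\<Sum>c\<in>?B'. \<Sum>d\<in>?B'. \<Sum>i\<in>?B. Q a i * ((\<Sum>j\<in>?B. \<Sum>k\<in>?B. hcomult H i j k * P j c * P k d) * Q c j * Q d k))"
      by (simp add: sum_distrib_right mult.assoc)
    also have "\<dots> = (\<Sum>c\<in>?B'. \<Sum>i\<in>?B. \<Sum>d\<in>?B'. Q a i * ((\<Sum>j\<in>?B. \<Sum>k\<in>?B. hcomult H i j k * P j c * P k d) * Q c j * Q d k))"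
      by (intro sum.cong refl sum.swap)
    also have "\<dots> = (\<Sum>i\<in>?B. \<Sum>c\<in>?B'. \<Sum>d\<in>?B'. Q a i * ((\<Sum>j\<in>?B. \<Sum>k\<in>?B. hcomult H i j k * P j c * P k d) * Q c j * Q d k))"
      by (rule sum.swap)
    also have "\<dots> = (\<Sum>i\<in>?B. Q a i * (\<Sum>c\<in>?B'. \<Sum>d\<in>?B'. (\<Sum>j\<in>?B. \<Sum>k\<in>?B. hcomult H i j k * P j c * P k d) * Q c j * Q d k))"
      by (simp add: sum_distrib_left)
    also have "\<dots> = (\<Sum>i\<in>?B. Q a i * hcomult H i j k)"
      unfolding sum_tensor using that fin by (simp add: PQ sum_delta_left)
    finally show ?thesis .
  qed
  moreover have "hcounit H' a = (\<Sum>i\<in>?B. Q a i * hcounit H i)" if "a \<in> ?B'" for a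
    using contract[OF that, of "hcounit H'"] cou by simp
  moreover have "(\<Sum>s\<in>?B'. hantipode H' a s * Q s t) = (\<Sum>i\<in>?B. Q a i * hantipode H i t)"
    if "a \<in> ?B'" "t \<in> ?B" for a t
  proof -
    have "(\<Sum>i\<in>?B. Q a i * hantipode H i t) = (\<Sum>i\<in>?B. Q a i * (\<Sum>u\<in>?B'. (\<Sum>c\<in>?B'. P i c * hantipode H' c u) * Q u t))"
      using that by (simp add: expand anti[symmetric])
    also have "\<dots> = (\<Sum>i\<in>?B. Q a i * (\<Sum>c\<in>?B'. P i c * (\<Sum>u\<in>?B'. hantipode H' c u * Q u t)))"
      by (simp add: sum_linear)
    finally show ?thesis using contract[OF that(1)] by simp
  qed
  ultimately show ?thesis
    by (intro hopf_matsI PQ QP)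
qed

lemma hopf_mats_trans:
  assumes fin: "finite (hbasis H)" "finite (hbasis H')" "finite (hbasis H'')"
    and h: "hopf_mats H H' P Q" and h': "hopf_mats H' H'' R S"
  shows "hopf_mats H H'' (\<lambda>i k. \<Sum>j\<in>hbasis H'. P i j * R j k) (\<lambda>k i. \<Sum>j\<in>hbasis H'. S k j * Q j i)"
proof -
  let ?B = "hbasis H" and ?B' = "hbasis H'" and ?B'' = "hbasis H''"
  have PQ: "(\<Sum>j\<in>?B'. P i j * Q j k) = (if i = k then 1 else 0)" if "i \<in> ?B" "k \<in> ?B" for i k
    using hopf_mats_inv_left[OF h] that by simp
  have QP: "(\<Sum>i\<in>?B. Q j i * P i k) = (if j = k then 1 else 0)" if "j \<in> ?B'" "k \<in> ?B'" for j k
    using hopf_mats_inv_right[OF h] that by simp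
  have RS: "(\<Sum>j\<in>?B''. R i j * S j k) = (if i = k then 1 else 0)" if "i \<in> ?B'" "k \<in> ?B'" for i k
    using hopf_mats_inv_left[OF h'] that by simp
  have SR: "(\<Sum>i\<in>?B'. S j i * R i k) = (if j = k then 1 else 0)" if "j \<in> ?B''" "k \<in> ?B''" for j k
    using hopf_mats_inv_right[OF h'] that by simp
  have "(\<Sum>k\<in>?B''. (\<Sum>j\<in>?B'. P i j * R j k) * (\<Sum>j\<in>?B'. S k j * Q j l)) = (if i = l then 1 else 0)"
    if "i \<in> ?B" "l \<in> ?B" for i l
    by (subst sum_inverse_comp[OF fin(2)]) (use RS PQ that in simp_all)
  moreover have "(\<Sum>k\<in>?B. (\<Sum>j\<in>?B'. S i j * Q j k) * (\<Sum>j\<in>?B'. P k j * R j l)) = (if i = l then 1 else 0)"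
    if "i \<in> ?B''" "l \<in> ?B''" for i l
    by (subst sum_inverse_comp[OF fin(2)]) (use QP SR that in simp_all)
  moreover have "(\<Sum>s\<in>?B. hmult H i j s * (\<Sum>u\<in>?B'. P s u * R u t)) =
      (\<Sum>a\<in>?B''. \<Sum>b\<in>?B''. (\<Sum>u\<in>?B'. P i u * R u a) * (\<Sum>u\<in>?B'. P j u * R u b) * hmult H'' a b t)"
    if "i \<in> ?B" "j \<in> ?B" "t \<in> ?B''" for i j t
  proof -
    have "(\<Sum>s\<in>?B. hmult H i j s * (\<Sum>u\<in>?B'. P s u * R u t))
       = (\<Sum>u\<in>?B'. (\<Sum>a\<in>?B'. \<Sum>b\<in>?B'. P i a * P j b * hmult H' a b u) * R u t)"
      using hopf_mats_mult[OF h] that by (simp add: sum_linear)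
    also have "\<dots> = (\<Sum>u\<in>?B'. \<Sum>a\<in>?B'. \<Sum>b\<in>?B'. P i a * P j b * (hmult H' a b u * R u t))"
      by (simp add: sum_distrib_right mult.assoc)
    also have "\<dots> = (\<Sum>a\<in>?B'. \<Sum>u\<in>?B'. \<Sum>b\<in>?B'. P i a * P j b * (hmult H' a b u * R u t))"
      by (rule sum.swap)
    also have "\<dots> = (\<Sum>a\<in>?B'. \<Sum>b\<in>?B'. \<Sum>u\<in>?B'. P i a * P j b * (hmult H' a b u * R u t))"
      by (intro sum.cong refl sum.swap)
    also have "\<dots> = (\<Sum>a\<in>?B'. \<Sum>b\<in>?B'. P i a * P j b * (\<Sum>c\<in>?B''. \<Sum>d\<in>?B''. R a c * R b d * hmult H'' c d t))"
      unfolding sum_distrib_left[symmetric] using hopf_mats_mult[OF h'] that by (intro sum.cong refl) simp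
    finally show ?thesis by (simp only: sum_bilinear)
  qed
  moreover have "(\<Sum>s\<in>?B. hunit H s * (\<Sum>u\<in>?B'. P s u * R u t)) = hunit H'' t" if "t \<in> ?B''" for t
    using hopf_mats_unit[OF h] hopf_mats_unit[OF h'] that by (simp add: sum_linear)
  moreover have "(\<Sum>j\<in>?B. \<Sum>k\<in>?B. hcomult H i j k * (\<Sum>u\<in>?B'. P j u * R u c) * (\<Sum>u\<in>?B'. P k u * R u d))
     = (\<Sum>a\<in>?B''. (\<Sum>u\<in>?B'. P i u * R u a) * hcomult H'' a c d)"
    if "i \<in> ?B" "c \<in> ?B''" "d \<in> ?B''" for i c d
  proof -
    have "(\<Sum>j\<in>?B. \<Sum>k\<in>?B. hcomult H i j k * (\<Sum>u\<in>?B'. P j u * R u c) * (\<Sum>u\<in>?B'. P k u * R u d))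
       = (\<Sum>u\<in>?B'. \<Sum>v\<in>?B'. (\<Sum>a\<in>?B'. P i a * hcomult H' a u v) * R u c * R v d)"
      unfolding sum_tensor[symmetric] using hopf_mats_comult[OF h] that by simp
    also have "\<dots> = (\<Sum>u\<in>?B'. \<Sum>v\<in>?B'. \<Sum>a\<in>?B'. P i a * (hcomult H' a u v * R u c * R v d))"
      by (simp add: sum_distrib_right mult.assoc)
    also have "\<dots> = (\<Sum>u\<in>?B'. \<Sum>a\<in>?B'. \<Sum>v\<in>?B'. P i a * (hcomult H' a u v * R u c * R v d))"
      by (intro sum.cong refl sum.swap)
    also have "\<dots> = (\<Sum>a\<in>?B'. \<Sum>u\<in>?B'. \<Sum>v\<in>?B'. P i a * (hcomult H' a u v * R u c * R v d))"
      by (rule sum.swap)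
    also have "\<dots> = (\<Sum>a\<in>?B'. P i a * (\<Sum>b\<in>?B''. R a b * hcomult H'' b c d))"
      unfolding sum_distrib_left[symmetric] using hopf_mats_comult[OF h'] that by (intro sum.cong refl) simp
    finally show ?thesis by (simp only: sum_linear)
  qed
  moreover have "hcounit H i = (\<Sum>a\<in>?B''. (\<Sum>u\<in>?B'. P i u * R u a) * hcounit H'' a)" if "i \<in> ?B" for i
    using hopf_mats_counit[OF h] hopf_mats_counit[OF h'] that by (simp add: sum_linear[symmetric])
  moreover have "(\<Sum>s\<in>?B. hantipode H i s * (\<Sum>u\<in>?B'. P s u * R u t)) = (\<Sum>a\<in>?B''. (\<Sum>u\<in>?B'. P i u * R u a) * hantipode H'' a t)"
    if "i \<in> ?B" "t \<in> ?B''" for i t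
  proof -
    have "(\<Sum>s\<in>?B. hantipode H i s * (\<Sum>u\<in>?B'. P s u * R u t)) = (\<Sum>u\<in>?B'. (\<Sum>a\<in>?B'. P i a * hantipode H' a u) * R u t)"
      using hopf_mats_antipode[OF h] that by (simp add: sum_linear)
    also have "\<dots> = (\<Sum>a\<in>?B'. P i a * (\<Sum>b\<in>?B''. R a b * hantipode H'' b t))"
      using hopf_mats_antipode[OF h'] that by (simp add: sum_linear[symmetric])
    finally show ?thesis by (simp only: sum_linear)
  qed
  ultimately show ?thesis by (intro hopf_matsI)
qed

section \<open>Hopf algebras that become group algebras\<close>

lemma group_hopf_simps [simp]:
  "hbasis (group_hopf N) = carrier N"
  "hmult (group_hopf N) g h k = (if k = g \<otimes>\<^bsub>N\<^esub> h then 1 else 0)"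
  "hunit (group_hopf N) g = (if g = \<one>\<^bsub>N\<^esub> then 1 else 0)"
  "hcomult (group_hopf N) g h k = (if h = g \<and> k = g then 1 else 0)"
  "hcounit (group_hopf N) g = 1"
  "hantipode (group_hopf N) g h = (if h = inv\<^bsub>N\<^esub> g then 1 else 0)"
  by (simp_all add: group_hopf_def)

lemma sum_swap4:
  fixes x :: "_ \<Rightarrow> _ \<Rightarrow> 'l::comm_ring_1"
  shows "(\<Sum>j\<in>A. \<Sum>k\<in>B. x j k * (\<Sum>n\<in>C. \<Sum>m\<in>D. P j n * R k m * Z n m)) =
    (\<Sum>n\<in>C. \<Sum>m\<in>D. (\<Sum>j\<in>A. \<Sum>k\<in>B. x j k * P j n * R k m) * Z n m)"
proof -
  have "(\<Sum>j\<in>A. \<Sum>k\<in>B. x j k * (\<Sum>n\<in>C. \<Sum>m\<in>D. P j n * R k m * Z n m))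
     = (\<Sum>j\<in>A. \<Sum>k\<in>B. \<Sum>n\<in>C. \<Sum>m\<in>D. x j k * P j n * R k m * Z n m)"
    by (simp add: sum_distrib_left mult.assoc)
  also have "\<dots> = (\<Sum>j\<in>A. \<Sum>n\<in>C. \<Sum>k\<in>B. \<Sum>m\<in>D. x j k * P j n * R k m * Z n m)"
    by (intro sum.cong refl sum.swap)
  also have "\<dots> = (\<Sum>n\<in>C. \<Sum>j\<in>A. \<Sum>k\<in>B. \<Sum>m\<in>D. x j k * P j n * R k m * Z n m)"
    by (rule sum.swap)
  also have "\<dots> = (\<Sum>n\<in>C. \<Sum>j\<in>A. \<Sum>m\<in>D. \<Sum>k\<in>B. x j k * P j n * R k m * Z n m)"
    by (intro sum.cong refl sum.swap)
  also have "\<dots> = (\<Sum>n\<in>C. \<Sum>m\<in>D. \<Sum>j\<in>A. \<Sum>k\<in>B. x j k * P j n * R k m * Z n m)"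
    by (intro sum.cong refl sum.swap)
  finally show ?thesis by (simp add: sum_distrib_right)
qed

lemma sum_swap3:
  fixes x :: "_ \<Rightarrow> 'l::comm_ring_1"
  shows "(\<Sum>s\<in>I. (\<Sum>a\<in>A. \<Sum>b\<in>B. f a b * g a b s) * h s) = (\<Sum>a\<in>A. \<Sum>b\<in>B. f a b * (\<Sum>s\<in>I. g a b s * (h s :: 'l)))"
proof -
  have "(\<Sum>s\<in>I. (\<Sum>a\<in>A. \<Sum>b\<in>B. f a b * g a b s) * h s) = (\<Sum>s\<in>I. \<Sum>a\<in>A. \<Sum>b\<in>B. f a b * (g a b s * h s))"
    by (simp add: sum_distrib_right mult.assoc)
  also have "\<dots> = (\<Sum>a\<in>A. \<Sum>s\<in>I. \<Sum>b\<in>B. f a b * (g a b s * h s))"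
    by (rule sum.swap)
  also have "\<dots> = (\<Sum>a\<in>A. \<Sum>b\<in>B. \<Sum>s\<in>I. f a b * (g a b s * h s))"
    by (intro sum.cong refl sum.swap)
  finally show ?thesis by (simp add: sum_distrib_left)
qed

text \<open>The axioms of \<open>hopf_algebra\<close> are not assumed, because in the descent they
  have to be deduced from exactly these data.\<close>

locale hopf_group_type =
  fixes H :: "('i, 'l::field) hopf" and N :: "('g, 'm) monoid_scheme" and P Q
  assumes groupN: "group N" and finN: "finite (carrier N)" and finH: "finite (hbasis H)"
    and mats: "hopf_mats H (group_hopf N) P Q"
begin

sublocale N: group N by (rule groupN)

lemma PQ: "i \<in> hbasis H \<Longrightarrow> k \<in> hbasis H \<Longrightarrow> (\<Sum>a\<in>carrier N. P i a * Q a k) = (if i = k then 1 else 0)"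
  using hopf_mats_inv_left[OF mats] by simp

lemma QP: "a \<in> carrier N \<Longrightarrow> b \<in> carrier N \<Longrightarrow> (\<Sum>i\<in>hbasis H. Q a i * P i b) = (if a = b then 1 else 0)"
  using hopf_mats_inv_right[OF mats] by simp

lemma mats': "hopf_mats (group_hopf N) H Q P"
  by (rule hopf_mats_sym[OF _ _ mats]) (simp_all add: finN finH)

lemma Q_mult:
  "a \<in> carrier N \<Longrightarrow> b \<in> carrier N \<Longrightarrow> t \<in> hbasis H \<Longrightarrow>
   (\<Sum>i\<in>hbasis H. \<Sum>j\<in>hbasis H. Q a i * Q b j * hmult H i j t) = Q (a \<otimes>\<^bsub>N\<^esub> b) t"
  using hopf_mats_mult[OF mats', of a b t] finN by (simp add: sum_delta_left)

lemma Q_unit: "t \<in> hbasis H \<Longrightarrow> hunit H t = Q \<one>\<^bsub>N\<^esub> t"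
  using hopf_mats_unit[OF mats', of t] finN by (simp add: sum_delta_left)

lemma Q_comult:
  assumes "a \<in> carrier N" "j \<in> hbasis H" "k \<in> hbasis H"
  shows "(\<Sum>i\<in>hbasis H. Q a i * hcomult H i j k) = Q a j * Q a k"
proof -
  have "(\<Sum>c\<in>carrier N. \<Sum>d\<in>carrier N. (if c = a \<and> d = a then 1 else 0) * Q c j * Q d k)
      = (\<Sum>c\<in>carrier N. \<Sum>d\<in>carrier N. (if a = c then 1 else 0) * (if a = d then 1 else 0) * (Q c j * Q d k))"
    by (intro sum.cong) auto
  then show ?thesis
    using hopf_mats_comult[OF mats', of a j k] assms finN by (simp add: sum_delta2)
qed

lemma Q_counit: "a \<in> carrier N \<Longrightarrow> (\<Sum>i\<in>hbasis H. Q a i * hcounit H i) = 1"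
  using hopf_mats_counit[OF mats', of a] by simp

lemma P_expand: "i \<in> hbasis H \<Longrightarrow> (\<Sum>a\<in>carrier N. P i a * (\<Sum>s\<in>hbasis H. Q a s * w s)) = w i"
  using finH by (simp add: sum_linear PQ sum_delta_left)

lemma Q_expand: "a \<in> carrier N \<Longrightarrow> (\<Sum>i\<in>hbasis H. Q a i * (\<Sum>b\<in>carrier N. P i b * w b)) = w a"
  using finN by (simp add: sum_linear QP sum_delta_left)

text \<open>A linear function \<open>Z\<close> on the group algebra is evaluated at a product of two
  basis elements. With its analogues \<open>hcomult_sum\<close> and \<open>hantipode_sum\<close> it
  eliminates the structure constants of \<open>H\<close> in favour of sums over
  \<open>N\<close>.\<close>

lemma hmult_sum:
  assumes "i \<in> hbasis H" "j \<in> hbasis H"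
  shows "(\<Sum>s\<in>hbasis H. hmult H i j s * (\<Sum>c\<in>carrier N. P s c * Z c)) =
    (\<Sum>a\<in>carrier N. \<Sum>b\<in>carrier N. P i a * P j b * Z (a \<otimes>\<^bsub>N\<^esub> b))"
proof -
  have "(\<Sum>s\<in>hbasis H. hmult H i j s * (\<Sum>c\<in>carrier N. P s c * Z c))
     = (\<Sum>c\<in>carrier N. (\<Sum>a\<in>carrier N. \<Sum>b\<in>carrier N. P i a * P j b * (if c = a \<otimes>\<^bsub>N\<^esub> b then 1 else 0)) * Z c)"
    using hopf_mats_mult[OF mats] assms by (simp add: sum_linear)
  then show ?thesis using finN by (simp add: sum_swap3 sum_delta_left)
qed

lemma P_comult:
  assumes "i \<in> hbasis H" "c \<in> carrier N" "d \<in> carrier N"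
  shows "(\<Sum>j\<in>hbasis H. \<Sum>k\<in>hbasis H. hcomult H i j k * P j c * P k d) = P i c * (if c = d then 1 else 0)"
proof -
  have "(\<Sum>a\<in>carrier N. P i a * (if c = a \<and> d = a then 1 else 0)) =
     (\<Sum>a\<in>carrier N. (P i a * (if c = d then 1 else 0)) * (if a = c then 1 else 0))"
    by (intro sum.cong) auto
  then show ?thesis
    using hopf_mats_comult[OF mats assms(1), of c d] assms finN by (simp add: sum_delta_left)
qed

lemma hcomult_sum:
  assumes "i \<in> hbasis H"
  shows "(\<Sum>j\<in>hbasis H. \<Sum>k\<in>hbasis H. hcomult H i j k *
      (\<Sum>n\<in>carrier N. \<Sum>m\<in>carrier N. P j n * P k m * Z n m)) = (\<Sum>n\<in>carrier N. P i n * Z n n)"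
  unfolding sum_swap4 using P_comult[OF assms] finN
  by (simp add: mult.assoc sum_distrib_left[symmetric] sum_delta_left)

lemma hantipode_sum:
  assumes "i \<in> hbasis H"
  shows "(\<Sum>s\<in>hbasis H. hantipode H i s * (\<Sum>c\<in>carrier N. P s c * Z c)) = (\<Sum>a\<in>carrier N. P i a * Z (inv\<^bsub>N\<^esub> a))"
proof -
  have "(\<Sum>s\<in>hbasis H. hantipode H i s * (\<Sum>c\<in>carrier N. P s c * Z c))
    = (\<Sum>c\<in>carrier N. (\<Sum>a\<in>carrier N. P i a * (if c = inv\<^bsub>N\<^esub> a then 1 else 0)) * Z c)"
    using hopf_mats_antipode[OF mats] assms by (simp add: sum_linear)
  also have "\<dots> = (\<Sum>a\<in>carrier N. P i a * (\<Sum>c\<in>carrier N. (if c = inv\<^bsub>N\<^esub> a then 1 else 0) * Z c))"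
    by (simp only: sum_linear)
  finally show ?thesis using finN by (simp add: sum_delta_left)
qed

lemma hcounit_eq: "i \<in> hbasis H \<Longrightarrow> hcounit H i = (\<Sum>a\<in>carrier N. P i a)"
  using hopf_mats_counit[OF mats] by simp

lemma hmult_eq:
  assumes "i \<in> hbasis H" "j \<in> hbasis H" "t \<in> hbasis H"
  shows "hmult H i j t = (\<Sum>a\<in>carrier N. P i a * (\<Sum>b\<in>carrier N. P j b * Q (a \<otimes>\<^bsub>N\<^esub> b) t))"
  using hmult_sum[OF assms(1,2), of "\<lambda>c. Q c t"] assms finH
  by (simp add: PQ sum_delta_left sum_distrib_left mult.assoc)

text \<open>\<open>hmult_eq\<close> isolates the row of the first factor, this form the row of the
  second; which one applies depends on the factor whose index is contracted.\<close>

lemma hmult_eq':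
  assumes "i \<in> hbasis H" "j \<in> hbasis H" "t \<in> hbasis H"
  shows "hmult H i j t = (\<Sum>b\<in>carrier N. P j b * (\<Sum>a\<in>carrier N. P i a * Q (a \<otimes>\<^bsub>N\<^esub> b) t))"
  unfolding hmult_eq[OF assms] sum_distrib_left by (subst sum.swap) (simp add: mult.left_commute)

lemma hcomult_eq:
  assumes "i \<in> hbasis H" "j \<in> hbasis H" "k \<in> hbasis H"
  shows "hcomult H i j k = (\<Sum>n\<in>carrier N. P i n * (Q n j * Q n k))"
  using P_expand[OF assms(1), of "\<lambda>i. hcomult H i j k"] assms by (simp add: Q_comult)

text \<open>
  The structure constants are those of the group algebra in another basis, so the axioms hold as soon
  as the constants lie in \<open>K\<close>.
\<close>

lemma hopf_algebraI:
  assumes K: "\<And>i j k. \<lbrakk>i \<in> hbasis H; j \<in> hbasis H; k \<in> hbasis H\<rbrakk> \<Longrightarrow> hmult H i j k \<in> K"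
    "\<And>i. i \<in> hbasis H \<Longrightarrow> hunit H i \<in> K"
    "\<And>i j k. \<lbrakk>i \<in> hbasis H; j \<in> hbasis H; k \<in> hbasis H\<rbrakk> \<Longrightarrow> hcomult H i j k \<in> K"
    "\<And>i. i \<in> hbasis H \<Longrightarrow> hcounit H i \<in> K"
    "\<And>i j. \<lbrakk>i \<in> hbasis H; j \<in> hbasis H\<rbrakk> \<Longrightarrow> hantipode H i j \<in> K"
  shows "hopf_algebra K H"
proof (rule hopf_algebra.intro)
  let ?I = "hbasis H" and ?N = "carrier N"
  have unit_sum: "(\<Sum>s\<in>?I. hunit H s * (\<Sum>c\<in>?N. P s c * Z c)) = Z \<one>\<^bsub>N\<^esub>" for Z
    using Q_expand[of "\<one>\<^bsub>N\<^esub>" Z] by (simp add: Q_unit)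
  have dist: "(\<Sum>a\<in>?N. \<Sum>b\<in>?N. P i a * P j b * Z a b) = (\<Sum>a\<in>?N. P i a * (\<Sum>b\<in>?N. P j b * Z a b))" for i j Z
    by (simp add: sum_distrib_left mult.assoc)
  show "(\<Sum>s\<in>?I. hmult H i j s * hmult H s k t) = (\<Sum>s\<in>?I. hmult H j k s * hmult H i s t)"
    if "i \<in> ?I" "j \<in> ?I" "k \<in> ?I" "t \<in> ?I" for i j k t
  proof -
    have "(\<Sum>s\<in>?I. hmult H i j s * hmult H s k t)
       = (\<Sum>a\<in>?N. \<Sum>b\<in>?N. P i a * P j b * (\<Sum>d\<in>?N. P k d * Q (a \<otimes>\<^bsub>N\<^esub> b \<otimes>\<^bsub>N\<^esub> d) t))"
      using that by (simp add: hmult_eq[of _ k t] hmult_sum)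
    also have "\<dots> = (\<Sum>a\<in>?N. \<Sum>b\<in>?N. \<Sum>d\<in>?N. P j b * P k d * (P i a * Q (a \<otimes>\<^bsub>N\<^esub> (b \<otimes>\<^bsub>N\<^esub> d)) t))"
      by (simp add: sum_distrib_left N.m_assoc mult_ac)
    also have "\<dots> = (\<Sum>b\<in>?N. \<Sum>a\<in>?N. \<Sum>d\<in>?N. P j b * P k d * (P i a * Q (a \<otimes>\<^bsub>N\<^esub> (b \<otimes>\<^bsub>N\<^esub> d)) t))"
      by (rule sum.swap)
    also have "\<dots> = (\<Sum>b\<in>?N. \<Sum>d\<in>?N. \<Sum>a\<in>?N. P j b * P k d * (P i a * Q (a \<otimes>\<^bsub>N\<^esub> (b \<otimes>\<^bsub>N\<^esub> d)) t))"
      by (intro sum.cong refl sum.swap)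
    also have "\<dots> = (\<Sum>b\<in>?N. \<Sum>d\<in>?N. P j b * P k d * (\<Sum>a\<in>?N. P i a * Q (a \<otimes>\<^bsub>N\<^esub> (b \<otimes>\<^bsub>N\<^esub> d)) t))"
      by (simp only: sum_distrib_left)
    also have "\<dots> = (\<Sum>s\<in>?I. hmult H j k s * hmult H i s t)"
      using that by (simp add: hmult_eq'[of i _ t] hmult_sum)
    finally show ?thesis .
  qed
  show "(\<Sum>s\<in>?I. hunit H s * hmult H s i t) = (if i = t then 1 else 0)" if "i \<in> ?I" "t \<in> ?I" for i t
    using that by (simp add: hmult_eq[of _ i t] unit_sum PQ)
  show "(\<Sum>s\<in>?I. hunit H s * hmult H i s t) = (if i = t then 1 else 0)" if "i \<in> ?I" "t \<in> ?I" for i t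
    using that by (simp add: hmult_eq'[of i _ t] unit_sum PQ)
  have com1: "(\<Sum>s\<in>?I. hcomult H i s l * w s) = (\<Sum>n\<in>?N. P i n * (Q n l * (\<Sum>s\<in>?I. Q n s * w s)))"
    if "i \<in> ?I" "l \<in> ?I" for i l w
  proof -
    have "(\<Sum>s\<in>?I. hcomult H i s l * w s) = (\<Sum>n\<in>?N. P i n * (\<Sum>s\<in>?I. Q n s * Q n l * w s))"
      using that by (simp add: hcomult_eq sum_linear)
    then show ?thesis by (simp add: sum_distrib_left mult_ac)
  qed
  have com2: "(\<Sum>s\<in>?I. hcomult H i l s * w s) = (\<Sum>n\<in>?N. P i n * (Q n l * (\<Sum>s\<in>?I. Q n s * w s)))"
    if "i \<in> ?I" "l \<in> ?I" for i l w
  proof -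
    have "(\<Sum>s\<in>?I. hcomult H i l s * w s) = (\<Sum>n\<in>?N. P i n * (\<Sum>s\<in>?I. Q n l * Q n s * w s))"
      using that by (simp add: hcomult_eq sum_linear)
    then show ?thesis by (simp add: sum_distrib_left mult_ac)
  qed
  show "(\<Sum>s\<in>?I. hcomult H i s l * hcomult H s j k) = (\<Sum>s\<in>?I. hcomult H i j s * hcomult H s k l)"
    if "i \<in> ?I" "j \<in> ?I" "k \<in> ?I" "l \<in> ?I" for i j k l
    unfolding com1[OF that(1,4)] com2[OF that(1,2)] using that by (simp add: Q_comult) (simp add: mult_ac)
  show "(\<Sum>s\<in>?I. hcounit H s * hcomult H i s j) = (if i = j then 1 else 0)" if "i \<in> ?I" "j \<in> ?I" for i j
    using that com1[of i j "hcounit H"] by (simp add: Q_counit PQ mult.commute[of "hcounit H _"])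
  show "(\<Sum>s\<in>?I. hcomult H i j s * hcounit H s) = (if i = j then 1 else 0)" if "i \<in> ?I" "j \<in> ?I" for i j
    using that com2[of i j "hcounit H"] by (simp add: Q_counit PQ)
  show "(\<Sum>s\<in>?I. hmult H i j s * hcomult H s k l) =
      (\<Sum>a\<in>?I. \<Sum>b\<in>?I. \<Sum>c\<in>?I. \<Sum>d\<in>?I. hcomult H i a b * hcomult H j c d * hmult H a c k * hmult H b d l)"
    if ij: "i \<in> ?I" "j \<in> ?I" and kl: "k \<in> ?I" "l \<in> ?I" for i j k l
  proof -
    \<comment> \<open>\<open>A a k m\<close> is the coefficient at \<open>k\<close> of the product
      of the basis element \<open>a\<close> with the group element \<open>m\<close>. Naming it
      allows \<open>hcomult_sum\<close> to be used first for \<open>j\<close> and then for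
      \<open>i\<close>.\<close>
    define A where "A a k m = (\<Sum>n\<in>?N. P a n * Q (n \<otimes>\<^bsub>N\<^esub> m) k)" for a k m
    have prod: "(\<Sum>m\<in>?N. P c m * f m) * (\<Sum>m\<in>?N. P d m * g m) = (\<Sum>m\<in>?N. \<Sum>m'\<in>?N. P c m * P d m' * (f m * g m'))" for c d f g
      by (simp add: sum_product mult_ac)
    have "(\<Sum>a\<in>?I. \<Sum>b\<in>?I. \<Sum>c\<in>?I. \<Sum>d\<in>?I. hcomult H i a b * hcomult H j c d * hmult H a c k * hmult H b d l)
       = (\<Sum>a\<in>?I. \<Sum>b\<in>?I. hcomult H i a b * (\<Sum>c\<in>?I. \<Sum>d\<in>?I. hcomult H j c d * (hmult H a c k * hmult H b d l)))"
      by (simp add: sum_distrib_left mult.assoc)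
    also have "\<dots> = (\<Sum>a\<in>?I. \<Sum>b\<in>?I. hcomult H i a b * (\<Sum>m\<in>?N. P j m * (A a k m * A b l m)))"
      using ij kl by (simp add: hmult_eq' A_def[symmetric] prod hcomult_sum)
    also have "\<dots> = (\<Sum>a\<in>?I. \<Sum>b\<in>?I. \<Sum>m\<in>?N. P j m * (hcomult H i a b * (A a k m * A b l m)))"
      by (simp add: sum_distrib_left mult.left_commute)
    also have "\<dots> = (\<Sum>a\<in>?I. \<Sum>m\<in>?N. \<Sum>b\<in>?I. P j m * (hcomult H i a b * (A a k m * A b l m)))"
      by (intro sum.cong refl sum.swap)
    also have "\<dots> = (\<Sum>m\<in>?N. \<Sum>a\<in>?I. \<Sum>b\<in>?I. P j m * (hcomult H i a b * (A a k m * A b l m)))"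
      by (rule sum.swap)
    also have "\<dots> = (\<Sum>m\<in>?N. P j m * (\<Sum>a\<in>?I. \<Sum>b\<in>?I. hcomult H i a b * (A a k m * A b l m)))"
      by (simp only: sum_distrib_left)
    also have "\<dots> = (\<Sum>m\<in>?N. P j m * (\<Sum>n\<in>?N. P i n * (Q (n \<otimes>\<^bsub>N\<^esub> m) k * Q (n \<otimes>\<^bsub>N\<^esub> m) l)))"
      using ij by (simp add: A_def prod hcomult_sum)
    also have "\<dots> = (\<Sum>n\<in>?N. \<Sum>m\<in>?N. P i n * P j m * (Q (n \<otimes>\<^bsub>N\<^esub> m) k * Q (n \<otimes>\<^bsub>N\<^esub> m) l))"
      unfolding sum_distrib_left by (subst sum.swap) (simp add: mult_ac)
    also have "\<dots> = (\<Sum>s\<in>?I. hmult H i j s * hcomult H s k l)"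
      using ij kl by (simp add: hcomult_eq hmult_sum)
    finally show ?thesis by simp
  qed
  show "(\<Sum>s\<in>?I. hunit H s * hcomult H s k l) = hunit H k * hunit H l" if "k \<in> ?I" "l \<in> ?I" for k l
    using that by (simp add: Q_unit Q_comult)
  show "(\<Sum>s\<in>?I. hmult H i j s * hcounit H s) = hcounit H i * hcounit H j" if "i \<in> ?I" "j \<in> ?I" for i j
    using that hmult_sum[of i j "\<lambda>_. 1"] by (simp add: hcounit_eq sum_product)
  show "(\<Sum>s\<in>?I. hunit H s * hcounit H s) = 1"
    using Q_counit[of "\<one>\<^bsub>N\<^esub>"] by (simp add: Q_unit)
  show "(\<Sum>a\<in>?I. \<Sum>b\<in>?I. \<Sum>c\<in>?I. hcomult H i a b * hantipode H a c * hmult H c b t) = hcounit H i * hunit H t"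
    if "i \<in> ?I" "t \<in> ?I" for i t
  proof -
    have "(\<Sum>a\<in>?I. \<Sum>b\<in>?I. \<Sum>c\<in>?I. hcomult H i a b * hantipode H a c * hmult H c b t)
       = (\<Sum>a\<in>?I. \<Sum>b\<in>?I. hcomult H i a b * (\<Sum>c\<in>?I. hantipode H a c * hmult H c b t))"
      by (simp add: sum_distrib_left mult.assoc)
    also have "\<dots> = (\<Sum>a\<in>?I. \<Sum>b\<in>?I. hcomult H i a b * (\<Sum>n\<in>?N. \<Sum>m\<in>?N. P a n * P b m * Q (inv\<^bsub>N\<^esub> n \<otimes>\<^bsub>N\<^esub> m) t))"
      using that by (simp add: hmult_eq[of _ _ t] hantipode_sum dist)
    also have "\<dots> = hcounit H i * hunit H t"
      using that by (simp add: hcomult_sum hcounit_eq Q_unit sum_distrib_right)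
    finally show ?thesis .
  qed
  show "(\<Sum>a\<in>?I. \<Sum>b\<in>?I. \<Sum>c\<in>?I. hcomult H i a b * hantipode H b c * hmult H a c t) = hcounit H i * hunit H t"
    if "i \<in> ?I" "t \<in> ?I" for i t
  proof -
    have sw: "(\<Sum>m\<in>?N. P b m * (\<Sum>n\<in>?N. P a n * Z n m)) = (\<Sum>n\<in>?N. \<Sum>m\<in>?N. P a n * P b m * Z n m)" for a b Z
      unfolding sum_distrib_left by (subst sum.swap) (simp add: mult_ac)
    have "(\<Sum>a\<in>?I. \<Sum>b\<in>?I. \<Sum>c\<in>?I. hcomult H i a b * hantipode H b c * hmult H a c t)
       = (\<Sum>a\<in>?I. \<Sum>b\<in>?I. hcomult H i a b * (\<Sum>c\<in>?I. hantipode H b c * hmult H a c t))"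
      by (simp add: sum_distrib_left mult.assoc)
    also have "\<dots> = (\<Sum>a\<in>?I. \<Sum>b\<in>?I. hcomult H i a b * (\<Sum>n\<in>?N. \<Sum>m\<in>?N. P a n * P b m * Q (n \<otimes>\<^bsub>N\<^esub> inv\<^bsub>N\<^esub> m) t))"
      using that by (simp add: hmult_eq'[of _ _ t] hantipode_sum) (simp add: sw)
    also have "\<dots> = hcounit H i * hunit H t"
      using that by (simp add: hcomult_sum hcounit_eq Q_unit sum_distrib_right)
    finally show ?thesis .
  qed
qed (use finH K in auto)

end

text \<open>The group algebra in the basis of the vectors \<open>P i\<close>, with \<open>Q\<close>
  as inverse matrix. If all constants are fixed by the Galois group, this is a form of the group
  algebra over the base field.\<close>

definition transported_hopf ::
    "'i set \<Rightarrow> ('g, 'm) monoid_scheme \<Rightarrow> ('i \<Rightarrow> 'g \<Rightarrow> 'l::field) \<Rightarrow> ('g \<Rightarrow> 'i \<Rightarrow> 'l) \<Rightarrow> ('i, 'l) hopf" where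
  "transported_hopf I N P Q =
    \<lparr>hbasis = I,
     hmult = (\<lambda>i j s. \<Sum>a\<in>carrier N. \<Sum>b\<in>carrier N. P i a * P j b * Q (a \<otimes>\<^bsub>N\<^esub> b) s),
     hunit = (\<lambda>s. Q \<one>\<^bsub>N\<^esub> s),
     hcomult = (\<lambda>i j k. \<Sum>a\<in>carrier N. P i a * (Q a j * Q a k)),
     hcounit = (\<lambda>i. \<Sum>a\<in>carrier N. P i a),
     hantipode = (\<lambda>i j. \<Sum>a\<in>carrier N. P i a * Q (inv\<^bsub>N\<^esub> a) j)\<rparr>"

lemma transported_hopf_mats:
  assumes N: "group N" "finite (carrier N)" and I: "finite I"
    and PQ: "\<And>i k. i \<in> I \<Longrightarrow> k \<in> I \<Longrightarrow> (\<Sum>a\<in>carrier N. P i a * Q a k) = (if i = k then 1 else (0 :: 'l::field))"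
    and QP: "\<And>a b. a \<in> carrier N \<Longrightarrow> b \<in> carrier N \<Longrightarrow> (\<Sum>i\<in>I. Q a i * P i b) = (if a = b then 1 else 0)"
  shows "hopf_mats (transported_hopf I N P Q) (group_hopf N) P Q"
proof (rule hopf_matsI, simp_all add: transported_hopf_def PQ QP N group.is_monoid monoid.one_closed)
  interpret N: group N by fact
  let ?N = "carrier N"
  show "(\<Sum>s\<in>I. (\<Sum>a\<in>?N. \<Sum>b\<in>?N. P i a * P j b * Q (a \<otimes>\<^bsub>N\<^esub> b) s) * P s t) =
      (\<Sum>a\<in>?N. \<Sum>b\<in>?N. P i a * P j b * (if t = a \<otimes>\<^bsub>N\<^esub> b then 1 else 0))"
    if "t \<in> ?N" for i j t
    using that unfolding sum_swap3 by (intro sum.cong refl) (auto simp: QP)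
  show "(\<Sum>j\<in>I. \<Sum>k\<in>I. (\<Sum>a\<in>?N. P i a * (Q a j * Q a k)) * P j c * P k d) =
      (\<Sum>a\<in>?N. P i a * (if c = a \<and> d = a then 1 else 0))"
    if "c \<in> ?N" "d \<in> ?N" for i c d
  proof -
    have "(\<Sum>j\<in>I. \<Sum>k\<in>I. (\<Sum>a\<in>?N. P i a * (Q a j * Q a k)) * P j c * P k d)
       = (\<Sum>j\<in>I. \<Sum>k\<in>I. \<Sum>a\<in>?N. P i a * ((Q a j * P j c) * (Q a k * P k d)))"
      unfolding sum_distrib_right by (simp add: mult_ac)
    also have "\<dots> = (\<Sum>j\<in>I. \<Sum>a\<in>?N. \<Sum>k\<in>I. P i a * ((Q a j * P j c) * (Q a k * P k d)))"
      by (intro sum.cong refl sum.swap)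
    also have "\<dots> = (\<Sum>a\<in>?N. \<Sum>j\<in>I. \<Sum>k\<in>I. P i a * ((Q a j * P j c) * (Q a k * P k d)))"
      by (rule sum.swap)
    also have "\<dots> = (\<Sum>a\<in>?N. P i a * ((\<Sum>j\<in>I. Q a j * P j c) * (\<Sum>k\<in>I. Q a k * P k d)))"
      unfolding sum_product unfolding sum_distrib_left ..
    finally show ?thesis using that by (auto simp: QP intro!: sum.cong)
  qed
  show "(\<Sum>s\<in>I. (\<Sum>a\<in>?N. P i a * Q (inv\<^bsub>N\<^esub> a) s) * P s t) = (\<Sum>a\<in>?N. P i a * (if t = inv\<^bsub>N\<^esub> a then 1 else 0))"
    if "t \<in> ?N" for i t
    using that unfolding sum_linear[symmetric] by (intro sum.cong refl) (auto simp: QP)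
qed

section \<open>Grouplike elements\<close>

context hopf_group_type
begin

lemma Q_inj:
  assumes "a \<in> carrier N" "b \<in> carrier N" "\<And>i. i \<in> hbasis H \<Longrightarrow> Q a i = Q b i"
  shows "a = b"
proof (rule ccontr)
  assume "a \<noteq> b"
  then have "(\<Sum>i\<in>hbasis H. Q b i * P i a) = 0" using QP[OF assms(2,1)] by simp
  moreover have "(\<Sum>i\<in>hbasis H. Q b i * P i a) = (\<Sum>i\<in>hbasis H. Q a i * P i a)"
    using assms(3) by (intro sum.cong) auto
  ultimately show False using QP[OF assms(1,1)] by simp
qed

end

text \<open>Serves two purposes: with equal identifications it lets \<open>\<sigma>\<close> act
  semilinearly on the group elements, and with \<open>\<sigma>\<close> the identity it compares two
  identifications of the same \<open>H\<close>.\<close>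

locale hopf_group_type_pair = A: hopf_group_type H N P Q + B: hopf_group_type H N P' Q' + field_endo \<sigma>
  for H :: "('i, 'l::field) hopf" and N :: "('g, 'm) monoid_scheme" and P Q P' Q' \<sigma> +
  assumes fix_mult: "\<lbrakk>i \<in> hbasis H; j \<in> hbasis H; k \<in> hbasis H\<rbrakk> \<Longrightarrow> \<sigma> (hmult H i j k) = hmult H i j k"
    and fix_comult: "\<lbrakk>i \<in> hbasis H; j \<in> hbasis H; k \<in> hbasis H\<rbrakk> \<Longrightarrow> \<sigma> (hcomult H i j k) = hcomult H i j k"
    and fix_counit: "i \<in> hbasis H \<Longrightarrow> \<sigma> (hcounit H i) = hcounit H i"
begin

text \<open>Over a field the grouplike elements of a group algebra are the group elements.\<close>

lemma grouplike:
  assumes n: "n \<in> carrier N"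
  shows "\<exists>m\<in>carrier N. \<forall>i\<in>hbasis H. \<sigma> (Q n i) = Q' m i"
proof -
  let ?I = "hbasis H"
  \<comment> \<open>The coefficients of the vector \<open>\<sigma> (Q n i)\<close> in the group
    elements. As the vector is grouplike they are orthogonal idempotents of a field
    (\<open>gg\<close>), and the counit makes their sum 1; so one of them is 1 and the others
    vanish.\<close>
  define g where "g m = (\<Sum>i\<in>?I. \<sigma> (Q n i) * P' i m)" for m
  have com: "(\<Sum>i\<in>?I. \<sigma> (Q n i) * hcomult H i j k) = \<sigma> (Q n j) * \<sigma> (Q n k)" if "j \<in> ?I" "k \<in> ?I" for j k
    using arg_cong[OF A.Q_comult[OF n that], of \<sigma>] that by (simp add: sum mult fix_comult)
  have gg: "g c * g d = g c * (if c = d then 1 else 0)" if "c \<in> carrier N" "d \<in> carrier N" for c d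
  proof -
    have "g c * g d = (\<Sum>j\<in>?I. \<Sum>k\<in>?I. (\<sigma> (Q n j) * \<sigma> (Q n k)) * (P' j c * P' k d))"
      by (simp add: g_def sum_product mult_ac)
    also have "\<dots> = (\<Sum>j\<in>?I. \<Sum>k\<in>?I. \<Sum>i\<in>?I. \<sigma> (Q n i) * (hcomult H i j k * P' j c * P' k d))"
      by (simp add: com[symmetric] sum_distrib_right mult.assoc)
    also have "\<dots> = (\<Sum>j\<in>?I. \<Sum>i\<in>?I. \<Sum>k\<in>?I. \<sigma> (Q n i) * (hcomult H i j k * P' j c * P' k d))"
      by (intro sum.cong refl sum.swap)
    also have "\<dots> = (\<Sum>i\<in>?I. \<Sum>j\<in>?I. \<Sum>k\<in>?I. \<sigma> (Q n i) * (hcomult H i j k * P' j c * P' k d))"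
      by (rule sum.swap)
    also have "\<dots> = (\<Sum>i\<in>?I. \<sigma> (Q n i) * (P' i c * (if c = d then 1 else 0)))"
      using that by (simp only: sum_distrib_left[symmetric]) (simp add: B.P_comult)
    finally show ?thesis by (simp add: g_def)
  qed
  have "(\<Sum>m\<in>carrier N. g m) = (\<Sum>i\<in>?I. \<sigma> (Q n i) * (\<Sum>m\<in>carrier N. P' i m))"
    unfolding g_def sum_distrib_left by (rule sum.swap)
  also have "\<dots> = \<sigma> (\<Sum>i\<in>?I. Q n i * hcounit H i)"
    by (simp add: sum mult fix_counit B.hcounit_eq[symmetric])
  also have "\<dots> = 1" by (simp add: A.Q_counit[OF n] one)
  finally have "(\<Sum>m\<in>carrier N. g m) \<noteq> 0" by simp
  then obtain m where m: "m \<in> carrier N" "g m \<noteq> 0" by (metis sum.neutral)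
  have gm: "g c = (if m = c then 1 else 0)" if "c \<in> carrier N" for c
    using gg[OF m(1) that] m(2) by auto
  have "\<sigma> (Q n i) = Q' m i" if "i \<in> ?I" for i
  proof -
    have "\<sigma> (Q n i) = (\<Sum>j\<in>?I. \<sigma> (Q n j) * (\<Sum>c\<in>carrier N. P' j c * Q' c i))"
      using that A.finH by (simp add: B.PQ sum_delta_left)
    also have "\<dots> = (\<Sum>c\<in>carrier N. g c * Q' c i)"
      by (simp add: sum_linear g_def)
    finally show ?thesis using gm m A.finN by (simp add: sum_delta_left)
  qed
  then show ?thesis using m by blast
qed

text \<open>The induced map on \<open>N\<close> is injective because \<open>\<sigma>\<close> is,
  hence bijective by finiteness, and multiplicative because \<open>\<sigma>\<close> fixes
  \<open>hmult\<close>. The rule for \<open>P\<close> follows because \<open>P'\<close> is inverse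
  to \<open>Q'\<close>.\<close>

lemma grouplike_auto:
  "\<exists>\<alpha>\<in>auto N. \<forall>n\<in>carrier N. \<forall>i\<in>hbasis H. \<sigma> (Q n i) = Q' (\<alpha> n) i \<and> \<sigma> (P i n) = P' i (\<alpha> n)"
proof -
  obtain f where f: "\<And>n. n \<in> carrier N \<Longrightarrow> f n \<in> carrier N"
    "\<And>n i. n \<in> carrier N \<Longrightarrow> i \<in> hbasis H \<Longrightarrow> \<sigma> (Q n i) = Q' (f n) i"
    using grouplike by metis
  define \<alpha> where "\<alpha> = restrict f (carrier N)"
  have cl: "\<alpha> n \<in> carrier N" if "n \<in> carrier N" for n using f that by (simp add: \<alpha>_def)
  have Qa: "\<sigma> (Q n i) = Q' (\<alpha> n) i" if "n \<in> carrier N" "i \<in> hbasis H" for n i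
    using f that by (simp add: \<alpha>_def)
  have "inj_on \<alpha> (carrier N)"
  proof (rule inj_onI)
    fix a b assume ab: "a \<in> carrier N" "b \<in> carrier N" "\<alpha> a = \<alpha> b"
    show "a = b"
    proof (rule A.Q_inj[OF ab(1,2)])
      fix i assume "i \<in> hbasis H"
      then have "\<sigma> (Q a i) = \<sigma> (Q b i)" using ab Qa by simp
      then show "Q a i = Q b i" using inj by (simp add: inj_eq)
    qed
  qed
  then have bij: "bij_betw \<alpha> (carrier N) (carrier N)"
    using cl by (simp add: bij_betw_def endo_inj_surj[OF A.finN] image_subset_iff)
  have "\<alpha> (a \<otimes>\<^bsub>N\<^esub> b) = \<alpha> a \<otimes>\<^bsub>N\<^esub> \<alpha> b" if ab: "a \<in> carrier N" "b \<in> carrier N" for a b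
  proof (rule B.Q_inj)
    fix t assume t: "t \<in> hbasis H"
    have "Q' (\<alpha> (a \<otimes>\<^bsub>N\<^esub> b)) t = \<sigma> (Q (a \<otimes>\<^bsub>N\<^esub> b) t)" using Qa t ab by simp
    also have "\<dots> = (\<Sum>i\<in>hbasis H. \<Sum>j\<in>hbasis H. Q' (\<alpha> a) i * Q' (\<alpha> b) j * hmult H i j t)"
      using ab t by (simp add: A.Q_mult[symmetric] sum mult Qa fix_mult)
    also have "\<dots> = Q' (\<alpha> a \<otimes>\<^bsub>N\<^esub> \<alpha> b) t" using ab t cl by (simp add: B.Q_mult)
    finally show "Q' (\<alpha> (a \<otimes>\<^bsub>N\<^esub> b)) t = Q' (\<alpha> a \<otimes>\<^bsub>N\<^esub> \<alpha> b) t" .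
  qed (use ab cl in auto)
  then have "\<alpha> \<in> auto N"
    using bij cl by (auto simp: auto_def Bij_def hom_def \<alpha>_def)
  moreover have "\<sigma> (P i n) = P' i (\<alpha> n)" if "n \<in> carrier N" "i \<in> hbasis H" for n i
  proof -
    have "\<sigma> (P i n) = (\<Sum>c\<in>carrier N. P' i c * (\<Sum>s\<in>hbasis H. Q' c s * \<sigma> (P s n)))"
      using that by (simp add: B.P_expand)
    also have "\<dots> = (\<Sum>m\<in>carrier N. P' i (\<alpha> m) * (\<Sum>s\<in>hbasis H. Q' (\<alpha> m) s * \<sigma> (P s n)))"
      by (rule sum.reindex_bij_betw[OF bij, symmetric])
    also have "\<dots> = (\<Sum>m\<in>carrier N. P' i (\<alpha> m) * \<sigma> (\<Sum>s\<in>hbasis H. Q m s * P s n))"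
      by (simp add: Qa sum mult)
    also have "\<dots> = (\<Sum>m\<in>carrier N. P' i (\<alpha> m) * (if m = n then 1 else 0))"
      using that by (intro sum.cong refl) (auto simp: A.QP one zero)
    finally show ?thesis using that A.finN by (simp add: sum_delta_left)
  qed
  ultimately show ?thesis using Qa by blast
qed

end

section \<open>The embedding induced by a Hopf-Galois structure\<close>

text \<open>The second component of \<open>\<beta> \<sigma>\<close> records how
  \<open>\<sigma>\<close> permutes the grouplike vectors. The rule for \<open>P\<close> is carried
  along with the one for \<open>Q\<close>, which saves inverting the matrix at each use.\<close>

definition induces ::
    "'l::field set \<Rightarrow> ('i, 'l) hopf \<Rightarrow> ('i \<Rightarrow> 'l \<Rightarrow> 'l) \<Rightarrow> ('g, 'm) monoid_scheme \<Rightarrow>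
     ('i \<Rightarrow> 'g \<Rightarrow> 'l) \<Rightarrow> ('g \<Rightarrow> 'i \<Rightarrow> 'l) \<Rightarrow> (('l \<Rightarrow> 'l) \<Rightarrow> 'g \<times> ('g \<Rightarrow> 'g)) \<Rightarrow> bool" where
  "induces K H act N P Q \<beta> \<longleftrightarrow>
     \<beta> \<in> regular_embeddings (Gal K) N \<and>
     (\<forall>\<sigma>\<in>carrier (Gal K).
        (\<forall>x. (\<Sum>i\<in>hbasis H. Q (fst (\<beta> \<sigma>)) i * act i x) = \<sigma> x) \<and>
        (\<forall>n\<in>carrier N. \<forall>i\<in>hbasis H.
           \<sigma> (Q n i) = Q (snd (\<beta> \<sigma>) n) i \<and> \<sigma> (P i n) = P i (snd (\<beta> \<sigma>) n)))"

locale typed_hopf_galois =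
  finite_galois K + hopf_galois_structure K H act + hopf_group_type H N P Q
  for K :: "'l::field set" and H :: "('i, 'l) hopf" and act :: "'i \<Rightarrow> 'l \<Rightarrow> 'l"
    and N :: "('g, 'm) monoid_scheme" and P Q
begin

text \<open>The operator on the field given by \<open>n\<close> as an element of the scalar
  extension of \<open>H\<close>. In general \<open>v\<close> is not a homomorphism, since operators
  do not commute with scalars; see \<open>v_comp\<close>.\<close>

definition v :: "'g \<Rightarrow> 'l \<Rightarrow> 'l" where
  "v n x = (\<Sum>i\<in>hbasis H. Q n i * act i x)"

lemma act_v: "i \<in> hbasis H \<Longrightarrow> act i x = (\<Sum>n\<in>carrier N. P i n * v n x)"
  unfolding v_def by (rule P_expand[symmetric])

text \<open>The module algebra law for a grouplike element has a single summand.\<close>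

lemma v_mult:
  assumes "n \<in> carrier N"
  shows "v n (x * y) = v n x * v n y"
proof -
  let ?I = "hbasis H"
  have "v n (x * y) = (\<Sum>i\<in>?I. \<Sum>j\<in>?I. \<Sum>k\<in>?I. Q n i * hcomult H i j k * (act j x * act k y))"
    by (simp add: v_def act_of_mult sum_distrib_left mult.assoc)
  also have "\<dots> = (\<Sum>j\<in>?I. \<Sum>i\<in>?I. \<Sum>k\<in>?I. Q n i * hcomult H i j k * (act j x * act k y))"
    by (rule sum.swap)
  also have "\<dots> = (\<Sum>j\<in>?I. \<Sum>k\<in>?I. \<Sum>i\<in>?I. Q n i * hcomult H i j k * (act j x * act k y))"
    by (intro sum.cong refl sum.swap)
  also have "\<dots> = (\<Sum>j\<in>?I. \<Sum>k\<in>?I. Q n j * Q n k * (act j x * act k y))"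
    using assms by (simp only: sum_distrib_right[symmetric]) (simp add: Q_comult)
  also have "\<dots> = v n x * v n y"
    by (simp add: v_def sum_product mult_ac)
  finally show ?thesis .
qed

lemma v_field_endo: "n \<in> carrier N \<Longrightarrow> field_endo (v n)"
proof
  fix x y assume n: "n \<in> carrier N"
  show "v n (x + y) = v n x + v n y"
    using act_End by (simp add: v_def End_def sum.distrib[symmetric] distrib_left)
  show "v n (x * y) = v n x * v n y" by (rule v_mult[OF n])
  show "v n 1 = 1" by (simp add: v_def act_of_one Q_counit[OF n])
qed

lemma v_fixes: "n \<in> carrier N \<Longrightarrow> c \<in> K \<Longrightarrow> v n c = c"
proof -
  assume n: "n \<in> carrier N" and c: "c \<in> K"
  have "act i (c * 1) = c * act i 1" if "i \<in> hbasis H" for i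
    using act_End[OF that] c unfolding End_def by blast
  then have "v n c = c * v n 1"
    by (simp add: v_def sum_distrib_left mult.left_commute)
  then show ?thesis using field_endo.one[OF v_field_endo[OF n]] by simp
qed

lemma pair:
  assumes "field_endo \<sigma>" "\<And>c. c \<in> K \<Longrightarrow> \<sigma> c = c" "hopf_mats H (group_hopf N) P' Q'"
  shows "hopf_group_type_pair H N P Q P' Q' \<sigma>"
proof -
  interpret B: hopf_group_type H N P' Q' by unfold_locales (fact finN finH assms)+
  interpret field_endo \<sigma> by fact
  show ?thesis by unfold_locales (auto simp: assms(2) hmult_in hcomult_in hcounit_in)
qed

text \<open>Defined for arbitrary maps and not only for Galois elements, since \<open>v_comp\<close>
  uses it for \<open>v n\<close> before \<open>v n\<close> is known to be one.\<close>

definition star :: "('l \<Rightarrow> 'l) \<Rightarrow> 'g \<Rightarrow> 'g" where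
  "star \<sigma> = (SOME \<alpha>. \<alpha> \<in> auto N \<and>
     (\<forall>n\<in>carrier N. \<forall>i\<in>hbasis H. \<sigma> (Q n i) = Q (\<alpha> n) i \<and> \<sigma> (P i n) = P i (\<alpha> n)))"

context
  fixes \<sigma> :: "'l \<Rightarrow> 'l"
  assumes s: "field_endo \<sigma>" "\<And>c. c \<in> K \<Longrightarrow> \<sigma> c = c"
begin

lemma star_ex: "star \<sigma> \<in> auto N \<and> (\<forall>n\<in>carrier N. \<forall>i\<in>hbasis H. \<sigma> (Q n i) = Q (star \<sigma> n) i \<and> \<sigma> (P i n) = P i (star \<sigma> n))"
proof -
  have "\<exists>\<alpha>. \<alpha> \<in> auto N \<and> (\<forall>n\<in>carrier N. \<forall>i\<in>hbasis H. \<sigma> (Q n i) = Q (\<alpha> n) i \<and> \<sigma> (P i n) = P i (\<alpha> n))"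
    using hopf_group_type_pair.grouplike_auto[OF pair[OF s mats]] by (simp only: Bex_def)
  from someI_ex[OF this] show ?thesis unfolding star_def .
qed

lemma star_auto: "star \<sigma> \<in> auto N" using star_ex by blast

lemma star_Q: "n \<in> carrier N \<Longrightarrow> i \<in> hbasis H \<Longrightarrow> \<sigma> (Q n i) = Q (star \<sigma> n) i" using star_ex by blast

end

text \<open>The endomorphism \<open>v n\<close> also acts on the coefficients \<open>Q m j\<close>
  inside \<open>v m\<close>, and this replaces \<open>m\<close> by \<open>star (v n) m\<close>. The
  outcome is the first component of a product in the holomorph.\<close>

lemma v_comp:
  assumes n: "n \<in> carrier N" and m: "m \<in> carrier N"
  shows "v n (v m x) = v (n \<otimes>\<^bsub>N\<^esub> star (v n) m) x"
proof -
  let ?I = "hbasis H"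
  interpret vn: field_endo "v n" by (rule v_field_endo[OF n])
  have sm: "star (v n) m \<in> carrier N"
    using auto_closed[OF star_auto[OF v_field_endo[OF n] v_fixes[OF n]] m] .
  have "v n (v m x) = (\<Sum>j\<in>?I. v n (Q m j) * v n (act j x))"
    unfolding v_def[of m] by (simp add: vn.sum vn.mult)
  also have "\<dots> = (\<Sum>j\<in>?I. Q (star (v n) m) j * (\<Sum>i\<in>?I. Q n i * act i (act j x)))"
    using star_Q[OF v_field_endo[OF n] v_fixes[OF n] m] by (simp add: v_def[of n "act _ x"])
  also have "\<dots> = (\<Sum>j\<in>?I. \<Sum>i\<in>?I. \<Sum>s\<in>?I. Q n i * Q (star (v n) m) j * hmult H i j s * act s x)"
    by (simp add: act_mult sum_distrib_left mult_ac)
  also have "\<dots> = (\<Sum>i\<in>?I. \<Sum>j\<in>?I. \<Sum>s\<in>?I. Q n i * Q (star (v n) m) j * hmult H i j s * act s x)"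
    by (rule sum.swap)
  also have "\<dots> = (\<Sum>i\<in>?I. \<Sum>s\<in>?I. \<Sum>j\<in>?I. Q n i * Q (star (v n) m) j * hmult H i j s * act s x)"
    by (intro sum.cong refl sum.swap)
  also have "\<dots> = (\<Sum>s\<in>?I. \<Sum>i\<in>?I. \<Sum>j\<in>?I. Q n i * Q (star (v n) m) j * hmult H i j s * act s x)"
    by (rule sum.swap)
  also have "\<dots> = (\<Sum>s\<in>?I. Q (n \<otimes>\<^bsub>N\<^esub> star (v n) m) s * act s x)"
    using n sm by (simp only: sum_distrib_right[symmetric]) (simp add: Q_mult)
  finally show ?thesis by (simp add: v_def)
qed

lemma v_one: "v \<one>\<^bsub>N\<^esub> x = x"
  using act_unit[of x] by (simp add: v_def Q_unit)

text \<open>Surjectivity: as \<open>star (v n)\<close> permutes \<open>N\<close>, some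
  \<open>m\<close> is mapped by it to the inverse of \<open>n\<close>, and then \<open>v n\<close>
  after \<open>v m\<close> is \<open>v\<close> of the identity.\<close>

lemma v_Gal:
  assumes n: "n \<in> carrier N"
  shows "v n \<in> carrier (Gal K)"
proof -
  interpret vn: field_endo "v n" by (rule v_field_endo[OF n])
  have bij: "bij_betw (star (v n)) (carrier N) (carrier N)"
    using auto_bij star_auto[OF v_field_endo[OF n] v_fixes[OF n]] by blast
  then have "inv\<^bsub>N\<^esub> n \<in> star (v n) ` carrier N" using n by (simp add: bij_betw_def)
  then obtain m where m: "m \<in> carrier N" "inv\<^bsub>N\<^esub> n = star (v n) m" by blast
  have "v n (v m x) = v \<one>\<^bsub>N\<^esub> x" for x
    using v_comp[OF n m(1), of x] n by (simp only: m(2)[symmetric] N.r_inv)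
  then have "v n (v m x) = x" for x by (simp only: v_one)
  then have "surj (v n)" by (metis surjI)
  then show ?thesis using vn.inj vn.add vn.mult v_fixes[OF n] by (simp add: mem_Gal bij_def)
qed

text \<open>Both halves of the Galois condition enter. Its injectivity distinguishes the rows of
  \<open>Q\<close> by their operators. Its surjectivity writes a Galois element
  \<open>\<sigma>\<close> as a combination of the \<open>v n\<close>, and by independence of Galois
  elements \<open>\<sigma>\<close> must be one of them.\<close>

lemma v_bij: "bij_betw v (carrier N) (carrier (Gal K))"
proof -
  let ?I = "hbasis H"
  have inj: "inj_on v (carrier N)"
  proof (rule inj_onI)
    fix n m assume nm: "n \<in> carrier N" "m \<in> carrier N" "v n = v m"
    let ?F = "\<lambda>l x. \<Sum>i\<in>?I. l i * act i x"
    have F: "?F (restrict (Q a) ?I) = v a" for a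
      by (simp add: v_def fun_eq_iff)
    have "inj_on ?F (?I \<rightarrow>\<^sub>E UNIV)" using galois by (rule bij_betw_imp_inj_on)
    then have "restrict (Q n) ?I = restrict (Q m) ?I"
      by (rule inj_onD) (use nm F in auto)
    then have "Q n i = Q m i" if "i \<in> ?I" for i using that by (metis restrict_apply)
    then show "n = m" using Q_inj nm by blast
  qed
  have "\<sigma> \<in> v ` carrier N" if s: "\<sigma> \<in> carrier (Gal K)" for \<sigma>
  proof (rule ccontr)
    assume nin: "\<sigma> \<notin> v ` carrier N"
    have "\<sigma> \<in> End K" by (rule Gal_sub_End[OF s])
    then obtain l where l: "\<sigma> = (\<lambda>x. \<Sum>i\<in>?I. l i * act i x)"
      using galois unfolding bij_betw_def by blast
    define c where "c n = (\<Sum>i\<in>?I. l i * P i n)" for n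
    have sz: "\<sigma> z = (\<Sum>n\<in>carrier N. c n * v n z)" for z
      unfolding l c_def by (simp add: act_v sum_linear)
    \<comment> \<open>The relation \<open>sz\<close>, rewritten with coefficients on the whole
      Galois group. At \<open>\<sigma>\<close> the coefficient is -1, as \<open>\<sigma>\<close> is
      assumed to lie outside the image of \<open>v\<close>.\<close>
    define a where "a \<tau> = (if \<tau> \<in> v ` carrier N then c (inv_into (carrier N) v \<tau>) else 0) - (if \<tau> = \<sigma> then 1 else 0)" for \<tau>
    have "(\<Sum>\<tau>\<in>carrier (Gal K). a \<tau> * \<tau> z) = 0" for z
    proof -
      have "(\<Sum>\<tau>\<in>carrier (Gal K). (if \<tau> \<in> v ` carrier N then c (inv_into (carrier N) v \<tau>) else 0) * \<tau> z)
         = (\<Sum>\<tau>\<in>v ` carrier N. c (inv_into (carrier N) v \<tau>) * \<tau> z)"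
        by (rule sum.mono_neutral_cong_right) (use fin v_Gal in auto)
      also have "\<dots> = \<sigma> z"
        using inj by (simp add: sum.reindex sz)
      finally show ?thesis
        using fin s by (simp add: a_def left_diff_distrib sum_subtractf if_distrib[of "\<lambda>x. x * _"] cong: if_cong)
    qed
    from Gal_independent[OF this s] show False using nin by (simp add: a_def)
  qed
  then show ?thesis using inj v_Gal by (auto simp: bij_betw_def)
qed

lemma star_Gal:
  assumes "\<sigma> \<in> carrier (Gal K)"
  shows "star \<sigma> \<in> auto N"
    and "n \<in> carrier N \<Longrightarrow> i \<in> hbasis H \<Longrightarrow> \<sigma> (Q n i) = Q (star \<sigma> n) i"
    and "n \<in> carrier N \<Longrightarrow> i \<in> hbasis H \<Longrightarrow> \<sigma> (P i n) = P i (star \<sigma> n)"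
  using star_ex[of \<sigma>] Gal_field_endo[OF assms] Gal_fixes[OF assms] by blast+

lemma star_comp:
  assumes s: "\<sigma> \<in> carrier (Gal K)" and t: "\<tau> \<in> carrier (Gal K)"
  shows "star (\<sigma> \<circ> \<tau>) = compose (carrier N) (star \<sigma>) (star \<tau>)"
proof (rule extensionalityI[of _ "carrier N"])
  note au = star_Gal(1)[OF s] star_Gal(1)[OF t] star_Gal(1)[OF Gal_comp[OF s t]]
  show "star (\<sigma> \<circ> \<tau>) \<in> extensional (carrier N)" using auto_extensional au by blast
  fix n assume n: "n \<in> carrier N"
  have "star (\<sigma> \<circ> \<tau>) n = star \<sigma> (star \<tau> n)"
  proof (rule Q_inj)
    fix i assume i: "i \<in> hbasis H"
    show "Q (star (\<sigma> \<circ> \<tau>) n) i = Q (star \<sigma> (star \<tau> n)) i"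
      using star_Gal(2)[OF Gal_comp[OF s t] n i] star_Gal(2)[OF t n i]
        star_Gal(2)[OF s auto_closed[OF au(2) n] i] by simp
  qed (rule auto_closed[OF au(3) n] auto_closed[OF au(1) auto_closed[OF au(2) n]])+
  then show "star (\<sigma> \<circ> \<tau>) n = compose (carrier N) (star \<sigma>) (star \<tau>) n" using n by (simp add: compose_eq)
qed (simp add: compose_def)

definition emb :: "('l \<Rightarrow> 'l) \<Rightarrow> 'g \<times> ('g \<Rightarrow> 'g)" where
  "emb = (\<lambda>\<sigma>\<in>carrier (Gal K). (inv_into (carrier N) v \<sigma>, star \<sigma>))"

lemma emb_induces: "induces K H act N P Q emb"
proof -
  let ?w = "inv_into (carrier N) v"
  have w: "?w \<sigma> \<in> carrier N" "v (?w \<sigma>) = \<sigma>" if "\<sigma> \<in> carrier (Gal K)" for \<sigma>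
    using that v_bij by (auto simp: bij_betw_def inv_into_into f_inv_into_f)
  have wv: "?w (v n) = n" if "n \<in> carrier N" for n
    using that v_bij by (simp add: bij_betw_inv_into_left)
  have au: "star \<sigma> \<in> auto N" if "\<sigma> \<in> carrier (Gal K)" for \<sigma>
    by (rule star_Gal(1)[OF that])
  have "?w (\<sigma> \<circ> \<tau>) = ?w \<sigma> \<otimes>\<^bsub>N\<^esub> star \<sigma> (?w \<tau>)" if s: "\<sigma> \<in> carrier (Gal K)" and t: "\<tau> \<in> carrier (Gal K)" for \<sigma> \<tau>
  proof -
    have "\<sigma> \<circ> \<tau> = v (?w \<sigma> \<otimes>\<^bsub>N\<^esub> star \<sigma> (?w \<tau>))"
      using v_comp[OF w(1)[OF s] w(1)[OF t]] w(2)[OF s] w(2)[OF t] by (simp add: fun_eq_iff)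
    then show ?thesis using wv w s t auto_closed[OF au[OF s]] by simp
  qed
  then have "emb (\<sigma> \<otimes>\<^bsub>Gal K\<^esub> \<tau>) = emb \<sigma> \<otimes>\<^bsub>holomorph N\<^esub> emb \<tau>"
    if s: "\<sigma> \<in> carrier (Gal K)" and t: "\<tau> \<in> carrier (Gal K)" for \<sigma> \<tau>
    using that mult_holomorph[OF au[OF s] au[OF t]] star_comp[OF s t] Gal_comp[OF s t] by (simp add: emb_def)
  moreover have "emb \<sigma> \<in> carrier (holomorph N)" if "\<sigma> \<in> carrier (Gal K)" for \<sigma>
    using that w au by (simp add: emb_def)
  ultimately have "emb \<in> hom (Gal K) (holomorph N)"
    by (intro homI)
  moreover have "bij_betw (\<lambda>\<sigma>. fst (emb \<sigma>)) (carrier (Gal K)) (carrier N)"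
    using bij_betw_inv_into[OF v_bij] by (rule bij_betw_cong[THEN iffD1, rotated]) (simp add: emb_def)
  ultimately have "emb \<in> regular_embeddings (Gal K) N"
    by (simp add: regular_embeddings_def emb_def)
  moreover have "(\<Sum>i\<in>hbasis H. Q (fst (emb \<sigma>)) i * act i x) = \<sigma> x" if "\<sigma> \<in> carrier (Gal K)" for \<sigma> x
    using fun_cong[OF w(2)[OF that], of x] that by (simp add: v_def emb_def)
  ultimately show ?thesis
    using star_Gal by (simp add: induces_def emb_def)
qed

text \<open>The first component is determined because \<open>v\<close> is injective, the second
  because distinct group elements have distinct rows of \<open>Q\<close>.\<close>

lemma induces_unique:
  assumes b: "induces K H act N P Q \<beta>" and g: "induces K H act N P Q \<gamma>"
  shows "\<beta> = \<gamma>"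
proof (rule extensionalityI[of _ "carrier (Gal K)"])
  show "\<beta> \<in> extensional (carrier (Gal K))" "\<gamma> \<in> extensional (carrier (Gal K))"
    using b g by (auto simp: induces_def regular_embeddings_def)
  fix \<sigma> assume s: "\<sigma> \<in> carrier (Gal K)"
  have mem: "\<beta> \<sigma> \<in> carrier N \<times> auto N" "\<gamma> \<sigma> \<in> carrier N \<times> auto N"
    using b g s by (auto simp: induces_def regular_embeddings_def hom_def)
  have "v (fst (\<beta> \<sigma>)) = v (fst (\<gamma> \<sigma>))"
    using b g s by (simp add: induces_def v_def fun_eq_iff)
  then have "fst (\<beta> \<sigma>) = fst (\<gamma> \<sigma>)"
    using v_bij mem by (auto simp: bij_betw_def dest: inj_onD)
  moreover have "snd (\<beta> \<sigma>) = snd (\<gamma> \<sigma>)"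
  proof (rule extensionalityI[of _ "carrier N"])
    show "snd (\<beta> \<sigma>) \<in> extensional (carrier N)" "snd (\<gamma> \<sigma>) \<in> extensional (carrier N)"
      using mem auto_extensional by auto
    fix n assume n: "n \<in> carrier N"
    show "snd (\<beta> \<sigma>) n = snd (\<gamma> \<sigma>) n"
    proof (rule Q_inj)
      show "snd (\<beta> \<sigma>) n \<in> carrier N" "snd (\<gamma> \<sigma>) n \<in> carrier N" using mem n auto_closed by auto
      show "Q (snd (\<beta> \<sigma>) n) i = Q (snd (\<gamma> \<sigma>) n) i" if "i \<in> hbasis H" for i
      proof -
        have "\<sigma> (Q n i) = Q (snd (\<beta> \<sigma>) n) i" using b s n that by (simp add: induces_def)
        moreover have "\<sigma> (Q n i) = Q (snd (\<gamma> \<sigma>) n) i" using g s n that by (simp add: induces_def)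
        ultimately show ?thesis by simp
      qed
    qed
  qed
  ultimately show "\<beta> \<sigma> = \<gamma> \<sigma>" by (simp add: prod_eq_iff)
qed

end

section \<open>Galois descent\<close>

text \<open>The assumption \<open>span\<close> says that the point masses on \<open>N\<close> are
  combinations of the vectors \<open>f i\<close>. A spanning subfamily of least size is independent,
  hence a basis, and the matrix expressing the point masses in it is a two-sided inverse.\<close>

lemma dual_basis_exists:
  fixes f :: "nat \<Rightarrow> 'g \<Rightarrow> 'l::field"
  assumes N: "finite N" and S: "finite S"
    and span: "\<And>n. n \<in> N \<Longrightarrow> \<exists>q. \<forall>m\<in>N. (\<Sum>i\<in>S. q i * f i m) = (if n = m then 1 else 0)"
  shows "\<exists>I Q. I \<subseteq> S \<and>
    (\<forall>n\<in>N. \<forall>m\<in>N. (\<Sum>i\<in>I. Q n i * f i m) = (if n = m then 1 else 0)) \<and>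
    (\<forall>i\<in>I. \<forall>k\<in>I. (\<Sum>n\<in>N. f i n * Q n k) = (if i = k then 1 else 0))"
proof -
  define sp where "sp I \<longleftrightarrow> I \<subseteq> S \<and> (\<forall>n\<in>N. \<exists>q. \<forall>m\<in>N. (\<Sum>i\<in>I. q i * f i m) = (if n = m then 1 else 0))" for I
  have "sp S" using span by (simp add: sp_def)
  then obtain I where I: "sp I" "\<And>J. sp J \<Longrightarrow> card I \<le> card J"
    using ex_has_least_nat[of sp S card] by blast
  have finI: "finite I" using I(1) S finite_subset by (auto simp: sp_def)
  obtain Q where Q: "\<And>n m. n \<in> N \<Longrightarrow> m \<in> N \<Longrightarrow> (\<Sum>i\<in>I. Q n i * f i m) = (if n = m then 1 else 0)"
    using I(1) unfolding sp_def by metis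
  have indep: "c j = 0" if c: "\<And>m. m \<in> N \<Longrightarrow> (\<Sum>i\<in>I. c i * f i m) = 0" and j: "j \<in> I" for c j
  proof (rule ccontr)
    assume cj: "c j \<noteq> 0"
    have "sp (I - {j})"
      unfolding sp_def
    proof (intro conjI ballI exI)
      show "I - {j} \<subseteq> S" using I(1) by (auto simp: sp_def)
      fix n m assume nm: "n \<in> N" "m \<in> N"
      let ?q = "\<lambda>i. Q n i - Q n j / c j * c i"
      have "(\<Sum>i\<in>I - {j}. ?q i * f i m) = (\<Sum>i\<in>I. ?q i * f i m)"
        using finI j cj by (simp add: sum.remove[of I j])
      also have "\<dots> = (\<Sum>i\<in>I. Q n i * f i m) - Q n j / c j * (\<Sum>i\<in>I. c i * f i m)"
        by (simp only: left_diff_distrib sum_subtractf sum_distrib_left mult.assoc)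
      finally show "(\<Sum>i\<in>I - {j}. ?q i * f i m) = (if n = m then 1 else 0)"
        using Q nm c by simp
    qed
    then have "card I \<le> card (I - {j})" by (rule I(2))
    then show False using finI j by (metis card_Diff1_less linorder_not_less)
  qed
  have "(\<Sum>n\<in>N. f i n * Q n k) = (if i = k then 1 else 0)" if ik: "i \<in> I" "k \<in> I" for i k
  proof -
    \<comment> \<open>The difference of two expansions of the vector \<open>f i\<close> in the
      basis, one through the point masses and one trivial.\<close>
    define c where "c k = (\<Sum>n\<in>N. f i n * Q n k) - (if i = k then 1 else 0)" for k
    have "(\<Sum>k\<in>I. c k * f k m) = 0" if m: "m \<in> N" for m
    proof -
      have "(\<Sum>k\<in>I. c k * f k m) = (\<Sum>k\<in>I. (\<Sum>n\<in>N. f i n * Q n k) * f k m) - f i m"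
        using finI ik by (simp add: c_def left_diff_distrib sum_subtractf sum_delta_left)
      also have "(\<Sum>k\<in>I. (\<Sum>n\<in>N. f i n * Q n k) * f k m) = (\<Sum>n\<in>N. f i n * (\<Sum>k\<in>I. Q n k * f k m))"
        by (simp only: sum_linear)
      also have "\<dots> = f i m" using Q m N by (simp add: sum_delta_left)
      finally show ?thesis by simp
    qed
    then have "c k = 0" using indep ik by blast
    then show ?thesis by (simp add: c_def)
  qed
  then show ?thesis using I(1) Q unfolding sp_def by blast
qed

context finite_galois
begin

text \<open>
  The basis is chosen among the traces of the multiples of point masses by Galois coordinates,
  which span.
\<close>

lemma descent:
  assumes N: "finite N"
    and cl: "\<And>\<sigma> n. \<sigma> \<in> carrier (Gal K) \<Longrightarrow> n \<in> N \<Longrightarrow> \<alpha> \<sigma> n \<in> N"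
    and one: "\<And>n. n \<in> N \<Longrightarrow> \<alpha> id n = n"
    and comp: "\<And>\<sigma> \<tau> n. \<sigma> \<in> carrier (Gal K) \<Longrightarrow> \<tau> \<in> carrier (Gal K) \<Longrightarrow> n \<in> N \<Longrightarrow>
      \<alpha> (\<sigma> \<circ> \<tau>) n = \<alpha> \<sigma> (\<alpha> \<tau> n)"
  shows "\<exists>(I :: nat set) P Q. finite I \<and>
    (\<forall>n\<in>N. \<forall>m\<in>N. (\<Sum>i\<in>I. Q n i * P i m) = (if n = m then 1 else 0)) \<and>
    (\<forall>i\<in>I. \<forall>k\<in>I. (\<Sum>n\<in>N. P i n * Q n k) = (if i = k then 1 else 0)) \<and>
    (\<forall>\<sigma>\<in>carrier (Gal K). \<forall>n\<in>N. \<forall>i\<in>I. \<sigma> (P i n) = P i (\<alpha> \<sigma> n))"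
proof -
  obtain r and x y :: "nat \<Rightarrow> 'l" where c: "\<forall>\<sigma>\<in>carrier (Gal K). \<forall>\<tau>\<in>carrier (Gal K).
     (\<Sum>i<r. \<tau> (x i) * \<sigma> (y i)) = (if \<sigma> = \<tau> then 1 else 0)"
    using galois_coordinates by blast
  \<comment> \<open>The trace of \<open>y (fst s)\<close> times the point mass at
    \<open>snd s\<close>, for the semilinear action in which \<open>\<sigma>\<close> moves the point
    \<open>n\<close> to \<open>\<alpha> \<sigma> n\<close>. It is invariant (\<open>equi\<close>),
    and the \<open>x i\<close> recover the point masses from these traces
    (\<open>delta\<close>).\<close>
  define T where "T s m = (\<Sum>\<sigma>\<in>carrier (Gal K). \<sigma> (y (fst s)) * (if \<alpha> \<sigma> (snd s) = m then 1 else 0))" for s m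
  have inj: "\<alpha> \<tau> a = \<alpha> \<tau> b \<longleftrightarrow> a = b" if t: "\<tau> \<in> carrier (Gal K)" and ab: "a \<in> N" "b \<in> N" for \<tau> a b
  proof -
    let ?i = "inv_into UNIV \<tau>"
    have id: "?i \<circ> \<tau> = id" using t by (simp add: mem_Gal bij_is_inj)
    have "\<alpha> ?i (\<alpha> \<tau> n) = n" if "n \<in> N" for n
      using comp[OF Gal_inv[OF t] t that] one[OF that] id by simp
    then show ?thesis using ab by metis
  qed
  have equi: "\<tau> (T s m) = T s (\<alpha> \<tau> m)" if t: "\<tau> \<in> carrier (Gal K)" and s: "snd s \<in> N" and m: "m \<in> N" for \<tau> s m
  proof -
    interpret t: field_endo \<tau> by (rule Gal_field_endo[OF t])
    have if01: "\<tau> (if b then 1 else 0) = (if b then 1 else 0)" for b by (simp add: t.one t.zero)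
    have "\<tau> (T s m) = (\<Sum>\<sigma>\<in>carrier (Gal K). (\<tau> \<circ> \<sigma>) (y (fst s)) * (if \<alpha> (\<tau> \<circ> \<sigma>) (snd s) = \<alpha> \<tau> m then 1 else 0))"
      unfolding T_def using t s m by (simp add: t.sum t.mult comp inj cl if01)
    then show ?thesis
      unfolding T_def using sum_Gal_comp[OF t, of "\<lambda>\<sigma>. \<sigma> (y (fst s)) * (if \<alpha> \<sigma> (snd s) = \<alpha> \<tau> m then 1 else 0)"]
      by simp
  qed
  have delta: "(\<Sum>i<r. x i * T (i, n) m) = (if n = m then 1 else 0)" if n: "n \<in> N" for n m
  proof -
    have "(\<Sum>i<r. x i * T (i, n) m)
       = (\<Sum>\<sigma>\<in>carrier (Gal K). (\<Sum>i<r. id (x i) * \<sigma> (y i)) * (if \<alpha> \<sigma> n = m then 1 else 0))"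
      unfolding T_def fst_conv snd_conv id_apply by (rule sum_linear)
    also have "\<dots> = (\<Sum>\<sigma>\<in>carrier (Gal K). (if \<sigma> = id then 1 else 0) * (if \<alpha> \<sigma> n = m then 1 else 0))"
      by (intro sum.cong refl arg_cong2[where f = "(*)"]) (rule bspec[OF bspec[OF c] id_Gal])
    also have "\<dots> = (if \<alpha> id n = m then 1 else 0)"
      using fin id_Gal[of K] by (simp only: sum_delta_left)
    finally show ?thesis using one[OF n] by simp
  qed
  let ?S = "{..<r} \<times> N"
  have finS: "finite ?S" using N by simp
  \<comment> \<open>Renumbering by naturals, the index type used in counting structures.\<close>
  obtain h where h: "bij_betw h {0..<card ?S} ?S" using ex_bij_betw_nat_finite[OF finS] by blast
  define f where "f i = T (h i)" for i
  have "\<exists>q. \<forall>m\<in>N. (\<Sum>i\<in>{0..<card ?S}. q i * f i m) = (if n = m then 1 else 0)" if n: "n \<in> N" for n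
  proof (intro exI ballI)
    fix m assume m: "m \<in> N"
    let ?q = "\<lambda>s. x (fst s) * (if snd s = n then 1 else 0)"
    have "(\<Sum>i\<in>{0..<card ?S}. ?q (h i) * f i m) = (\<Sum>s\<in>?S. ?q s * T s m)"
      unfolding f_def by (rule sum.reindex_bij_betw[OF h])
    also have "\<dots> = (\<Sum>i<r. \<Sum>n'\<in>N. ?q (i, n') * T (i, n') m)"
      by (simp add: sum.cartesian_product case_prod_unfold)
    also have "\<dots> = (\<Sum>i<r. \<Sum>n'\<in>N. (x i * T (i, n') m) * (if n' = n then 1 else 0))"
      by (intro sum.cong refl) simp
    also have "\<dots> = (\<Sum>i<r. x i * T (i, n) m)" using N n by (simp only: sum_delta_left)
    finally show "(\<Sum>i\<in>{0..<card ?S}. ?q (h i) * f i m) = (if n = m then 1 else 0)"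
      using delta[OF n] by simp
  qed
  from dual_basis_exists[OF N finite_atLeastLessThan this]
  obtain I Q where IQ: "I \<subseteq> {0..<card ?S}"
    "\<forall>n\<in>N. \<forall>m\<in>N. (\<Sum>i\<in>I. Q n i * f i m) = (if n = m then 1 else 0)"
    "\<forall>i\<in>I. \<forall>k\<in>I. (\<Sum>n\<in>N. f i n * Q n k) = (if i = k then 1 else 0)" by blast
  have "\<sigma> (f i n) = f i (\<alpha> \<sigma> n)" if "\<sigma> \<in> carrier (Gal K)" "n \<in> N" "i \<in> I" for \<sigma> n i
  proof -
    have "h i \<in> ?S" using h IQ(1) that(3) by (auto simp: bij_betw_def)
    then show ?thesis unfolding f_def using that by (intro equi) auto
  qed
  then show ?thesis using IQ finite_subset[OF IQ(1)] by blast
qed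

end

lemma sum_mult_cong:
  "(\<And>a. a \<in> A \<Longrightarrow> f a = g a) \<Longrightarrow> (\<Sum>a\<in>A. c a * f a) = (\<Sum>a\<in>A. c a * (g a :: 'l::comm_ring_1))"
  by simp

lemma Gal_action_comp:
  assumes "\<beta> \<in> hom (Gal K) (holomorph N)" "\<sigma> \<in> carrier (Gal K)" "\<tau> \<in> carrier (Gal K)"
  shows "fst (\<beta> (\<sigma> \<circ> \<tau>)) = fst (\<beta> \<sigma>) \<otimes>\<^bsub>N\<^esub> snd (\<beta> \<sigma>) (fst (\<beta> \<tau>))"
    and "n \<in> carrier N \<Longrightarrow> snd (\<beta> (\<sigma> \<circ> \<tau>)) n = snd (\<beta> \<sigma>) (snd (\<beta> \<tau>) n)"
proof -
  have mem: "\<beta> \<sigma> \<in> carrier (holomorph N)" "\<beta> \<tau> \<in> carrier (holomorph N)"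
    by (rule hom_in_carrier[OF assms(1)], rule assms)+
  obtain a \<zeta> b \<xi> where eq: "\<beta> \<sigma> = (a, \<zeta>)" "\<beta> \<tau> = (b, \<xi>)" by (metis prod.exhaust)
  have "\<beta> (\<sigma> \<circ> \<tau>) = (a \<otimes>\<^bsub>N\<^esub> \<zeta> b, compose (carrier N) \<zeta> \<xi>)"
    using hom_mult[OF assms] mem by (simp add: eq mult_holomorph)
  then show "fst (\<beta> (\<sigma> \<circ> \<tau>)) = fst (\<beta> \<sigma>) \<otimes>\<^bsub>N\<^esub> snd (\<beta> \<sigma>) (fst (\<beta> \<tau>))"
    and "n \<in> carrier N \<Longrightarrow> snd (\<beta> (\<sigma> \<circ> \<tau>)) n = snd (\<beta> \<sigma>) (snd (\<beta> \<tau>) n)"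
    by (simp_all add: eq compose_eq)
qed

context finite_galois
begin

text \<open>The invariants of the group algebra, where \<open>\<sigma>\<close> acts on coefficients
  and by \<open>snd (\<beta> \<sigma>)\<close> on group elements, form the Hopf algebra; the group
  element \<open>fst (\<beta> \<sigma>)\<close> acts on the field as \<open>\<sigma>\<close>.
  Multiplicativity of \<open>\<beta>\<close> is what makes the two compatible.\<close>

lemma hopf_galois_structure_exists:
  assumes N: "group N" "finite (carrier N)" and b: "\<beta> \<in> regular_embeddings (Gal K) N"
  shows "\<exists>(H :: (nat, 'l) hopf) act P Q. hopf_galois_structure K H act \<and>
    hopf_mats H (group_hopf N) P Q \<and> induces K H act N P Q \<beta>"
proof -
  interpret N: group N by fact
  let ?N = "carrier N" and ?G = "carrier (Gal K)"
  have hom: "\<beta> \<in> hom (Gal K) (holomorph N)" and bij: "bij_betw (\<lambda>\<sigma>. fst (\<beta> \<sigma>)) ?G ?N"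
    using b by (auto simp: regular_embeddings_def)
  define \<alpha> where "\<alpha> \<sigma> = snd (\<beta> \<sigma>)" for \<sigma>
  have au: "\<alpha> \<sigma> \<in> auto N" and fN: "fst (\<beta> \<sigma>) \<in> ?N" if "\<sigma> \<in> ?G" for \<sigma>
    using hom_in_carrier[OF hom that] by (auto simp: \<alpha>_def mem_Times_iff)
  have cl: "\<alpha> \<sigma> n \<in> ?N" if "\<sigma> \<in> ?G" "n \<in> ?N" for \<sigma> n
    by (rule auto_closed[OF au[OF that(1)] that(2)])
  have comp: "\<alpha> (\<sigma> \<circ> \<tau>) n = \<alpha> \<sigma> (\<alpha> \<tau> n)" if "\<sigma> \<in> ?G" "\<tau> \<in> ?G" "n \<in> ?N" for \<sigma> \<tau> n
    unfolding \<alpha>_def by (rule Gal_action_comp(2)[OF hom that])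
  have bid: "\<beta> id = \<one>\<^bsub>holomorph N\<^esub>"
    using hom_one[OF hom group_Gal group_holomorph[OF N(1)]] by simp
  have one: "\<alpha> id n = n" if "n \<in> ?N" for n using that bid by (simp add: \<alpha>_def)
  have fst1: "fst (\<beta> id) = \<one>\<^bsub>N\<^esub>" using bid by simp
  have "\<exists>(I :: nat set) P Q. finite I \<and>
    (\<forall>n\<in>?N. \<forall>m\<in>?N. (\<Sum>i\<in>I. Q n i * P i m) = (if n = m then 1 else (0 :: 'l))) \<and>
    (\<forall>i\<in>I. \<forall>k\<in>I. (\<Sum>n\<in>?N. P i n * Q n k) = (if i = k then 1 else 0)) \<and>
    (\<forall>\<sigma>\<in>?G. \<forall>n\<in>?N. \<forall>i\<in>I. \<sigma> (P i n) = P i (\<alpha> \<sigma> n))"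
    by (rule descent[of ?N \<alpha>, OF N(2) cl one comp])
  then obtain I :: "nat set" and P Q where D: "finite I \<and>
    (\<forall>n\<in>?N. \<forall>m\<in>?N. (\<Sum>i\<in>I. Q n i * P i m) = (if n = m then 1 else (0 :: 'l))) \<and>
    (\<forall>i\<in>I. \<forall>k\<in>I. (\<Sum>n\<in>?N. P i n * Q n k) = (if i = k then 1 else 0)) \<and>
    (\<forall>\<sigma>\<in>?G. \<forall>n\<in>?N. \<forall>i\<in>I. \<sigma> (P i n) = P i (\<alpha> \<sigma> n))"
    by (elim exE) (erule that)
  have I: "finite I" using D by (rule conjunct1)
  have QP: "(\<Sum>i\<in>I. Q n i * P i m) = (if n = m then 1 else (0 :: 'l))" if "n \<in> ?N" "m \<in> ?N" for n m
    using D that by simp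
  have PQ: "(\<Sum>n\<in>?N. P i n * Q n k) = (if i = k then 1 else 0)" if "i \<in> I" "k \<in> I" for i k
    using D that by simp
  have eP: "\<sigma> (P i n) = P i (\<alpha> \<sigma> n)" if "\<sigma> \<in> ?G" "n \<in> ?N" "i \<in> I" for \<sigma> n i
    using D that by simp
  define H where "H = transported_hopf I N P Q"
  have HI: "hbasis H = I" by (simp add: H_def transported_hopf_def)
  have mats: "hopf_mats H (group_hopf N) P Q"
    unfolding H_def by (rule transported_hopf_mats[OF N I PQ QP])
  interpret T: hopf_group_type H N P Q
    by unfold_locales (use N I HI mats in auto)
  have re: "(\<Sum>n\<in>?N. g (\<alpha> \<sigma> n)) = (\<Sum>n\<in>?N. g n)" if "\<sigma> \<in> ?G" for \<sigma> and g :: "_ \<Rightarrow> 'l"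
    by (rule sum.reindex_bij_betw[OF auto_bij[OF au[OF that]]])
  \<comment> \<open>\<open>Q\<close> inherits equivariance as the inverse of the equivariant
    \<open>P\<close>.\<close>
  have eQ: "\<sigma> (Q n i) = Q (\<alpha> \<sigma> n) i" if s: "\<sigma> \<in> ?G" and n: "n \<in> ?N" and i: "i \<in> I" for \<sigma> n i
  proof -
    interpret s: field_endo \<sigma> by (rule Gal_field_endo[OF s])
    have "\<sigma> (Q n i) = (\<Sum>j\<in>I. \<sigma> (Q n j) * (\<Sum>m\<in>?N. P j m * Q m i))"
      using I i by (simp add: PQ sum_delta_left)
    also have "\<dots> = (\<Sum>m\<in>?N. (\<Sum>j\<in>I. \<sigma> (Q n j) * P j m) * Q m i)"
      by (rule sum_linear)
    also have "\<dots> = (\<Sum>m\<in>?N. (\<Sum>j\<in>I. \<sigma> (Q n j) * P j (\<alpha> \<sigma> m)) * Q (\<alpha> \<sigma> m) i)"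
      by (rule re[OF s, symmetric])
    also have "\<dots> = (\<Sum>m\<in>?N. \<sigma> (\<Sum>j\<in>I. Q n j * P j m) * Q (\<alpha> \<sigma> m) i)"
      using s by (simp add: s.sum s.mult eP)
    also have "\<dots> = (\<Sum>m\<in>?N. (if n = m then 1 else 0) * Q (\<alpha> \<sigma> m) i)"
      using n by (intro sum.cong refl) (simp add: QP s.one s.zero)
    finally show ?thesis using N n by (simp add: sum_delta_left)
  qed
  have inK: "c \<in> K" if "\<And>\<sigma>. \<sigma> \<in> ?G \<Longrightarrow> \<sigma> c = c" for c by (rule fixed) (rule that)
  have hopf: "hopf_algebra K H"
  proof (rule T.hopf_algebraI; rule inK)
    fix \<sigma> assume s: "\<sigma> \<in> ?G"
    interpret s: field_endo \<sigma> by (rule Gal_field_endo[OF s])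
    show "\<sigma> (hmult H i j k) = hmult H i j k" if "i \<in> hbasis H" "j \<in> hbasis H" "k \<in> hbasis H" for i j k
    proof -
      have "\<sigma> (hmult H i j k) = (\<Sum>a\<in>?N. P i (\<alpha> \<sigma> a) * (\<Sum>b\<in>?N. P j (\<alpha> \<sigma> b) * Q (\<alpha> \<sigma> a \<otimes>\<^bsub>N\<^esub> \<alpha> \<sigma> b) k))"
        using that s by (simp add: T.hmult_eq HI s.sum s.mult eP eQ auto_mult[OF au])
      also have "\<dots> = (\<Sum>a\<in>?N. P i (\<alpha> \<sigma> a) * (\<Sum>b\<in>?N. P j b * Q (\<alpha> \<sigma> a \<otimes>\<^bsub>N\<^esub> b) k))"
        by (rule sum_mult_cong)
          (rule re[OF s, of "\<lambda>b. P j b * Q (\<alpha> \<sigma> a \<otimes>\<^bsub>N\<^esub> b) k" for a])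
      also have "\<dots> = (\<Sum>a\<in>?N. P i a * (\<Sum>b\<in>?N. P j b * Q (a \<otimes>\<^bsub>N\<^esub> b) k))"
        by (rule re[OF s])
      finally show ?thesis using that by (simp add: T.hmult_eq)
    qed
    show "\<sigma> (hunit H i) = hunit H i" if "i \<in> hbasis H" for i
      using that s eQ[OF s N.one_closed, of i] by (simp add: T.Q_unit HI auto_one[OF N(1) au])
    show "\<sigma> (hcomult H i j k) = hcomult H i j k" if "i \<in> hbasis H" "j \<in> hbasis H" "k \<in> hbasis H" for i j k
      using that s re[OF s, of "\<lambda>n. P i n * (Q n j * Q n k)"]
      by (simp add: T.hcomult_eq HI s.sum s.mult eP eQ)
    show "\<sigma> (hcounit H i) = hcounit H i" if "i \<in> hbasis H" for i
      using that s re[OF s, of "P i"] by (simp add: T.hcounit_eq HI s.sum eP)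
    show "\<sigma> (hantipode H i j) = hantipode H i j" if "i \<in> hbasis H" "j \<in> hbasis H" for i j
    proof -
      have e: "hantipode H i j = (\<Sum>a\<in>?N. P i a * Q (inv\<^bsub>N\<^esub> a) j)"
        by (simp add: H_def transported_hopf_def)
      have "\<alpha> \<sigma> (inv\<^bsub>N\<^esub> a) = inv\<^bsub>N\<^esub> (\<alpha> \<sigma> a)" if "a \<in> ?N" for a
      proof (rule N.inv_equality[symmetric])
        show "\<alpha> \<sigma> (inv\<^bsub>N\<^esub> a) \<otimes>\<^bsub>N\<^esub> \<alpha> \<sigma> a = \<one>\<^bsub>N\<^esub>"
          using auto_mult[OF au[OF s], of "inv\<^bsub>N\<^esub> a" a] that auto_one[OF N(1) au[OF s]] by simp
      qed (use that cl[OF s] in auto)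
      then show ?thesis using that s re[OF s, of "\<lambda>a. P i a * Q (inv\<^bsub>N\<^esub> a) j"]
        by (simp add: e HI s.sum s.mult eP eQ)
    qed
  qed
  define w where "w = inv_into ?G (\<lambda>\<sigma>. fst (\<beta> \<sigma>))"
  have wG: "w n \<in> ?G" and bw: "fst (\<beta> (w n)) = n" if "n \<in> ?N" for n
  proof -
    have n: "n \<in> (\<lambda>\<sigma>. fst (\<beta> \<sigma>)) ` ?G" using bij that by (simp add: bij_betw_def)
    show "w n \<in> ?G" unfolding w_def by (rule inv_into_into[OF n])
    show "fst (\<beta> (w n)) = n" unfolding w_def by (rule f_inv_into_f[OF n])
  qed
  have wb: "w (fst (\<beta> \<sigma>)) = \<sigma>" if "\<sigma> \<in> ?G" for \<sigma>
    using bij_betw_inv_into_left[OF bij that] by (simp add: w_def)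
  have bij_w: "bij_betw w ?N ?G" unfolding w_def by (rule bij_betw_inv_into[OF bij])
  have w1: "w \<one>\<^bsub>N\<^esub> = id" using wb[OF id_Gal] fst1 by simp
  \<comment> \<open>The rule \<open>v_comp\<close> read backwards: \<open>w\<close> takes the place
    of \<open>v\<close> and is found from the holomorph product.\<close>
  have wcomp: "w n (w m x) = w (n \<otimes>\<^bsub>N\<^esub> \<alpha> (w n) m) x" if "n \<in> ?N" "m \<in> ?N" for n m x
    using wb[OF Gal_comp[OF wG wG], OF that] Gal_action_comp(1)[OF hom wG wG, OF that] bw that
    by (simp add: \<alpha>_def fun_eq_iff)
  define act where "act i x = (\<Sum>n\<in>?N. P i n * w n x)" for i x
  have act_sum: "(\<Sum>i\<in>I. l i * act i x) = (\<Sum>n\<in>?N. (\<Sum>i\<in>I. l i * P i n) * w n x)" for l x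
    unfolding act_def by (rule sum_linear)
  have Qact: "(\<Sum>i\<in>I. Q n i * act i x) = w n x" if "n \<in> ?N" for n x
    using that N by (simp add: act_sum QP sum_delta_left)
  interpret HA: hopf_algebra K H by (rule hopf)
  have End_sum: "(\<lambda>x. \<Sum>n\<in>?N. c n * w n x) \<in> End K" for c
    using wG by (auto simp: End_def mem_Gal distrib_left sum.distrib sum_distrib_left mult.left_commute)
  have sumG: "(\<Sum>n\<in>?N. a (w n) * w n x) = (\<Sum>\<sigma>\<in>?G. a \<sigma> * \<sigma> x)" for a x
    by (rule sum.reindex_bij_betw[OF bij_w])
  have hgs: "hopf_galois_structure K H act"
  proof
    show "act i \<in> End K" if "i \<in> hbasis H" for i
      using End_sum[of "P i"] by (simp add: act_def[abs_def])
    show "act i (act j x) = (\<Sum>s\<in>hbasis H. hmult H i j s * act s x)" if "i \<in> hbasis H" "j \<in> hbasis H" for i j x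
    proof -
      have "act i (act j x) = (\<Sum>a\<in>?N. P i a * (\<Sum>b\<in>?N. P j (\<alpha> (w a) b) * w (a \<otimes>\<^bsub>N\<^esub> \<alpha> (w a) b) x))"
        unfolding act_def[of i]
      proof (rule sum_mult_cong)
        fix a assume a: "a \<in> ?N"
        interpret s: field_endo "w a" by (rule Gal_field_endo[OF wG[OF a]])
        show "w a (act j x) = (\<Sum>b\<in>?N. P j (\<alpha> (w a) b) * w (a \<otimes>\<^bsub>N\<^esub> \<alpha> (w a) b) x)"
          using that by (simp add: act_def s.sum s.mult eP[OF wG[OF a]] HI wcomp[OF a])
      qed
      \<comment> \<open>Equivariance of \<open>P j\<close> has produced the same twist in both
        places, so summing along the automorphism \<open>\<alpha> (w a)\<close> removes it and
        leaves the plain product of \<open>N\<close>.\<close>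
      also have "\<dots> = (\<Sum>a\<in>?N. P i a * (\<Sum>b\<in>?N. P j b * w (a \<otimes>\<^bsub>N\<^esub> b) x))"
        by (rule sum_mult_cong) (rule re[OF wG])
      also have "\<dots> = (\<Sum>s\<in>hbasis H. hmult H i j s * act s x)"
        unfolding act_def T.hmult_sum[OF that] by (simp add: sum_distrib_left mult.assoc)
      finally show ?thesis .
    qed
    show "(\<Sum>s\<in>hbasis H. hunit H s * act s x) = x" for x
      using Qact[of "\<one>\<^bsub>N\<^esub>" x] by (simp add: T.Q_unit HI w1)
    show "act i (x * y) = (\<Sum>j\<in>hbasis H. \<Sum>k\<in>hbasis H. hcomult H i j k * act j x * act k y)"
      if i: "i \<in> hbasis H" for i x y
    proof -
      have "(\<Sum>j\<in>hbasis H. \<Sum>k\<in>hbasis H. hcomult H i j k * act j x * act k y)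
        = (\<Sum>j\<in>hbasis H. \<Sum>k\<in>hbasis H. hcomult H i j k *
            (\<Sum>n\<in>?N. \<Sum>m\<in>?N. P j n * P k m * (w n x * w m y)))"
        unfolding act_def mult.assoc sum_product by (simp add: mult_ac)
      also have "\<dots> = (\<Sum>n\<in>?N. P i n * (w n x * w n y))"
        by (rule T.hcomult_sum[OF i])
      finally show ?thesis by (simp add: act_def Gal_mult[OF wG])
    qed
    show "act i 1 = hcounit H i" if "i \<in> hbasis H" for i
      using that by (simp add: act_def T.hcounit_eq field_endo.one[OF Gal_field_endo[OF wG]])
    show "bij_betw (\<lambda>l x. \<Sum>i\<in>hbasis H. l i * act i x) (hbasis H \<rightarrow>\<^sub>E UNIV) (End K)"
      unfolding HI
    proof (rule bij_betwI')
      fix l l' :: "nat \<Rightarrow> 'l" assume l: "l \<in> I \<rightarrow>\<^sub>E UNIV" "l' \<in> I \<rightarrow>\<^sub>E UNIV"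
      show "((\<lambda>x. \<Sum>i\<in>I. l i * act i x) = (\<lambda>x. \<Sum>i\<in>I. l' i * act i x)) = (l = l')"
      proof
        assume eq: "(\<lambda>x. \<Sum>i\<in>I. l i * act i x) = (\<lambda>x. \<Sum>i\<in>I. l' i * act i x)"
        define c where "c n = (\<Sum>i\<in>I. (l i - l' i) * P i n)" for n
        have "(\<Sum>n\<in>?N. c n * w n z) = 0" for z
        proof -
          have "(\<Sum>n\<in>?N. c n * w n z) = (\<Sum>i\<in>I. (l i - l' i) * act i z)"
            by (simp add: act_sum c_def)
          also have "\<dots> = 0" using fun_cong[OF eq, of z] by (simp add: left_diff_distrib sum_subtractf)
          finally show ?thesis .
        qed
        moreover have "(\<Sum>n\<in>?N. c n * w n z) = (\<Sum>\<sigma>\<in>?G. c (fst (\<beta> \<sigma>)) * \<sigma> z)" for z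
          unfolding sumG[symmetric] by (simp add: bw)
        ultimately have c0: "c n = 0" if "n \<in> ?N" for n
          using Gal_independent[of "\<lambda>\<sigma>. c (fst (\<beta> \<sigma>))" "w n"] that by (simp add: wG bw)
        have "l i = l' i" if i: "i \<in> I" for i
        proof -
          have "l i - l' i = (\<Sum>j\<in>I. (l j - l' j) * (\<Sum>n\<in>?N. P j n * Q n i))"
            using i I by (simp add: PQ sum_delta_left)
          also have "\<dots> = (\<Sum>n\<in>?N. c n * Q n i)" unfolding c_def by (rule sum_linear)
          also have "\<dots> = 0" using c0 by simp
          finally show ?thesis by simp
        qed
        then show "l = l'" using l by (auto intro: PiE_ext)
      qed simp
    next
      fix l :: "nat \<Rightarrow> 'l"
      show "(\<lambda>x. \<Sum>i\<in>I. l i * act i x) \<in> End K"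
        unfolding act_sum by (rule End_sum)
    next
      fix f assume "f \<in> End K"
      then obtain a where a: "\<And>z. f z = (\<Sum>\<sigma>\<in>?G. a \<sigma> * \<sigma> z)" using End_in_span_Gal by blast
      let ?l = "\<lambda>i\<in>I. \<Sum>n\<in>?N. a (w n) * Q n i"
      have "f z = (\<Sum>i\<in>I. ?l i * act i z)" for z
      proof -
        have "(\<Sum>i\<in>I. ?l i * act i z) = (\<Sum>n\<in>?N. a (w n) * (\<Sum>i\<in>I. Q n i * act i z))"
          by (simp add: sum_linear)
        also have "\<dots> = f z" by (simp add: Qact a sumG)
        finally show ?thesis by simp
      qed
      then show "\<exists>l\<in>I \<rightarrow>\<^sub>E UNIV. f = (\<lambda>x. \<Sum>i\<in>I. l i * act i x)"
        by (intro bexI[of _ ?l]) auto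
    qed
  qed
  have "induces K H act N P Q \<beta>"
    using b by (simp add: induces_def HI Qact fN wb eP eQ \<alpha>_def[symmetric])
  then show ?thesis using hgs mats by blast
qed

end

section \<open>Counting Hopf-Galois structures\<close>

lemma card_quotient_kernel:
  assumes r: "r = {(x, y). x \<in> A \<and> y \<in> A \<and> f x = f y}"
  shows "card (A // r) = card (f ` A)"
proof -
  have cls: "r `` {x} = {y \<in> A. f y = f x}" if "x \<in> A" for x using that by (auto simp: r)
  have "bij_betw (\<lambda>y. {x \<in> A. f x = y}) (f ` A) (A // r)"
  proof (rule bij_betw_imageI)
    show "inj_on (\<lambda>y. {x \<in> A. f x = y}) (f ` A)" by (auto simp: inj_on_def)
    show "(\<lambda>y. {x \<in> A. f x = y}) ` f ` A = A // r"
      by (auto simp: quotient_def cls image_image)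
  qed
  then show ?thesis by (rule bij_betw_same_card[symmetric])
qed

text \<open>All sums over \<open>N\<close> are reindexed along the automorphism
  \<open>\<gamma>\<close>, which respects every structure map of the group algebra.\<close>

lemma mats_permute:
  fixes H :: "('i, 'l::field) hopf"
  assumes N: "group N" and g: "\<gamma> \<in> auto N" and m: "hopf_mats H (group_hopf N) P Q"
  shows "hopf_mats H (group_hopf N) (\<lambda>i n. P i (\<gamma> n)) (\<lambda>n i. Q (\<gamma> n) i)"
proof -
  interpret group N by fact
  let ?N = "carrier N"
  have re: "(\<Sum>n\<in>?N. f (\<gamma> n)) = (\<Sum>n\<in>?N. f n)" for f :: "_ \<Rightarrow> 'l"
    by (rule sum.reindex_bij_betw[OF auto_bij[OF g]])
  have cl: "\<gamma> n \<in> ?N" if "n \<in> ?N" for n by (rule auto_closed[OF g that])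
  have eq: "\<gamma> a = \<gamma> b \<longleftrightarrow> a = b" if "a \<in> ?N" "b \<in> ?N" for a b
    using auto_bij[OF g] that by (auto simp: bij_betw_def dest: inj_onD)
  have mul: "\<gamma> c = \<gamma> a \<otimes>\<^bsub>N\<^esub> \<gamma> b \<longleftrightarrow> c = a \<otimes>\<^bsub>N\<^esub> b" if "a \<in> ?N" "b \<in> ?N" "c \<in> ?N" for a b c
    using eq[of c "a \<otimes>\<^bsub>N\<^esub> b"] that by (simp add: auto_mult[OF g])
  have one: "\<gamma> c = \<one>\<^bsub>N\<^esub> \<longleftrightarrow> c = \<one>\<^bsub>N\<^esub>" if "c \<in> ?N" for c
    using eq[of c "\<one>\<^bsub>N\<^esub>"] that by (simp add: auto_one[OF N g])
  have "\<gamma> (inv\<^bsub>N\<^esub> a) = inv\<^bsub>N\<^esub> (\<gamma> a)" if "a \<in> ?N" for a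
    by (rule inv_equality[symmetric]) (use that auto_mult[OF g, of "inv\<^bsub>N\<^esub> a" a] auto_one[OF N g] cl in auto)
  then have inv: "\<gamma> c = inv\<^bsub>N\<^esub> (\<gamma> a) \<longleftrightarrow> c = inv\<^bsub>N\<^esub> a" if "a \<in> ?N" "c \<in> ?N" for a c
    using eq[of c "inv\<^bsub>N\<^esub> a"] that by simp
  show ?thesis
  proof (rule hopf_matsI)
    show "(\<Sum>j\<in>hbasis (group_hopf N). P i (\<gamma> j) * Q (\<gamma> j) k) = (if i = k then 1 else 0)"
      if "i \<in> hbasis H" "k \<in> hbasis H" for i k
      using hopf_mats_inv_left[OF m that] re[of "\<lambda>n. P i n * Q n k"] by simp
    show "(\<Sum>i\<in>hbasis H. Q (\<gamma> j) i * P i (\<gamma> k)) = (if j = k then 1 else 0)"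
      if "j \<in> hbasis (group_hopf N)" "k \<in> hbasis (group_hopf N)" for j k
      using hopf_mats_inv_right[OF m, of "\<gamma> j" "\<gamma> k"] cl eq that by simp
    show "(\<Sum>s\<in>hbasis H. hmult H i j s * P s (\<gamma> t)) =
       (\<Sum>a\<in>hbasis (group_hopf N). \<Sum>b\<in>hbasis (group_hopf N). P i (\<gamma> a) * P j (\<gamma> b) * hmult (group_hopf N) a b t)"
      if "i \<in> hbasis H" "j \<in> hbasis H" "t \<in> hbasis (group_hopf N)" for i j t
    proof -
      have t: "t \<in> ?N" using that by simp
      have "(\<Sum>s\<in>hbasis H. hmult H i j s * P s (\<gamma> t)) =
          (\<Sum>a\<in>?N. \<Sum>b\<in>?N. P i a * P j b * (if \<gamma> t = a \<otimes>\<^bsub>N\<^esub> b then 1 else 0))"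
        using hopf_mats_mult[OF m that(1,2), of "\<gamma> t"] cl[OF t] by simp
      also have "\<dots> = (\<Sum>a\<in>?N. \<Sum>b\<in>?N. P i (\<gamma> a) * P j b * (if \<gamma> t = \<gamma> a \<otimes>\<^bsub>N\<^esub> b then 1 else 0))"
        by (rule re[symmetric])
      also have "\<dots> = (\<Sum>a\<in>?N. \<Sum>b\<in>?N. P i (\<gamma> a) * P j (\<gamma> b) * (if \<gamma> t = \<gamma> a \<otimes>\<^bsub>N\<^esub> \<gamma> b then 1 else 0))"
        by (rule sum.cong[OF refl], rule re[symmetric])
      finally show ?thesis using t by (simp add: mul)
    qed
    show "(\<Sum>s\<in>hbasis H. hunit H s * P s (\<gamma> t)) = hunit (group_hopf N) t" if "t \<in> hbasis (group_hopf N)" for t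
      using hopf_mats_unit[OF m, of "\<gamma> t"] that cl by (simp add: one)
    show "(\<Sum>j\<in>hbasis H. \<Sum>k\<in>hbasis H. hcomult H i j k * P j (\<gamma> c) * P k (\<gamma> d)) =
       (\<Sum>a\<in>hbasis (group_hopf N). P i (\<gamma> a) * hcomult (group_hopf N) a c d)"
      if "i \<in> hbasis H" "c \<in> hbasis (group_hopf N)" "d \<in> hbasis (group_hopf N)" for i c d
      using hopf_mats_comult[OF m that(1), of "\<gamma> c" "\<gamma> d"] that cl
        re[of "\<lambda>a. P i a * (if \<gamma> c = a \<and> \<gamma> d = a then 1 else 0)"]
      by (simp add: eq)
    show "hcounit H i = (\<Sum>a\<in>hbasis (group_hopf N). P i (\<gamma> a) * hcounit (group_hopf N) a)"
      if "i \<in> hbasis H" for i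
      using hopf_mats_counit[OF m that] re[of "P i"] by simp
    show "(\<Sum>s\<in>hbasis H. hantipode H i s * P s (\<gamma> t)) =
       (\<Sum>a\<in>hbasis (group_hopf N). P i (\<gamma> a) * hantipode (group_hopf N) a t)"
      if "i \<in> hbasis H" "t \<in> hbasis (group_hopf N)" for i t
      using hopf_mats_antipode[OF m that(1), of "\<gamma> t"] that cl
        re[of "\<lambda>a. P i a * (if \<gamma> t = inv\<^bsub>N\<^esub> a then 1 else 0)"]
      by (simp add: inv)
  qed
qed

abbreviation conj_emb where
  "conj_emb K N \<alpha> \<beta> \<equiv> compose (carrier (Gal K)) (map_prod \<alpha> (conj_auto N N \<alpha>)) \<beta>"

text \<open>Renaming the grouplike vectors by \<open>\<alpha>\<close> conjugates the embedding.
  \<open>P'\<close> and \<open>Q'\<close> are only constrained, not defined, since they are either a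
  second given identification or one constructed from \<open>\<alpha>\<close>.\<close>

lemma induces_conj:
  assumes N: "group N" and b: "induces K H act N P Q \<beta>" and a: "\<alpha> \<in> auto N"
    and Q: "\<And>n i. n \<in> carrier N \<Longrightarrow> i \<in> hbasis H \<Longrightarrow> Q' (\<alpha> n) i = Q n i"
    and P: "\<And>n i. n \<in> carrier N \<Longrightarrow> i \<in> hbasis H \<Longrightarrow> P' i (\<alpha> n) = P i n"
  shows "induces K H act N P' Q' (conj_emb K N \<alpha> \<beta>)"
  unfolding induces_def
proof (intro conjI ballI allI)
  show "conj_emb K N \<alpha> \<beta> \<in> regular_embeddings (Gal K) N"
    by (rule conj_regular_embedding[OF group_Gal N N auto_iso[OF a]]) (use b in \<open>simp add: induces_def\<close>)
  fix \<sigma> assume s: "\<sigma> \<in> carrier (Gal K)"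
  have "\<beta> \<sigma> \<in> carrier (holomorph N)"
    by (rule hom_in_carrier[of \<beta> "Gal K"]) (use b s in \<open>auto simp: induces_def regular_embeddings_def\<close>)
  then have mem: "fst (\<beta> \<sigma>) \<in> carrier N" "snd (\<beta> \<sigma>) \<in> auto N" by (auto simp: mem_Times_iff)
  show "(\<Sum>i\<in>hbasis H. Q' (fst (conj_emb K N \<alpha> \<beta> \<sigma>)) i * act i x) = \<sigma> x" for x
    using b s mem Q by (simp add: induces_def compose_eq)
  fix n i assume n: "n \<in> carrier N" and i: "i \<in> hbasis H"
  have "n \<in> \<alpha> ` carrier N" using n auto_bij[OF a] by (simp add: bij_betw_def)
  then obtain m where m: "m \<in> carrier N" "n = \<alpha> m" by blast
  have sm: "snd (\<beta> \<sigma>) m \<in> carrier N" by (rule auto_closed[OF mem(2) m(1)])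
  have "snd (conj_emb K N \<alpha> \<beta> \<sigma>) n = \<alpha> (snd (\<beta> \<sigma>) m)"
    using s m conj_auto_apply[OF auto_iso[OF a] m(1)] by (simp add: compose_eq)
  then show "\<sigma> (Q' n i) = Q' (snd (conj_emb K N \<alpha> \<beta> \<sigma>) n) i"
    and "\<sigma> (P' i n) = P' i (snd (conj_emb K N \<alpha> \<beta> \<sigma>) n)"
    using b s m i sm by (simp_all add: induces_def Q P)
qed

lemma inv_auto:
  assumes N: "group N" and a: "\<alpha> \<in> auto N"
  shows "\<exists>\<gamma>\<in>auto N. \<forall>n\<in>carrier N. \<gamma> (\<alpha> n) = n"
proof (intro bexI ballI)
  interpret group N by fact
  let ?g = "restrict (inv_into (carrier N) \<alpha>) (carrier N)"
  show "?g \<in> auto N"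
  proof (rule autoI)
    show "?g \<in> iso N N" by (rule iso_eq[OF iso_set_sym[OF auto_iso[OF a]]]) simp
  qed simp
  fix n assume n: "n \<in> carrier N"
  show "?g (\<alpha> n) = n"
    using bij_betw_inv_into_left[OF auto_bij[OF a] n] auto_closed[OF a n] by simp
qed

text \<open>The embeddings from all identifications with the group algebra at once. Unlike a single
  embedding, this set depends on the structure only; it turns out to be a complete invariant up to
  isomorphism.\<close>

definition embeddings_of ::
  "'l::field set \<Rightarrow> ('g, 'm) monoid_scheme \<Rightarrow> ('i, 'l) hopf \<times> ('i \<Rightarrow> 'l \<Rightarrow> 'l) \<Rightarrow> (('l \<Rightarrow> 'l) \<Rightarrow> 'g \<times> ('g \<Rightarrow> 'g)) set" where
  "embeddings_of K N S = {\<beta>. \<exists>P Q. hopf_mats (fst S) (group_hopf N) P Q \<and> induces K (fst S) (snd S) N P Q \<beta>}"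

lemma has_type_iff: "has_type H N \<longleftrightarrow> (\<exists>P Q. hopf_mats H (group_hopf N) P Q)"
  by (simp add: has_type_def is_hopf_iso_iff)

context finite_galois
begin

lemma typed:
  assumes N: "group N" "finite (carrier N)" and "hopf_galois_structure K H act" "hopf_mats H (group_hopf N) P Q"
  shows "typed_hopf_galois K H act N P Q"
proof -
  interpret hopf_galois_structure K H act by fact
  show ?thesis
    by (intro typed_hopf_galois.intro hopf_group_type.intro finite_galois_axioms assms finite_basis)
qed

text \<open>Two identifications differ by an automorphism of \<open>N\<close>, by the comparison of
  grouplike vectors for the identity endomorphism; conversely each automorphism changes a given
  identification into another one.\<close>

lemma embeddings_of_orbit:
  assumes N: "group N" "finite (carrier N)" and S: "hopf_galois_structure K H act"
    and PQ: "hopf_mats H (group_hopf N) P Q" and b: "induces K H act N P Q \<beta>"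
  shows "embeddings_of K N (H, act) = (\<lambda>\<alpha>. conj_emb K N \<alpha> \<beta>) ` auto N"
proof (intro equalityI subsetI)
  interpret T: typed_hopf_galois K H act N P Q by (rule typed[OF N S PQ])
  fix \<gamma> assume "\<gamma> \<in> embeddings_of K N (H, act)"
  then obtain P' Q' where PQ': "hopf_mats H (group_hopf N) P' Q'" and g: "induces K H act N P' Q' \<gamma>"
    by (auto simp: embeddings_of_def)
  interpret T': typed_hopf_galois K H act N P' Q' by (rule typed[OF N S PQ'])
  interpret pr: hopf_group_type_pair H N P Q P' Q' "\<lambda>x. x"
    by (rule T.pair[OF _ _ PQ']) (unfold_locales, auto)
  obtain \<alpha> where a: "\<alpha> \<in> auto N" "\<forall>n\<in>carrier N. \<forall>i\<in>hbasis H. Q n i = Q' (\<alpha> n) i \<and> P i n = P' i (\<alpha> n)"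
    using pr.grouplike_auto by blast
  have "induces K H act N P' Q' (conj_emb K N \<alpha> \<beta>)"
    by (rule induces_conj[OF N(1) b a(1)]) (use a(2) in auto)
  then have "\<gamma> = conj_emb K N \<alpha> \<beta>" by (rule T'.induces_unique[OF g])
  then show "\<gamma> \<in> (\<lambda>\<alpha>. conj_emb K N \<alpha> \<beta>) ` auto N" using a(1) by blast
next
  fix \<gamma> assume "\<gamma> \<in> (\<lambda>\<alpha>. conj_emb K N \<alpha> \<beta>) ` auto N"
  then obtain \<alpha> where a: "\<alpha> \<in> auto N" and g: "\<gamma> = conj_emb K N \<alpha> \<beta>" by blast
  obtain \<delta> where d: "\<delta> \<in> auto N" "\<forall>n\<in>carrier N. \<delta> (\<alpha> n) = n" using inv_auto[OF N(1) a] by blast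
  have "induces K H act N (\<lambda>i n. P i (\<delta> n)) (\<lambda>n i. Q (\<delta> n) i) \<gamma>"
    unfolding g by (rule induces_conj[OF N(1) b a]) (use d in auto)
  then show "\<gamma> \<in> embeddings_of K N (H, act)"
    using mats_permute[OF N(1) d(1) PQ] by (auto simp: embeddings_of_def)
qed

text \<open>The action of \<open>auto N\<close> is free: the first components of an embedding
  exhaust \<open>N\<close>, so an automorphism can be read off from the conjugated
  embedding.\<close>

lemma card_embeddings_of:
  assumes N: "group N" "finite (carrier N)" and S: "hopf_galois_structure K H act" and ty: "has_type H N"
  shows "card (embeddings_of K N (H, act)) = card (auto N)"
proof -
  obtain P Q where PQ: "hopf_mats H (group_hopf N) P Q" using ty by (auto simp: has_type_iff)
  interpret T: typed_hopf_galois K H act N P Q by (rule typed[OF N S PQ])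
  let ?\<beta> = T.emb
  have b: "induces K H act N P Q ?\<beta>" by (rule T.emb_induces)
  have bij: "(\<lambda>\<sigma>. fst (?\<beta> \<sigma>)) ` carrier (Gal K) = carrier N"
    using b by (auto simp: induces_def regular_embeddings_def bij_betw_def)
  have "inj_on (\<lambda>\<alpha>. conj_emb K N \<alpha> ?\<beta>) (auto N)"
  proof (rule inj_onI)
    fix \<alpha> \<gamma> assume a: "\<alpha> \<in> auto N" "\<gamma> \<in> auto N" and eq: "conj_emb K N \<alpha> ?\<beta> = conj_emb K N \<gamma> ?\<beta>"
    show "\<alpha> = \<gamma>"
    proof (rule extensionalityI[of _ "carrier N"])
      fix n assume "n \<in> carrier N"
      then have "n \<in> (\<lambda>\<sigma>. fst (?\<beta> \<sigma>)) ` carrier (Gal K)" using bij by simp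
      then obtain \<sigma> where "\<sigma> \<in> carrier (Gal K)" "n = fst (?\<beta> \<sigma>)" by blast
      then show "\<alpha> n = \<gamma> n" using arg_cong[OF fun_cong[OF eq, of \<sigma>], of fst] by (simp add: compose_eq)
    qed (use a in \<open>simp_all add: auto_extensional\<close>)
  qed
  then show ?thesis unfolding embeddings_of_orbit[OF N S PQ b] by (rule card_image)
qed

text \<open>An identification for \<open>H'\<close> is composed with the isomorphism
  \<open>A\<close>. Entries in \<open>K\<close> are fixed by the Galois group, so the composite
  permutes in the same way and induces the same embedding.\<close>

lemma embeddings_of_mono:
  assumes fin: "finite (hbasis H)" "finite (hbasis H')" "finite (carrier N)"
    and AB: "hopf_mats H H' A B"
    and BK: "\<And>i j. i \<in> hbasis H \<Longrightarrow> j \<in> hbasis H' \<Longrightarrow> A i j \<in> K \<and> B j i \<in> K"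
    and act: "\<And>i x. i \<in> hbasis H \<Longrightarrow> act i x = (\<Sum>j\<in>hbasis H'. A i j * act' j x)"
  shows "embeddings_of K N (H', act') \<subseteq> embeddings_of K N (H, act)"
proof
  fix \<beta> assume "\<beta> \<in> embeddings_of K N (H', act')"
  then obtain P Q where PQ: "hopf_mats H' (group_hopf N) P Q" and b: "induces K H' act' N P Q \<beta>"
    by (auto simp: embeddings_of_def)
  let ?P = "\<lambda>i n. \<Sum>j\<in>hbasis H'. A i j * P j n" and ?Q = "\<lambda>n i. \<Sum>j\<in>hbasis H'. Q n j * B j i"
  have "hopf_mats H (group_hopf N) ?P ?Q"
    by (rule hopf_mats_trans[OF _ _ _ AB PQ]) (use fin in auto)
  moreover have "induces K H act N ?P ?Q \<beta>"
    unfolding induces_def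
  proof (intro conjI ballI allI)
    show "\<beta> \<in> regular_embeddings (Gal K) N" using b by (simp add: induces_def)
    fix \<sigma> assume s: "\<sigma> \<in> carrier (Gal K)"
    interpret s: field_endo \<sigma> by (rule Gal_field_endo[OF s])
    show "(\<Sum>i\<in>hbasis H. ?Q (fst (\<beta> \<sigma>)) i * act i x) = \<sigma> x" for x
    proof -
      have "(\<Sum>i\<in>hbasis H. ?Q (fst (\<beta> \<sigma>)) i * act i x)
          = (\<Sum>i\<in>hbasis H. ?Q (fst (\<beta> \<sigma>)) i * (\<Sum>j\<in>hbasis H'. A i j * act' j x))"
        by (simp add: act)
      also have "\<dots> = (\<Sum>j\<in>hbasis H'. Q (fst (\<beta> \<sigma>)) j * act' j x)"
        by (rule sum_inverse_comp[OF fin(2) hopf_mats_inv_right[OF AB]])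
      finally show ?thesis using b s by (simp add: induces_def)
    qed
    fix n i assume "n \<in> carrier N" "i \<in> hbasis H"
    then show "\<sigma> (?Q n i) = ?Q (snd (\<beta> \<sigma>) n) i" "\<sigma> (?P i n) = ?P i (snd (\<beta> \<sigma>) n)"
      using b s BK Gal_fixes[OF s] by (simp_all add: induces_def s.sum s.mult)
  qed
  ultimately show "\<beta> \<in> embeddings_of K N (H, act)" by (auto simp: embeddings_of_def)
qed

text \<open>The composite \<open>?A\<close> of one identification with the inverse of the other is
  an isomorphism over the large field. As the Galois group permutes both by the same automorphisms,
  the entries of \<open>?A\<close> are invariant and lie in \<open>K\<close>. The actions agree
  because a group element acts as the same Galois element in both.\<close>

lemma iso_if_common_embedding:
  assumes N: "group N" "finite (carrier N)"
    and S: "hopf_galois_structure K H act" and S': "hopf_galois_structure K H' act'"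
    and b: "\<beta> \<in> embeddings_of K N (H, act)" "\<beta> \<in> embeddings_of K N (H', act')"
  shows "\<exists>A. is_hopf_iso K H H' A \<and> (\<forall>i\<in>hbasis H. \<forall>x. act i x = (\<Sum>j\<in>hbasis H'. A i j * act' j x))"
proof -
  interpret X: hopf_galois_structure K H act by fact
  interpret X': hopf_galois_structure K H' act' by fact
  obtain P Q where PQ: "hopf_mats H (group_hopf N) P Q" and i: "induces K H act N P Q \<beta>"
    using b by (auto simp: embeddings_of_def)
  obtain P' Q' where PQ': "hopf_mats H' (group_hopf N) P' Q'" and i': "induces K H' act' N P' Q' \<beta>"
    using b by (auto simp: embeddings_of_def)
  interpret T: typed_hopf_galois K H act N P Q by (rule typed[OF N S PQ])
  interpret T': typed_hopf_galois K H' act' N P' Q' by (rule typed[OF N S' PQ'])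
  let ?N = "carrier N"
  let ?A = "\<lambda>i j. \<Sum>n\<in>?N. P i n * Q' n j" and ?B = "\<lambda>j i. \<Sum>n\<in>?N. P' j n * Q n i"
  have m: "hopf_mats H H' ?A ?B"
    using hopf_mats_trans[OF _ _ _ PQ T'.mats'] N X.finite_basis X'.finite_basis by simp
  have inK: "(\<Sum>n\<in>?N. R n * R' n) \<in> K"
    if "\<And>\<sigma> n. \<sigma> \<in> carrier (Gal K) \<Longrightarrow> n \<in> ?N \<Longrightarrow> \<sigma> (R n) = R (snd (\<beta> \<sigma>) n) \<and> \<sigma> (R' n) = R' (snd (\<beta> \<sigma>) n)"
    for R R' :: "_ \<Rightarrow> 'l"
  proof (rule fixed)
    fix \<sigma> assume s: "\<sigma> \<in> carrier (Gal K)"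
    interpret s: field_endo \<sigma> by (rule Gal_field_endo[OF s])
    have "\<beta> \<sigma> \<in> carrier (holomorph N)"
      by (rule hom_in_carrier[of \<beta> "Gal K"]) (use i s in \<open>auto simp: induces_def regular_embeddings_def\<close>)
    then have au: "snd (\<beta> \<sigma>) \<in> auto N" by (auto simp: mem_Times_iff)
    have "\<sigma> (\<Sum>n\<in>?N. R n * R' n) = (\<Sum>n\<in>?N. R (snd (\<beta> \<sigma>) n) * R' (snd (\<beta> \<sigma>) n))"
      using that s by (simp add: s.sum s.mult)
    also have "\<dots> = (\<Sum>n\<in>?N. R n * R' n)"
      by (rule sum.reindex_bij_betw[OF auto_bij[OF au]])
    finally show "\<sigma> (\<Sum>n\<in>?N. R n * R' n) = (\<Sum>n\<in>?N. R n * R' n)" .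
  qed
  have "is_hopf_iso K H H' ?A"
    unfolding is_hopf_iso_iff
  proof (intro conjI exI[of _ ?B] ballI)
    show "?A i j \<in> K" if "i \<in> hbasis H" "j \<in> hbasis H'" for i j
      by (rule inK) (use i i' that in \<open>auto simp: induces_def\<close>)
    show "?B j i \<in> K" if "i \<in> hbasis H" "j \<in> hbasis H'" for i j
      by (rule inK) (use i i' that in \<open>auto simp: induces_def\<close>)
    show "hopf_mats H H' ?A ?B" by (rule m)
  qed
  moreover have "act k x = (\<Sum>j\<in>hbasis H'. ?A k j * act' j x)" if k: "k \<in> hbasis H" for k x
  proof -
    have vv: "T.v n x = T'.v n x" if n: "n \<in> ?N" for n
    proof -
      have "n \<in> (\<lambda>\<sigma>. fst (\<beta> \<sigma>)) ` carrier (Gal K)"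
        using i n by (simp add: induces_def regular_embeddings_def bij_betw_def)
      then obtain \<sigma> where "\<sigma> \<in> carrier (Gal K)" "n = fst (\<beta> \<sigma>)" by blast
      then show ?thesis using i i' by (simp add: induces_def T.v_def T'.v_def)
    qed
    have "act k x = (\<Sum>n\<in>?N. P k n * T'.v n x)"
      using k vv by (simp add: T.act_v)
    also have "\<dots> = (\<Sum>j\<in>hbasis H'. ?A k j * act' j x)"
      unfolding T'.v_def by (rule sum_linear)
    finally show ?thesis .
  qed
  ultimately show ?thesis by blast
qed

text \<open>Isomorphism classes correspond to the values of \<open>embeddings_of\<close>, which are
  pairwise disjoint, have \<open>card (auto N)\<close> elements each, and together make up all
  regular embeddings.\<close>

theorem hopf_galois_count:
  assumes N: "group N" "finite (carrier N)"
  shows "hopf_galois_count K N * card (auto N) = card (regular_embeddings (Gal K) N)"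
proof -
  let ?S = "hopf_galois_structures K N" and ?f = "embeddings_of K N"
  have S: "hopf_galois_structure K (fst s) (snd s)" "has_type (fst s) N" if "s \<in> ?S" for s
    using that by (auto simp: hopf_galois_structures_def)
  have nonempty: "\<exists>\<beta>. \<beta> \<in> ?f s" if s: "s \<in> ?S" for s
  proof -
    obtain P Q where PQ: "hopf_mats (fst s) (group_hopf N) P Q" using S(2)[OF s] by (auto simp: has_type_iff)
    interpret T: typed_hopf_galois K "fst s" "snd s" N P Q by (rule typed[OF N S(1)[OF s] PQ])
    show ?thesis using T.emb_induces PQ by (auto simp: embeddings_of_def)
  qed
  have iso: "(s, s') \<in> hopf_galois_iso K N" if "s \<in> ?S" "s' \<in> ?S" "\<beta> \<in> ?f s" "\<beta> \<in> ?f s'" for s s' \<beta>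
    using iso_if_common_embedding[OF N S(1)[OF that(1)] S(1)[OF that(2)], of \<beta>] that
    by (cases s; cases s') (simp add: hopf_galois_iso_def)
  have sub: "?f s' = ?f s" if ss: "(s, s') \<in> hopf_galois_iso K N" for s s'
  proof -
    obtain H act H' act' where eq: "s = (H, act)" "s' = (H', act')" by (metis prod.exhaust)
    have mem: "s \<in> ?S" "s' \<in> ?S" using ss by (auto simp: hopf_galois_iso_def)
    interpret X: hopf_galois_structure K H act using S(1)[OF mem(1)] eq by simp
    interpret X': hopf_galois_structure K H' act' using S(1)[OF mem(2)] eq by simp
    note fin' = X.finite_basis X'.finite_basis
    obtain A B where AK: "\<forall>i\<in>hbasis H. \<forall>j\<in>hbasis H'. A i j \<in> K" and BK: "\<forall>j\<in>hbasis H'. \<forall>i\<in>hbasis H. B j i \<in> K"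
      and m: "hopf_mats H H' A B" and act: "\<forall>i\<in>hbasis H. \<forall>x. act i x = (\<Sum>j\<in>hbasis H'. A i j * act' j x)"
      using ss by (auto simp: hopf_galois_iso_def eq is_hopf_iso_iff)
    have act': "act' j x = (\<Sum>i\<in>hbasis H. B j i * act i x)" if "j \<in> hbasis H'" for j x
      using that act fin' by (simp add: sum_linear hopf_mats_inv_right[OF m] sum_delta_left)
    show ?thesis unfolding eq
    proof (rule equalityI)
      show "?f (H', act') \<subseteq> ?f (H, act)"
        by (rule embeddings_of_mono[OF fin' N(2) m]) (use AK BK act in auto)
      show "?f (H, act) \<subseteq> ?f (H', act')"
        by (rule embeddings_of_mono[OF fin'(2,1) N(2) hopf_mats_sym[OF fin' m]]) (use AK BK act' in auto)
    qed
  qed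
  have r: "hopf_galois_iso K N = {(s, s'). s \<in> ?S \<and> s' \<in> ?S \<and> ?f s = ?f s'}"
  proof (intro equalityI subsetI)
    fix z assume z: "z \<in> hopf_galois_iso K N"
    then have "fst z \<in> ?S \<and> snd z \<in> ?S" by (auto simp: hopf_galois_iso_def)
    then show "z \<in> {(s, s'). s \<in> ?S \<and> s' \<in> ?S \<and> ?f s = ?f s'}"
      using sub[of "fst z" "snd z"] z by (simp add: case_prod_unfold)
  next
    fix z assume "z \<in> {(s, s'). s \<in> ?S \<and> s' \<in> ?S \<and> ?f s = ?f s'}"
    then have z: "fst z \<in> ?S" "snd z \<in> ?S" "?f (fst z) = ?f (snd z)" by auto
    then obtain \<beta> where "\<beta> \<in> ?f (fst z)" using nonempty by blast
    then show "z \<in> hopf_galois_iso K N" using iso[OF z(1,2), of \<beta>] z(3) by simp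
  qed
  have un: "\<Union> (?f ` ?S) = regular_embeddings (Gal K) N"
  proof (intro equalityI subsetI)
    fix \<beta> assume "\<beta> \<in> \<Union> (?f ` ?S)"
    then show "\<beta> \<in> regular_embeddings (Gal K) N" by (auto simp: embeddings_of_def induces_def)
  next
    fix \<beta> assume "\<beta> \<in> regular_embeddings (Gal K) N"
    then obtain H :: "(nat, 'l) hopf" and act P Q where "hopf_galois_structure K H act"
      "hopf_mats H (group_hopf N) P Q" "induces K H act N P Q \<beta>"
      using hopf_galois_structure_exists[OF N] by blast
    then have "(H, act) \<in> ?S" "\<beta> \<in> ?f (H, act)"
      by (auto simp: hopf_galois_structures_def has_type_iff embeddings_of_def)
    then show "\<beta> \<in> \<Union> (?f ` ?S)" by blast
  qed
  have finR: "finite (regular_embeddings (Gal K) N)" by (rule finite_regular_embeddings[OF fin N(2)])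
  then have "finite (?f ` ?S)" unfolding un[symmetric] by (rule finite_UnionD)
  then have "card (auto N) * card (?f ` ?S) = card (\<Union> (?f ` ?S))"
  proof (rule card_partition)
    show "finite (\<Union> (?f ` ?S))" using finR un by simp
    show "card c = card (auto N)" if "c \<in> ?f ` ?S" for c
      using that card_embeddings_of[OF N S] by auto
    show "c1 \<inter> c2 = {}" if c: "c1 \<in> ?f ` ?S" "c2 \<in> ?f ` ?S" "c1 \<noteq> c2" for c1 c2
    proof (rule ccontr)
      assume "c1 \<inter> c2 \<noteq> {}"
      then obtain \<beta> where b: "\<beta> \<in> c1" "\<beta> \<in> c2" by blast
      obtain s where s: "s \<in> ?S" "c1 = ?f s" using c(1) by blast
      obtain s' where s': "s' \<in> ?S" "c2 = ?f s'" using c(2) by blast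
      have "?f s' = ?f s" by (rule sub[OF iso[OF s(1) s'(1), of \<beta>]]) (use b s s' in auto)
      then show False using c(3) s s' by simp
    qed
  qed
  then show ?thesis
    using un by (simp add: hopf_galois_count_def card_quotient_kernel[OF r] mult.commute)
qed

end

section \<open>Sums of powers modulo primes\<close>

lemma sum_powers_eq: "(x - 1) * (\<Sum>j<m. x ^ j) = x ^ m - (1 :: int)"
  by (rule power_diff_1_eq[symmetric])

lemma sum_powers_cong_one:
  assumes "[t = 1] (mod m)"
  shows "[(\<Sum>j<k. t ^ j) = int k] (mod (m :: int))"
proof -
  have "[(\<Sum>j<k. t ^ j) = (\<Sum>j<k. 1)] (mod m)"
    by (rule cong_sum) (metis assms cong_pow power_one)
  then show ?thesis by simp
qed

lemma sum_powers_mult: "(\<Sum>j<m * k. t ^ j) = (\<Sum>j<m. t ^ j) * (\<Sum>i<k. (t ^ m) ^ i :: int)"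
proof (cases "t = 1")
  case False
  have "(t - 1) * (\<Sum>j<m * k. t ^ j) = (t ^ m) ^ k - 1"
    by (simp add: sum_powers_eq power_mult)
  also have "\<dots> = (t ^ m - 1) * (\<Sum>i<k. (t ^ m) ^ i)" by (simp add: sum_powers_eq)
  also have "\<dots> = (t - 1) * ((\<Sum>j<m. t ^ j) * (\<Sum>i<k. (t ^ m) ^ i))"
    by (simp add: sum_powers_eq[of t m, symmetric] mult.assoc)
  finally show ?thesis using False by simp
qed simp

text \<open>With \<open>u = 1 + p c\<close>, modulo the square of \<open>p\<close> the sum is
  \<open>p\<close> plus \<open>p c\<close> times the sum of the \<open>i < p\<close>. The latter is
  a multiple of \<open>p\<close> for odd \<open>p\<close>, so only the term \<open>p\<close>
  survives.\<close>

lemma sum_powers_prime: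
  fixes u :: int
  assumes p: "prime p" "odd p" and u: "[u = 1] (mod int p)"
  shows "\<exists>w. (\<Sum>i<p. u ^ i) = int p * w \<and> \<not> int p dvd w"
proof -
  obtain c where c: "u = 1 + int p * c"
    using u by (metis cong_iff_lin cong_sym)
  have pw: "[u ^ i = 1 + int i * (int p * c)] (mod int p ^ 2)" for i
  proof (induction i)
    case (Suc i)
    have "[u * u ^ i = (1 + int p * c) * (1 + int i * (int p * c))] (mod int p ^ 2)"
      using Suc c by (intro cong_mult) auto
    also have "(1 + int p * c) * (1 + int i * (int p * c)) = 1 + int (Suc i) * (int p * c) + int p ^ 2 * (int i * c ^ 2)"
      by (simp add: algebra_simps power2_eq_square)
    also have "[\<dots> = 1 + int (Suc i) * (int p * c)] (mod int p ^ 2)"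
      by (simp add: cong_def)
    finally show ?case by simp
  qed simp
  obtain h where h: "p = Suc (2 * h)" using p(2) by (metis oddE Suc_eq_plus1)
  have gauss: "(\<Sum>i<p. int i) = int p * int h"
  proof -
    have "2 * (\<Sum>i<m. int i) = int m * (int m - 1)" for m
      by (induction m) (auto simp: algebra_simps)
    from this[of p] show ?thesis using h by (simp add: algebra_simps)
  qed
  have "[(\<Sum>i<p. u ^ i) = (\<Sum>i<p. 1 + int i * (int p * c))] (mod int p ^ 2)"
    by (intro cong_sum pw)
  also have "(\<Sum>i<p. 1 + int i * (int p * c)) = int p + int p * int h * (int p * c)"
    by (simp add: sum.distrib sum_distrib_right[symmetric] gauss)
  finally obtain d where "(\<Sum>i<p. u ^ i) = int p + int p * int h * (int p * c) + int p ^ 2 * d"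
    by (metis cong_iff_lin cong_sym)
  then have "(\<Sum>i<p. u ^ i) = int p * (1 + int p * (int h * c + d))"
    by (simp add: algebra_simps power2_eq_square)
  moreover have "\<not> int p dvd 1 + int p * (int h * c + d)"
    using p(1) by (metis dvd_add_left_iff dvd_triv_left int_dvd_int_iff not_prime_unit of_nat_1)
  ultimately show ?thesis by blast
qed

text \<open>A case of the lifting-the-exponent lemma.\<close>

lemma prime_power_dvd_sum_powers:
  fixes t :: int
  assumes p: "prime p" "odd p" and t: "[t = 1] (mod int p)"
  shows "int p ^ v dvd (\<Sum>j<m. t ^ j) \<longleftrightarrow> p ^ v dvd m"
proof (induction m arbitrary: v rule: less_induct)
  case (less m)
  show ?case
  proof (cases "v = 0 \<or> m = 0")
    case False
    then obtain v' where v: "v = Suc v'" by (cases v) auto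
    show ?thesis
    proof (cases "p dvd m")
      case True
      \<comment> \<open>By \<open>sum_powers_mult\<close> the last factor \<open>p\<close> of
        \<open>m\<close> contributes a sum of exact valuation 1, so the valuation goes up by one on
        both sides.\<close>
      then obtain m' where m: "m = m' * p" by (metis dvd_def mult.commute)
      have m': "m' < m" using False m p(1) prime_gt_1_nat by simp
      have "[t ^ m' = 1] (mod int p)" using cong_pow[OF t, of m'] by simp
      then obtain w where w: "(\<Sum>i<p. (t ^ m') ^ i) = int p * w" "\<not> int p dvd w"
        using sum_powers_prime[OF p] by blast
      have cop: "coprime (int p ^ v') w"
        using w(2) p(1) by (simp add: prime_imp_coprime)
      have "int p ^ v dvd (\<Sum>j<m. t ^ j) \<longleftrightarrow> int p * int p ^ v' dvd int p * ((\<Sum>j<m'. t ^ j) * w)"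
        unfolding m sum_powers_mult w(1) v by (simp add: mult_ac)
      also have "\<dots> \<longleftrightarrow> int p ^ v' dvd (\<Sum>j<m'. t ^ j) * w"
        using p(1) by (simp add: prime_gt_0_nat)
      also have "\<dots> \<longleftrightarrow> int p ^ v' dvd (\<Sum>j<m'. t ^ j)"
        using cop by (simp add: coprime_dvd_mult_left_iff)
      also have "\<dots> \<longleftrightarrow> p ^ v' dvd m'" by (rule less.IH[OF m'])
      also have "\<dots> \<longleftrightarrow> p ^ v dvd m"
        using p(1) by (simp add: m v mult.commute[of m'] prime_gt_0_nat)
      finally show ?thesis .
    next
      case nd: False
      have "\<not> int p dvd (\<Sum>j<m. t ^ j)"
        using cong_dvd_iff[OF sum_powers_cong_one[OF t, of m]] nd by simp
      then show ?thesis using nd v by (metis dvd_mult_left power_Suc)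
    qed
  qed auto
qed

text \<open>The multiplicative order divides both exponents. As \<open>ord\<close> lives on
  naturals, \<open>t\<close> is replaced by its residue \<open>u\<close>.\<close>

lemma cong_one_of_coprime_powers:
  fixes t :: int
  assumes "coprime a b" "[t ^ a = 1] (mod int m)" "[t ^ b = 1] (mod int m)" "m > 0"
  shows "[t = 1] (mod int m)"
proof -
  define u where "u = nat (t mod int m)"
  have u: "[int u = t] (mod int m)" using assms(4) by (simp add: u_def cong_def)
  have "[u ^ a = 1] (mod m)" "[u ^ b = 1] (mod m)"
    using cong_trans[OF cong_pow[OF u] assms(2)] cong_trans[OF cong_pow[OF u] assms(3)]
    by (metis cong_int_iff of_nat_1 of_nat_power)+
  then have "ord m u dvd gcd a b" by (simp add: ord_divides')
  then have "[u ^ 1 = 1] (mod m)" using assms(1) by (simp only: ord_divides coprime_iff_gcd_eq_1)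
  then have "[int u = 1] (mod int m)" by (metis cong_int_iff of_nat_1 power_one_right)
  then show ?thesis by (rule cong_trans[OF cong_sym[OF u]])
qed

lemma fermat_int:
  fixes t :: int
  assumes "prime p" "\<not> int p dvd t"
  shows "[t ^ (p - 1) = 1] (mod int p)"
proof -
  define u where "u = nat (t mod int p)"
  have p0: "p > 0" using assms(1) by (simp add: prime_gt_0_nat)
  have u: "[int u = t] (mod int p)" using p0 by (simp add: u_def cong_def)
  have "\<not> p dvd u" using cong_dvd_iff[OF u] assms(2) by simp
  then have "[u ^ (p - 1) = 1] (mod p)" by (rule fermat_theorem[OF assms(1)])
  then have "[int u ^ (p - 1) = 1] (mod int p)" by (metis cong_int_iff of_nat_1 of_nat_power)
  then show ?thesis by (rule cong_trans[OF cong_sym[OF cong_pow[OF u]]])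
qed

lemma cong_mod_self: "[x mod m = x] (mod (m :: int))"
  by (simp add: cong_def)

lemma (in group) nat_pow_mod:
  assumes "x \<in> carrier G" "x [^] (m :: nat) = \<one>"
  shows "x [^] (a mod m) = x [^] a"
proof -
  have "x [^] a = x [^] (m * (a div m)) \<otimes> x [^] (a mod m)"
    using assms(1) by (simp add: nat_pow_mult)
  then show ?thesis using assms by (simp add: nat_pow_pow[symmetric])
qed

lemma (in group) nat_pow_cong:
  assumes "x \<in> carrier G" "x [^] (m :: nat) = \<one>" "[a = a'] (mod m)"
  shows "x [^] a = x [^] a'"
  using nat_pow_mod[OF assms(1,2), of a] nat_pow_mod[OF assms(1,2), of a'] assms(3) by (simp add: cong_def)

section \<open>Metacyclic groups and their holomorphs\<close>

text \<open>
  The integer \<open>K i\<close>, only relevant modulo \<open>q\<close>, is the scalar by which \<open>i\<close> acts on the factor of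
  order \<open>q\<close>. For \<open>b = 0\<close> the group is the direct product, so the cyclic group is covered as well.
\<close>

locale metacyclic =
  fixes p n q b :: nat and K :: "int \<Rightarrow> int" and N :: "(int \<times> int) monoid"
  assumes p: "prime p" "odd p" and q: "prime q" and pq: "p < q" and n: "n \<ge> 1" and b: "b \<le> n"
    and K_eq: "[K i = K j] (mod int q) \<longleftrightarrow> [i = j] (mod int (p ^ b))"
    and K_add: "[K (i + j) = K i * K j] (mod int q)" and K_zero: "[K 0 = 1] (mod int q)"
    and grp: "group N" and car: "carrier N = {0..<int q} \<times> {0..<int (p ^ n)}"
    and mul: "\<lbrakk>x \<in> {0..<int q}; i \<in> {0..<int (p ^ n)}; y \<in> {0..<int q}; j \<in> {0..<int (p ^ n)}\<rbrakk> \<Longrightarrow>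
      (x, i) \<otimes>\<^bsub>N\<^esub> (y, j) = ((x + K i * y) mod int q, (i + j) mod int (p ^ n))"
begin

sublocale group N by (rule grp)

abbreviation M :: int where "M \<equiv> int (p ^ n)"

text \<open>Arbitrary integers serve as coordinates, so that equations in the group become pairs of
  congruences without range conditions.\<close>

definition el :: "int \<Rightarrow> int \<Rightarrow> int \<times> int" where
  "el x i = (x mod int q, i mod M)"

lemma q_pos: "int q > 0" using q by (simp add: prime_gt_0_nat)

lemma M_pos: "M > 0" using p by (simp add: prime_gt_0_nat)

lemma prime_q: "prime (int q)" using q by simp

lemma finite_carrier: "finite (carrier N)" by (simp add: car)

lemma el_in: "el x i \<in> carrier N"
  using q_pos M_pos by (simp add: el_def car)

lemma el_id: "z \<in> carrier N \<Longrightarrow> el (fst z) (snd z) = z"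
  by (auto simp: car el_def)

lemma el_eq: "el x i = el y j \<longleftrightarrow> [x = y] (mod int q) \<and> [i = j] (mod M)"
  by (simp add: el_def cong_def)

lemma el_cases:
  assumes "z \<in> carrier N"
  obtains x i :: nat where "z = el (int x) (int i)"
proof -
  have "z = el (int (nat (fst z))) (int (nat (snd z)))"
    using assms el_id[OF assms] by (auto simp: car)
  then show thesis by (rule that)
qed

lemma K_cong: "[i = j] (mod M) \<Longrightarrow> [K i = K j] (mod int q)"
proof -
  have "int (p ^ b) dvd M" using le_imp_power_dvd[OF b, of p] by (simp only: int_dvd_int_iff)
  then show "[i = j] (mod M) \<Longrightarrow> [K i = K j] (mod int q)" unfolding K_eq by (rule cong_dvd_modulus[rotated])
qed

lemma el_mult: "el x i \<otimes>\<^bsub>N\<^esub> el y j = el (x + K i * y) (i + j)"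
proof -
  have "el x i \<otimes>\<^bsub>N\<^esub> el y j = el (x mod int q + K (i mod M) * (y mod int q)) (i mod M + j mod M)"
    using q_pos M_pos by (simp add: el_def mul)
  also have "\<dots> = el (x + K i * y) (i + j)"
    unfolding el_eq
    by (intro conjI cong_add[OF cong_mod_self cong_mult[OF K_cong[OF cong_mod_self] cong_mod_self]]
        cong_add[OF cong_mod_self cong_mod_self])
  finally show ?thesis .
qed

lemma K_unit: "[K i * K (- i) = 1] (mod int q)"
  using cong_trans[OF cong_sym[OF K_add[of i "- i"]]] K_zero by simp

lemma K_not_dvd: "\<not> int q dvd K i"
proof
  assume "int q dvd K i"
  then have "int q dvd 1" using cong_dvd_iff[OF K_unit[of i]] by simp
  then show False using prime_q by (simp add: prime_int_iff)
qed

lemma K_times: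
  assumes "[t = 1] (mod int (p ^ b))"
  shows "[K (t * i) = K i] (mod int q)"
  using cong_mult[OF assms cong_refl, of i] by (simp add: K_eq)

lemma K_pow: "[K (int m * i) = K i ^ m] (mod int q)"
proof (induction m)
  case (Suc m)
  have "[K (i + int m * i) = K i * K i ^ m] (mod int q)"
    by (rule cong_trans[OF K_add cong_mult[OF cong_refl Suc]])
  then show ?case by (simp add: algebra_simps)
qed (use K_zero in simp)

lemma one_el: "\<one>\<^bsub>N\<^esub> = el 0 0"
proof -
  show ?thesis using l_cancel_one[OF el_in el_in, of 0 0 0 0] by (simp add: el_mult)
qed

lemma el_pow0: "el x 0 [^]\<^bsub>N\<^esub> (m :: nat) = el (int m * x) 0"
proof (induction m)
  case (Suc m)
  have "[int m * x + K 0 * x = int m * x + 1 * x] (mod int q)"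
    by (rule cong_add[OF cong_refl cong_mult[OF K_zero cong_refl]])
  then show ?case using Suc by (simp add: el_mult el_eq algebra_simps)
qed (simp add: one_el)

lemma el_pow1: "el 0 i [^]\<^bsub>N\<^esub> (m :: nat) = el 0 (int m * i)"
  by (induction m) (auto simp: one_el el_mult algebra_simps)

lemma el_pow_snd: "\<exists>y. el x i [^]\<^bsub>N\<^esub> (m :: nat) = el y (int m * i)"
proof (induction m)
  case (Suc m)
  then obtain y where "el x i [^]\<^bsub>N\<^esub> m = el y (int m * i)" by blast
  then have "el x i [^]\<^bsub>N\<^esub> Suc m = el y (int m * i) \<otimes>\<^bsub>N\<^esub> el x i" by simp
  also have "\<dots> = el (y + K (int m * i) * x) (int m * i + i)" by (rule el_mult)
  finally have "el x i [^]\<^bsub>N\<^esub> Suc m = el (y + K (int m * i) * x) (int (Suc m) * i)"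
    by (simp add: distrib_right add.commute)
  then show ?case by blast
qed (auto simp: one_el)

section \<open>Homomorphisms from the presentation\<close>

lemma el_split: "el (int x) (int i) = el 1 0 [^]\<^bsub>N\<^esub> x \<otimes>\<^bsub>N\<^esub> el 0 1 [^]\<^bsub>N\<^esub> i"
  by (simp add: el_pow0 el_pow1 el_mult)

text \<open>The constant $k$ of the presentation, as a natural number because it occurs as an
  exponent.\<close>

definition \<kappa> :: nat where "\<kappa> = nat (K 1 mod int q)"

lemma \<kappa>: "[int \<kappa> = K 1] (mod int q)"
  using q_pos by (simp add: \<kappa>_def cong_def)

lemma \<kappa>_pow: "[int (\<kappa> ^ i) = K (int i)] (mod int q)"
proof -
  have "[int \<kappa> ^ i = K 1 ^ i] (mod int q)" by (rule cong_pow[OF \<kappa>])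
  then show ?thesis using cong_trans[OF _ cong_sym[OF K_pow[of i 1]]] by simp
qed

text \<open>\<open>S\<close> stands for $x$ and \<open>T\<close> for $y$ in the presentation, with
  the conjugation relation freed of inverses.\<close>

definition relators :: "('x, 'y) monoid_scheme \<Rightarrow> 'x \<Rightarrow> 'x \<Rightarrow> bool" where
  "relators H S T \<longleftrightarrow> S \<in> carrier H \<and> T \<in> carrier H \<and> T [^]\<^bsub>H\<^esub> q = \<one>\<^bsub>H\<^esub> \<and> S [^]\<^bsub>H\<^esub> (p ^ n) = \<one>\<^bsub>H\<^esub> \<and>
     S \<otimes>\<^bsub>H\<^esub> T = T [^]\<^bsub>H\<^esub> \<kappa> \<otimes>\<^bsub>H\<^esub> S"

definition hom_of :: "('x, 'y) monoid_scheme \<Rightarrow> 'x \<Rightarrow> 'x \<Rightarrow> int \<times> int \<Rightarrow> 'x" where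
  "hom_of H S T = (\<lambda>z\<in>carrier N. T [^]\<^bsub>H\<^esub> nat (fst z) \<otimes>\<^bsub>H\<^esub> S [^]\<^bsub>H\<^esub> nat (snd z))"

lemma hom_relators:
  assumes H: "group H" and h: "\<beta> \<in> hom N H"
  shows "relators H (\<beta> (el 0 1)) (\<beta> (el 1 0))"
    and "\<beta> (el (int x) (int i)) = \<beta> (el 1 0) [^]\<^bsub>H\<^esub> x \<otimes>\<^bsub>H\<^esub> \<beta> (el 0 1) [^]\<^bsub>H\<^esub> i"
proof -
  interpret group_hom N H \<beta> using H h by (simp add: group_hom_def group_hom_axioms_def grp)
  show "\<beta> (el (int x) (int i)) = \<beta> (el 1 0) [^]\<^bsub>H\<^esub> x \<otimes>\<^bsub>H\<^esub> \<beta> (el 0 1) [^]\<^bsub>H\<^esub> i"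
    by (simp add: el_split el_in hom_nat_pow hom_mult)
  have T: "\<beta> (el 1 0) [^]\<^bsub>H\<^esub> m = \<beta> (el (int m) 0)" and S: "\<beta> (el 0 1) [^]\<^bsub>H\<^esub> m = \<beta> (el 0 (int m))" for m :: nat
    by (simp_all add: hom_nat_pow[symmetric] el_in el_pow0 el_pow1)
  have "el (int q) 0 = \<one>\<^bsub>N\<^esub>" "el 0 M = \<one>\<^bsub>N\<^esub>" by (simp_all add: one_el el_eq cong_def)
  moreover have "el 0 1 \<otimes>\<^bsub>N\<^esub> el 1 0 = el (int \<kappa>) 0 \<otimes>\<^bsub>N\<^esub> el 0 1"
    using cong_sym[OF \<kappa>] by (simp add: el_mult el_eq)
  then have "\<beta> (el 0 1 \<otimes>\<^bsub>N\<^esub> el 1 0) = \<beta> (el (int \<kappa>) 0 \<otimes>\<^bsub>N\<^esub> el 0 1)" by (rule arg_cong)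
  then have "\<beta> (el 0 1) \<otimes>\<^bsub>H\<^esub> \<beta> (el 1 0) = \<beta> (el (int \<kappa>) 0) \<otimes>\<^bsub>H\<^esub> \<beta> (el 0 1)"
    by (simp only: hom_mult el_in)
  ultimately show "relators H (\<beta> (el 0 1)) (\<beta> (el 1 0))"
    unfolding relators_def T S by (intro conjI hom_closed el_in) (simp_all only: hom_one)
qed

text \<open>Words are brought into the form power of \<open>T\<close> times power of
  \<open>S\<close>. By \<open>c2\<close>, moving the \<open>c\<close>-th power of \<open>S\<close>
  past a power of \<open>T\<close> multiplies its exponent by \<open>\<kappa> ^ c\<close>, as in
  \<open>N\<close>; the order relations allow exponents to be reduced.\<close>

lemma hom_of_hom:
  assumes H: "group H" and r: "relators H S T"
  shows "hom_of H S T \<in> hom N H"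
proof -
  interpret H: group H by fact
  have S: "S \<in> carrier H" "S [^]\<^bsub>H\<^esub> (p ^ n) = \<one>\<^bsub>H\<^esub>" and T: "T \<in> carrier H" "T [^]\<^bsub>H\<^esub> q = \<one>\<^bsub>H\<^esub>"
    and ST: "S \<otimes>\<^bsub>H\<^esub> T = T [^]\<^bsub>H\<^esub> \<kappa> \<otimes>\<^bsub>H\<^esub> S" using r by (auto simp: relators_def)
  have c1: "S \<otimes>\<^bsub>H\<^esub> T [^]\<^bsub>H\<^esub> a = T [^]\<^bsub>H\<^esub> (\<kappa> * a) \<otimes>\<^bsub>H\<^esub> S" for a
  proof (induction a)
    case (Suc a)
    have "S \<otimes>\<^bsub>H\<^esub> T [^]\<^bsub>H\<^esub> Suc a = T [^]\<^bsub>H\<^esub> (\<kappa> * a) \<otimes>\<^bsub>H\<^esub> (S \<otimes>\<^bsub>H\<^esub> T)"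
      using S T by (simp add: H.m_assoc[symmetric] Suc[symmetric])
    also have "\<dots> = T [^]\<^bsub>H\<^esub> (\<kappa> * a) \<otimes>\<^bsub>H\<^esub> T [^]\<^bsub>H\<^esub> \<kappa> \<otimes>\<^bsub>H\<^esub> S"
      using S T by (simp add: ST H.m_assoc)
    finally show ?case using T by (simp add: H.nat_pow_mult add.commute)
  qed (use S in simp)
  have c2: "S [^]\<^bsub>H\<^esub> c \<otimes>\<^bsub>H\<^esub> T [^]\<^bsub>H\<^esub> a = T [^]\<^bsub>H\<^esub> (\<kappa> ^ c * a) \<otimes>\<^bsub>H\<^esub> S [^]\<^bsub>H\<^esub> c" for c a :: nat
  proof (induction c arbitrary: a)
    case (Suc c)
    have "S [^]\<^bsub>H\<^esub> Suc c \<otimes>\<^bsub>H\<^esub> T [^]\<^bsub>H\<^esub> a = S [^]\<^bsub>H\<^esub> c \<otimes>\<^bsub>H\<^esub> T [^]\<^bsub>H\<^esub> (\<kappa> * a) \<otimes>\<^bsub>H\<^esub> S"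
      using S T by (simp add: H.m_assoc c1)
    also have "\<dots> = T [^]\<^bsub>H\<^esub> (\<kappa> ^ c * (\<kappa> * a)) \<otimes>\<^bsub>H\<^esub> (S [^]\<^bsub>H\<^esub> c \<otimes>\<^bsub>H\<^esub> S)"
      using S T by (simp add: Suc H.m_assoc)
    finally show ?case by (simp add: mult_ac)
  qed (use T in simp)
  show ?thesis
  proof (rule homI)
    fix z assume "z \<in> carrier N"
    then show "hom_of H S T z \<in> carrier H" using S T by (simp add: hom_of_def)
  next
    fix z w assume z: "z \<in> carrier N" and w: "w \<in> carrier N"
    obtain x i y j where e: "z = (x, i)" "w = (y, j)" by (metis prod.exhaust)
    have r: "x \<in> {0..<int q}" "i \<in> {0..<M}" "y \<in> {0..<int q}" "j \<in> {0..<M}" using z w by (auto simp: e car)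
    have "hom_of H S T z \<otimes>\<^bsub>H\<^esub> hom_of H S T w =
       T [^]\<^bsub>H\<^esub> nat x \<otimes>\<^bsub>H\<^esub> (S [^]\<^bsub>H\<^esub> nat i \<otimes>\<^bsub>H\<^esub> T [^]\<^bsub>H\<^esub> nat y) \<otimes>\<^bsub>H\<^esub> S [^]\<^bsub>H\<^esub> nat j"
      using z w S T by (simp add: hom_of_def e H.m_assoc)
    also have "\<dots> = (T [^]\<^bsub>H\<^esub> nat x \<otimes>\<^bsub>H\<^esub> T [^]\<^bsub>H\<^esub> (\<kappa> ^ nat i * nat y)) \<otimes>\<^bsub>H\<^esub> (S [^]\<^bsub>H\<^esub> nat i \<otimes>\<^bsub>H\<^esub> S [^]\<^bsub>H\<^esub> nat j)"
      using S T by (simp add: c2 H.m_assoc)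
    also have "\<dots> = T [^]\<^bsub>H\<^esub> (nat x + \<kappa> ^ nat i * nat y) \<otimes>\<^bsub>H\<^esub> S [^]\<^bsub>H\<^esub> (nat i + nat j)"
      using S T by (simp add: H.nat_pow_mult)
    also have "T [^]\<^bsub>H\<^esub> (nat x + \<kappa> ^ nat i * nat y) = T [^]\<^bsub>H\<^esub> nat ((x + K i * y) mod int q)"
    proof (rule H.nat_pow_cong[OF T])
      have "[int (nat x + \<kappa> ^ nat i * nat y) = x + K i * y] (mod int q)"
        using r cong_add[OF cong_refl cong_mult[OF \<kappa>_pow[of "nat i"] cong_refl], of x y] by simp
      then have "[int (nat x + \<kappa> ^ nat i * nat y) = int (nat ((x + K i * y) mod int q))] (mod int q)"
        using q_pos by (simp add: cong_def)
      then show "[nat x + \<kappa> ^ nat i * nat y = nat ((x + K i * y) mod int q)] (mod q)"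
        by (simp only: cong_int_iff)
    qed
    also have "S [^]\<^bsub>H\<^esub> (nat i + nat j) = S [^]\<^bsub>H\<^esub> nat ((i + j) mod M)"
    proof (rule H.nat_pow_cong[OF S])
      have "[int (nat i + nat j) = int (nat ((i + j) mod M))] (mod M)"
        using r M_pos by (simp add: cong_def)
      then show "[nat i + nat j = nat ((i + j) mod M)] (mod p ^ n)"
        by (simp only: cong_int_iff)
    qed
    finally show "hom_of H S T (z \<otimes>\<^bsub>N\<^esub> w) = hom_of H S T z \<otimes>\<^bsub>H\<^esub> hom_of H S T w"
      using r q_pos M_pos by (simp add: hom_of_def e mul car)
  qed
qed

lemma q_gt_1: "int q > 1" using q prime_gt_1_nat by simp

lemma M_gt_1: "M > 1"
proof -
  have "1 < p ^ n" by (rule one_less_power[OF prime_gt_1_nat[OF p(1)]]) (use n in simp)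
  then show ?thesis by (simp del: of_nat_power)
qed

lemma el_gens: "el 1 0 = (1, 0)" "el 0 1 = (0, 1)"
  using q_gt_1 M_gt_1 by (simp_all add: el_def del: of_nat_power)

lemma hom_of_gens:
  assumes H: "group H" and r: "relators H S T"
  shows "hom_of H S T (el 1 0) = T" "hom_of H S T (el 0 1) = S"
proof -
  interpret H: group H by fact
  show "hom_of H S T (el 1 0) = T" "hom_of H S T (el 0 1) = S"
    using r el_in[of 1 0] el_in[of 0 1] by (simp_all add: hom_of_def relators_def el_gens)
qed

lemma hom_of_unique:
  assumes H: "group H" and h: "\<beta> \<in> hom N H" "\<beta> \<in> extensional (carrier N)"
  shows "hom_of H (\<beta> (el 0 1)) (\<beta> (el 1 0)) = \<beta>"
proof (rule extensionalityI[of _ "carrier N"])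
  fix z assume z: "z \<in> carrier N"
  then have e: "z = el (int (nat (fst z))) (int (nat (snd z)))" using el_id[OF z] by (auto simp: car)
  have "\<beta> z = \<beta> (el 1 0) [^]\<^bsub>H\<^esub> nat (fst z) \<otimes>\<^bsub>H\<^esub> \<beta> (el 0 1) [^]\<^bsub>H\<^esub> nat (snd z)"
    by (subst e) (rule hom_relators(2)[OF H h(1)])
  then show "hom_of H (\<beta> (el 0 1)) (\<beta> (el 1 0)) z = \<beta> z" using z by (simp add: hom_of_def)
qed (use h in \<open>simp_all add: hom_of_def\<close>)

section \<open>Automorphisms of a metacyclic group\<close>

lemma coprime_q_M: "coprime (int q) M"
  using p q pq by (simp add: primes_coprime)

lemma q_not_dvd_M: "\<not> int q dvd M"
proof
  assume "int q dvd M"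
  then have "is_unit (int q)" using coprime_q_M by (simp only: coprime_absorb_left)
  then show False using q_gt_1 by simp
qed

text \<open>
  The summand with \<open>F\<close> is a coboundary. It vanishes for \<open>b = 0\<close>, so \<open>F\<close> is only determined if \<open>b \<noteq> 0\<close>;
  in the other case it is normalised to \<open>0\<close>.
\<close>

definition aut :: "int \<Rightarrow> int \<Rightarrow> int \<Rightarrow> int \<times> int \<Rightarrow> int \<times> int" where
  "aut D F t = (\<lambda>z\<in>carrier N. el (D * fst z + F * (K (snd z) - 1)) (t * snd z))"

text \<open>The congruence says that \<open>i\<close> and \<open>t * i\<close> act by the same
  scalar. For \<open>b = 0\<close> it is empty, and coprimality to \<open>p\<close> alone governs
  invertibility of \<open>t\<close>.\<close>

definition valid :: "int \<Rightarrow> int \<Rightarrow> bool" where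
  "valid D t \<longleftrightarrow> \<not> int q dvd D \<and> coprime t (int p) \<and> [t = 1] (mod int (p ^ b))"

lemma aut_el: "aut D F t (el x i) = el (D * x + F * (K i - 1)) (t * i)"
proof -
  have "[D * (x mod int q) + F * (K (i mod M) - 1) = D * x + F * (K i - 1)] (mod int q)"
    by (rule cong_add[OF cong_mult[OF cong_refl cong_mod_self]
          cong_mult[OF cong_refl cong_diff[OF K_cong[OF cong_mod_self] cong_refl]]])
  moreover have "[t * (i mod M) = t * i] (mod M)" by (simp add: cong_def mod_mult_right_eq)
  ultimately show ?thesis using el_in[of x i] by (simp add: aut_def el_def[of x i] el_eq)
qed

lemma coprime_M: "coprime t (int p) \<Longrightarrow> coprime t M"
  by simp

lemma cong_cancel_q: "\<not> int q dvd c \<Longrightarrow> [c * x = c * y] (mod int q) \<longleftrightarrow> [x = y] (mod int q)"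
  using prime_imp_coprime[OF prime_q, of c] by (intro cong_mult_lcancel) (simp add: coprime_commute)

text \<open>Additivity rests on the cocycle identity
  \<open>K (i + j) - 1 = (K i - 1) + K i * (K j - 1)\<close> modulo \<open>q\<close>, and on
  \<open>K (t * i)\<close> and \<open>K i\<close> being congruent.\<close>

lemma aut_auto:
  assumes v: "valid D t"
  shows "aut D F t \<in> auto N"
proof (rule autoI)
  have "inj_on (aut D F t) (carrier N)"
  proof (rule inj_onI)
    fix z w assume zw: "z \<in> carrier N" "w \<in> carrier N" "aut D F t z = aut D F t w"
    obtain x i :: nat where e1: "z = el (int x) (int i)" by (rule el_cases[OF zw(1)])
    obtain y j :: nat where e2: "w = el (int y) (int j)" by (rule el_cases[OF zw(2)])
    note e = e1 e2
    have 1: "[t * int i = t * int j] (mod M)"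
      and 2: "[D * int x + F * (K (int i) - 1) = D * int y + F * (K (int j) - 1)] (mod int q)"
      using zw(3) by (simp_all add: e aut_el el_eq)
    have ij: "[int i = int j] (mod M)" using 1 v coprime_M by (simp add: valid_def cong_mult_lcancel)
    have "[F * (K (int i) - 1) = F * (K (int j) - 1)] (mod int q)"
      by (rule cong_mult[OF cong_refl cong_diff[OF K_cong[OF ij] cong_refl]])
    from cong_diff[OF 2 this] have "[D * int x = D * int y] (mod int q)" by simp
    then show "z = w" using v ij by (simp add: e el_eq valid_def cong_cancel_q)
  qed
  moreover have "aut D F t ` carrier N \<subseteq> carrier N" using el_in by (auto simp: aut_def)
  ultimately have bij: "bij_betw (aut D F t) (carrier N) (carrier N)"
    by (simp add: bij_betw_def endo_inj_surj[OF finite_carrier])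
  have "aut D F t \<in> hom N N"
  proof (rule homI)
    fix z assume "z \<in> carrier N" then show "aut D F t z \<in> carrier N" using el_in by (simp add: aut_def)
  next
    fix z w assume zw: "z \<in> carrier N" "w \<in> carrier N"
    obtain x i :: nat where e1: "z = el (int x) (int i)" by (rule el_cases[OF zw(1)])
    obtain y j :: nat where e2: "w = el (int y) (int j)" by (rule el_cases[OF zw(2)])
    note e = e1 e2
    let ?i = "int i" and ?j = "int j" and ?x = "int x" and ?y = "int y"
    have "[D * (?x + K ?i * ?y) + F * (K (?i + ?j) - 1) = D * (?x + K ?i * ?y) + F * (K ?i * K ?j - 1)] (mod int q)"
      by (rule cong_add[OF cong_refl cong_mult[OF cong_refl cong_diff[OF K_add cong_refl]]])
    also have "D * (?x + K ?i * ?y) + F * (K ?i * K ?j - 1) = D * ?x + F * (K ?i - 1) + K ?i * (D * ?y + F * (K ?j - 1))"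
      by (simp add: algebra_simps)
    also have "[\<dots> = D * ?x + F * (K ?i - 1) + K (t * ?i) * (D * ?y + F * (K ?j - 1))] (mod int q)"
      by (rule cong_add[OF cong_refl cong_mult[OF cong_sym[OF K_times] cong_refl]]) (use v in \<open>simp add: valid_def\<close>)
    finally show "aut D F t (z \<otimes>\<^bsub>N\<^esub> w) = aut D F t z \<otimes>\<^bsub>N\<^esub> aut D F t w"
      by (simp add: e el_mult aut_el el_eq algebra_simps)
  qed
  then show "aut D F t \<in> iso N N" using bij by (simp add: iso_def)
qed (simp add: aut_def)

lemma aut_compose:
  assumes "valid D t" "valid D' t'"
  shows "compose (carrier N) (aut D F t) (aut D' F' t') = aut (D * D') (D * F' + F) (t * t')"
proof (rule extensionalityI[of _ "carrier N"])
  fix z assume z: "z \<in> carrier N"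
  obtain x i :: nat where e: "z = el (int x) (int i)" by (rule el_cases[OF z])
  have "[D * (D' * int x + F' * (K (int i) - 1)) + F * (K (t' * int i) - 1)
      = D * (D' * int x + F' * (K (int i) - 1)) + F * (K (int i) - 1)] (mod int q)"
    by (rule cong_add[OF cong_refl cong_mult[OF cong_refl cong_diff[OF K_times cong_refl]]])
      (use assms in \<open>simp add: valid_def\<close>)
  then show "compose (carrier N) (aut D F t) (aut D' F' t') z = aut (D * D') (D * F' + F) (t * t') z"
    by (simp add: compose_eq z) (simp add: e aut_el el_eq algebra_simps)
qed (simp_all add: aut_def)

lemma K_1_cong_1_iff: "[K 1 = 1] (mod int q) \<longleftrightarrow> b = 0"
proof -
  have "[K 1 = 1] (mod int q) \<longleftrightarrow> [K 1 = K 0] (mod int q)"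
    using K_zero by (metis cong_sym cong_trans)
  also have "\<dots> \<longleftrightarrow> p ^ b = 1" unfolding K_eq by (simp add: cong_0_iff del: of_nat_power)
  also have "\<dots> \<longleftrightarrow> b = 0"
    using one_less_power[OF prime_gt_1_nat[OF p(1)], of b] by (cases "b = 0") auto
  finally show ?thesis .
qed

lemma K1_diff: "b \<noteq> 0 \<Longrightarrow> \<not> int q dvd K 1 - 1"
  using K_1_cong_1_iff by (simp add: cong_iff_dvd_diff[symmetric])

text \<open>The image of \<open>el 1 0\<close> determines \<open>D\<close>, that of
  \<open>el 0 1\<close> determines \<open>t\<close> and \<open>F * (K 1 - 1)\<close>, where the
  second factor is a unit modulo \<open>q\<close> unless \<open>b = 0\<close>.\<close>

lemma aut_eq:
  assumes "b = 0 \<Longrightarrow> F = 0 \<and> F' = 0"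
  shows "aut D F t = aut D' F' t' \<longleftrightarrow> [D = D'] (mod int q) \<and> [F = F'] (mod int q) \<and> [t = t'] (mod M)"
proof
  assume eq: "aut D F t = aut D' F' t'"
  have "[D + F * (K 0 - 1) = D] (mod int q)" for D F
  proof -
    have "[D + F * (K 0 - 1) = D + F * (1 - 1)] (mod int q)"
      by (rule cong_add[OF cong_refl cong_mult[OF cong_refl cong_diff[OF K_zero cong_refl]]])
    then show ?thesis by simp
  qed
  then have D: "[D = D'] (mod int q)"
    using arg_cong[OF eq, of "\<lambda>f. f (el 1 0)"] by (simp add: aut_el el_eq) (metis cong_sym cong_trans)
  have F: "[(K 1 - 1) * F = (K 1 - 1) * F'] (mod int q)" and t: "[t = t'] (mod M)"
    using arg_cong[OF eq, of "\<lambda>f. f (el 0 1)"] by (simp_all add: aut_el el_eq mult.commute)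
  have "[F = F'] (mod int q)"
  proof (cases "b = 0")
    case False
    show ?thesis using F unfolding cong_cancel_q[OF K1_diff[OF False]] .
  qed (use assms in simp)
  then show "[D = D'] (mod int q) \<and> [F = F'] (mod int q) \<and> [t = t'] (mod M)" using D t by blast
next
  assume c: "[D = D'] (mod int q) \<and> [F = F'] (mod int q) \<and> [t = t'] (mod M)"
  show "aut D F t = aut D' F' t'"
    unfolding aut_def by (intro restrict_ext) (use c in \<open>simp add: el_eq cong_add cong_mult\<close>)
qed

text \<open>The generator of order \<open>q\<close> goes to some \<open>el c 0\<close>, as its
  second coordinate is killed by \<open>q\<close>, a unit modulo \<open>M\<close>. The conjugation
  relation then forces \<open>K t\<close> and \<open>K 1\<close> to agree, which is the congruence
  for \<open>t\<close>.\<close>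

lemma auto_is_aut:
  assumes z: "\<zeta> \<in> auto N"
  shows "\<exists>D F t. valid D t \<and> (b = 0 \<longrightarrow> F = 0) \<and> \<zeta> = aut D F t"
proof -
  have h: "\<zeta> \<in> hom N N" using z by (simp add: auto_def)
  note rel = hom_relators[OF grp h]
  have zin: "\<zeta> (el x i) \<in> carrier N" for x i by (rule auto_closed[OF z el_in])
  have zbij: "bij_betw \<zeta> (carrier N) (carrier N)" by (rule auto_bij[OF z])
  obtain c j where T: "\<zeta> (el 1 0) = el c j" using el_id[OF zin[of 1 0]] by metis
  obtain d t where S: "\<zeta> (el 0 1) = el d t" using el_id[OF zin[of 0 1]] by metis
  obtain y where "el c j [^]\<^bsub>N\<^esub> q = el y (int q * j)" using el_pow_snd by blast
  then have "el y (int q * j) = el 0 0" using rel(1) by (simp add: relators_def T one_el)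
  then have "[int q * j = int q * 0] (mod M)" by (simp add: el_eq)
  moreover note coprime_q_M
  ultimately have j: "[j = 0] (mod M)" by (simp add: cong_mult_lcancel del: mult_zero_right)
  then have T0: "\<zeta> (el 1 0) = el c 0" by (simp add: T el_eq)
  have c: "\<not> int q dvd c"
  proof
    assume "int q dvd c"
    then have "\<zeta> (el 1 0) = el 0 0" by (simp add: T0 el_eq cong_0_iff)
    also have "\<dots> = \<zeta> (el 0 0)" using auto_one[OF grp z] by (simp add: one_el)
    finally have "el 1 0 = el 0 0" using zbij el_in by (auto simp: bij_betw_def dest: inj_onD)
    then have "int q dvd 1" by (simp add: el_eq cong_0_iff)
    then show False using q_gt_1 by simp
  qed
  have "el d t \<otimes>\<^bsub>N\<^esub> el c 0 = el (int \<kappa> * c) 0 \<otimes>\<^bsub>N\<^esub> el d t"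
    using rel(1) by (simp add: relators_def T0 S el_pow0)
  then have "[d + K t * c = int \<kappa> * c + K 0 * d] (mod int q)" by (simp add: el_mult el_eq)
  also have "[int \<kappa> * c + K 0 * d = K 1 * c + 1 * d] (mod int q)"
    by (rule cong_add[OF cong_mult[OF \<kappa> cong_refl] cong_mult[OF K_zero cong_refl]])
  finally have "[c * K t = c * K 1] (mod int q)"
    using cong_add_lcancel[of d "c * K t" "c * K 1"] by (simp add: algebra_simps)
  then have t1: "[t = 1] (mod int (p ^ b))" using c K_eq cong_cancel_q by blast
  \<comment> \<open>For \<open>b = 0\<close> the scalars are trivial and the \<open>p ^ n\<close>-th
    power of \<open>el d t\<close> is the identity, so \<open>d\<close> vanishes; otherwise
    \<open>K 1 - 1\<close> can be divided out.\<close>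
  have "\<exists>F. [d = F * (K 1 - 1)] (mod int q) \<and> (b = 0 \<longrightarrow> F = 0)"
  proof (cases "b = 0")
    case True
    have "el d t [^]\<^bsub>N\<^esub> m = el (int m * d) (int m * t)" for m :: nat
    proof (induction m)
      case (Suc m)
      have "[K (int m * t) = 1] (mod int q)"
        using cong_trans[OF _ K_zero] K_eq[of "int m * t" 0] True by simp
      then have "[int m * d + K (int m * t) * d = int m * d + 1 * d] (mod int q)"
        by (rule cong_add[OF cong_refl cong_mult[OF _ cong_refl]])
      then show ?case using Suc by (simp add: el_mult el_eq algebra_simps)
    qed (simp add: one_el)
    then have "[int (p ^ n) * d = 0] (mod int q)"
      using rel(1) by (simp add: relators_def S one_el el_eq)
    then have "int q dvd int p ^ n * d" by (simp add: cong_0_iff)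
    moreover have "\<not> int q dvd int p ^ n" using q_not_dvd_M by simp
    ultimately have "int q dvd d" by (simp only: prime_dvd_mult_iff[OF prime_q] simp_thms)
    then have "[d = 0 * (K 1 - 1)] (mod int q) \<and> (b = 0 \<longrightarrow> 0 = (0 :: int))"
      by (simp only: cong_0_iff mult_zero_left simp_thms)
    then show ?thesis by (rule exI)
  next
    case False
    have "coprime (K 1 - 1) (int q)"
      using prime_imp_coprime[OF prime_q K1_diff[OF False]] by (simp add: coprime_commute)
    then obtain e where "[(K 1 - 1) * e = 1] (mod int q)" using cong_solve_coprime_int by blast
    then have "[(K 1 - 1) * e * d = 1 * d] (mod int q)" by (rule cong_mult[OF _ cong_refl])
    then show ?thesis using False by (intro exI[of _ "e * d"]) (simp add: cong_sym_eq mult_ac)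
  qed
  then obtain F where F: "[d = F * (K 1 - 1)] (mod int q)" "b = 0 \<longrightarrow> F = 0" by blast
  have pow: "el d t [^]\<^bsub>N\<^esub> m = el (F * (K (int m) - 1)) (t * int m)" for m :: nat
  proof (induction m)
    case 0
    have "[F * (1 - 1) = F * (K 0 - 1)] (mod int q)"
      by (rule cong_mult[OF cong_refl cong_diff[OF cong_sym[OF K_zero] cong_refl]])
    then show ?case by (simp add: one_el el_eq)
  next
    case (Suc m)
    have "[F * (K (int m) - 1) + K (t * int m) * d = F * (K (int m) - 1) + K (int m) * (F * (K 1 - 1))] (mod int q)"
      by (rule cong_add[OF cong_refl cong_mult[OF K_times[OF t1] F(1)]])
    also have "F * (K (int m) - 1) + K (int m) * (F * (K 1 - 1)) = F * (K (int m) * K 1 - 1)"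
      by (simp add: algebra_simps)
    also have "[F * (K (int m) * K 1 - 1) = F * (K (int m + 1) - 1)] (mod int q)"
      by (rule cong_mult[OF cong_refl cong_diff[OF cong_sym[OF K_add] cong_refl]])
    finally show ?case using Suc by (simp add: el_mult el_eq algebra_simps)
  qed
  have "\<zeta> = aut c F t"
  proof (rule extensionalityI[of _ "carrier N"])
    show "\<zeta> \<in> extensional (carrier N)" by (rule auto_extensional[OF z])
    show "aut c F t \<in> extensional (carrier N)" by (simp add: aut_def)
    fix w assume w: "w \<in> carrier N"
    obtain x i :: nat where e: "w = el (int x) (int i)" by (rule el_cases[OF w])
    have "[int x * c + K 0 * (F * (K (int i) - 1)) = int x * c + 1 * (F * (K (int i) - 1))] (mod int q)"
      by (rule cong_add[OF cong_refl cong_mult[OF K_zero cong_refl]])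
    then show "\<zeta> w = aut c F t w"
      unfolding e rel(2) by (simp add: T0 S pow el_pow0 el_mult aut_el el_eq algebra_simps)
  qed
  moreover have "coprime t (int p)"
  proof -
    have "el 0 1 \<in> \<zeta> ` carrier N" using zbij el_in by (auto simp: bij_betw_def)
    then obtain w where w: "w \<in> carrier N" "\<zeta> w = el 0 1" by auto
    obtain x i :: nat where e: "w = el (int x) (int i)" by (rule el_cases[OF w(1)])
    have "[t * int i = 1] (mod M)" using w(2) \<open>\<zeta> = aut c F t\<close> by (simp add: e aut_el el_eq)
    then have "coprime t M" by (rule coprime_iff_invertible_int[THEN iffD2, OF exI])
    then show ?thesis using n by simp
  qed
  ultimately show ?thesis using c t1 F(2) by (auto simp: valid_def)
qed


section \<open>The holomorph in coordinates\<close>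

lemma aut_cong:
  "[D = D'] (mod int q) \<Longrightarrow> [F = F'] (mod int q) \<Longrightarrow> [t = t'] (mod M) \<Longrightarrow> aut D F t = aut D' F' t'"
  unfolding aut_def by (intro restrict_ext) (simp add: el_eq cong_add cong_mult)

text \<open>
  The shift of the translation by \<open>K s * F\<close> makes the coordinates \<open>B\<close> and \<open>F\<close> transform independently
  under multiplication: \<open>B\<close> is scaled by \<open>D * K s\<close> and \<open>F\<close> by \<open>D\<close>.
\<close>

definition hol :: "int \<Rightarrow> int \<Rightarrow> int \<Rightarrow> int \<Rightarrow> int \<Rightarrow> (int \<times> int) \<times> (int \<times> int \<Rightarrow> int \<times> int)" where
  "hol B s D F t = (el (B + K s * F) s, aut D F t)"

lemma hol_in: "valid D t \<Longrightarrow> hol B s D F t \<in> carrier (holomorph N)"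
  by (simp add: hol_def el_in aut_auto)

lemma hol_cong:
  assumes "[B = B'] (mod int q)" "[s = s'] (mod M)" "[D = D'] (mod int q)" "[F = F'] (mod int q)" "[t = t'] (mod M)"
  shows "hol B s D F t = hol B' s' D' F' t'"
proof -
  have "[B + K s * F = B' + K s' * F'] (mod int q)"
    by (rule cong_add[OF assms(1) cong_mult[OF K_cong[OF assms(2)] assms(4)]])
  then show ?thesis using assms by (simp add: hol_def el_eq aut_cong)
qed

lemma hol_eq:
  assumes "b = 0 \<Longrightarrow> F = 0 \<and> F' = 0" and eq: "hol B s D F t = hol B' s' D' F' t'"
  shows "[B = B'] (mod int q)" "[s = s'] (mod M)" "[D = D'] (mod int q)" "[F = F'] (mod int q)" "[t = t'] (mod M)"
proof -
  have a: "[B + K s * F = B' + K s' * F'] (mod int q)" "[s = s'] (mod M)" "aut D F t = aut D' F' t'"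
    using eq by (simp_all add: hol_def el_eq)
  show D: "[D = D'] (mod int q)" "[F = F'] (mod int q)" "[t = t'] (mod M)"
    using a(3) aut_eq[OF assms(1)] by simp_all
  show "[s = s'] (mod M)" by (rule a(2))
  show "[B = B'] (mod int q)"
    using cong_diff[OF a(1) cong_mult[OF K_cong[OF a(2)] D(2)]] by simp
qed

lemma hol_cases:
  assumes "g \<in> carrier (holomorph N)"
  shows "\<exists>B s D F t. valid D t \<and> (b = 0 \<longrightarrow> F = 0) \<and> g = hol B s D F t"
proof -
  obtain a \<zeta> where g: "g = (a, \<zeta>)" "a \<in> carrier N" "\<zeta> \<in> auto N" using assms by auto
  obtain D F t where "valid D t" "b = 0 \<longrightarrow> F = 0" "\<zeta> = aut D F t" using auto_is_aut[OF g(3)] by blast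
  moreover have "a = el (fst a - K (snd a) * F + K (snd a) * F) (snd a)" using el_id[OF g(2)] by simp
  ultimately show ?thesis using g(1) unfolding hol_def by blast
qed

lemma valid_one: "valid 1 1"
  using q_gt_1 by (simp add: valid_def)

lemma valid_mult:
  assumes "valid D t" "valid D' t'" shows "valid (D * D') (t * t')"
  using assms cong_mult[of t 1 "int (p ^ b)" t' 1] prime_dvd_mult_iff[OF prime_q]
  by (simp add: valid_def)

lemma valid_pow: "valid D t \<Longrightarrow> valid (D ^ m) (t ^ m)"
  by (induction m) (auto simp: valid_one valid_mult)

lemma hol_mult:
  assumes v: "valid D t" "valid D' t'"
  shows "hol B s D F t \<otimes>\<^bsub>holomorph N\<^esub> hol B' s' D' F' t' =
    hol (B + D * K s * B') (s + t * s') (D * D') (D * F' + F) (t * t')"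
proof -
  let ?X = "D * (B' + K s' * F') + F * (K s' - 1)"
  have "[K (s + t * s') = K s * K s'] (mod int q)"
    using cong_trans[OF K_add cong_mult[OF cong_refl K_times]] v by (simp add: valid_def)
  then have "[B + D * K s * B' + K (s + t * s') * (D * F' + F) = B + D * K s * B' + K s * K s' * (D * F' + F)] (mod int q)"
    by (rule cong_add[OF cong_refl cong_mult[OF _ cong_refl]])
  also have "B + D * K s * B' + K s * K s' * (D * F' + F) = B + K s * F + K s * ?X"
    by (simp add: algebra_simps)
  finally have "el (B + K s * F) s \<otimes>\<^bsub>N\<^esub> el ?X (t * s') = el (B + D * K s * B' + K (s + t * s') * (D * F' + F)) (s + t * s')"
    by (simp only: el_mult el_eq cong_sym_eq cong_refl simp_thms)
  then show ?thesis
    using v by (simp add: hol_def mult_holomorph aut_auto aut_compose aut_el)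
qed

lemma hol_one: "\<one>\<^bsub>holomorph N\<^esub> = hol 0 0 1 0 1"
proof -
  have "aut 1 0 1 = (\<lambda>x\<in>carrier N. x)"
    unfolding aut_def by (intro restrict_ext) (simp add: el_id)
  then show ?thesis by (simp add: hol_def one_el)
qed

text \<open>Repeated multiplication changes \<open>B\<close>, \<open>s\<close> and \<open>F\<close>
  by affine maps with the multipliers \<open>D * K s\<close>, \<open>t\<close> and \<open>D\<close>,
  hence the geometric sums. For \<open>B\<close> this uses that \<open>t\<close> is 1 modulo
  \<open>p ^ b\<close>, which turns \<open>K\<close> of the sum in the second coordinate into
  \<open>K s ^ m\<close>.\<close>

lemma hol_pow:
  assumes v: "valid D t"
  shows "hol B s D F t [^]\<^bsub>holomorph N\<^esub> (m :: nat) =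
    hol (B * (\<Sum>j<m. (D * K s) ^ j)) (s * (\<Sum>j<m. t ^ j)) (D ^ m) (F * (\<Sum>j<m. D ^ j)) (t ^ m)"
proof (induction m)
  case 0
  show ?case using hol_one by simp
next
  case (Suc m)
  let ?g = "\<lambda>x :: int. \<Sum>j<m. x ^ j"
  have "[s * ?g t = int m * s] (mod int (p ^ b))"
    using cong_mult[OF cong_refl sum_powers_cong_one, of t "int (p ^ b)" s m] v by (simp add: valid_def mult.commute)
  then have "[K (s * ?g t) = K s ^ m] (mod int q)"
    using cong_trans[OF _ K_pow] K_eq by blast
  then have A: "[D ^ m * K (s * ?g t) * B = (D * K s) ^ m * B] (mod int q)"
    unfolding power_mult_distrib by (intro cong_mult cong_refl)
  have "hol B s D F t [^]\<^bsub>holomorph N\<^esub> Suc m =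
     hol (B * ?g (D * K s) + D ^ m * K (s * ?g t) * B) (s * ?g t + t ^ m * s) (D ^ m * D) (D ^ m * F + F * ?g D) (t ^ m * t)"
    using Suc hol_mult[OF valid_pow[OF v] v] by simp
  also have "\<dots> = hol (B * (\<Sum>j<Suc m. (D * K s) ^ j)) (s * (\<Sum>j<Suc m. t ^ j)) (D ^ Suc m) (F * (\<Sum>j<Suc m. D ^ j)) (t ^ Suc m)"
    by (rule hol_cong) (use cong_add[OF cong_refl A, of "B * ?g (D * K s)"] in \<open>simp_all add: algebra_simps\<close>)
  finally show ?case .
qed

lemma transl_pow: "hol y 0 1 f 1 [^]\<^bsub>holomorph N\<^esub> (m :: nat) = hol (int m * y) 0 1 (int m * f) 1"
proof -
  have "[y * (\<Sum>j<m. (1 * K 0) ^ j) = y * int m] (mod int q)"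
    by (rule cong_mult[OF cong_refl sum_powers_cong_one]) (simp add: K_zero)
  then show ?thesis
    unfolding hol_pow[OF valid_one] by (intro hol_cong) (simp_all add: mult.commute)
qed

lemma cong_p: "[x = y] (mod M) \<Longrightarrow> [x = y] (mod int p)"
proof -
  assume "[x = y] (mod M)"
  moreover have "int p dvd M" using n by (simp add: dvd_power)
  ultimately show ?thesis by (rule cong_dvd_modulus)
qed

lemma coprime_not_dvd_p: "coprime x (int p) \<longleftrightarrow> \<not> int p dvd x"
  using p by (metis coprime_commute prime_imp_coprime coprime_absorb_left prime_nat_int_transfer not_prime_unit)

text \<open>Fermat disposes of \<open>D\<close>, since its exponents \<open>q\<close> and
  \<open>q - 1\<close> are consecutive. Modulo \<open>p\<close> the exponents \<open>q\<close> and
  \<open>p - 1\<close> are coprime, so \<open>t\<close> is 1 there; then the sum of its powers is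
  congruent to \<open>q\<close>, hence a unit modulo \<open>M\<close>, and can be cancelled both
  from \<open>t ^ q = 1\<close> and from the equation for \<open>s\<close>.\<close>

lemma order_q:
  assumes v: "valid D t" and F: "b = 0 \<Longrightarrow> F = 0"
    and one: "hol B s D F t [^]\<^bsub>holomorph N\<^esub> q = \<one>\<^bsub>holomorph N\<^esub>"
  shows "[D = 1] (mod int q)" "[t = 1] (mod M)" "[s = 0] (mod M)"
proof -
  have e: "hol (B * (\<Sum>j<q. (D * K s) ^ j)) (s * (\<Sum>j<q. t ^ j)) (D ^ q) (F * (\<Sum>j<q. D ^ j)) (t ^ q) = hol 0 0 1 0 1"
    using one hol_pow[OF v] hol_one by simp
  note c = hol_eq[OF _ e]
  have Dq: "[D ^ q = 1] (mod int q)" and tq: "[t ^ q = 1] (mod M)" and sq: "[s * (\<Sum>j<q. t ^ j) = 0] (mod M)"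
    using c F by auto
  have "D ^ q = D ^ (q - 1) * D" using q by (simp add: power_eq_if prime_gt_0_nat)
  moreover have "[D ^ (q - 1) * D = 1 * D] (mod int q)"
    using v fermat_int[OF q] by (intro cong_mult cong_refl) (simp add: valid_def)
  ultimately show "[D = 1] (mod int q)" using Dq by (metis cong_sym cong_trans mult_1)
  have "[t ^ (p - 1) = 1] (mod int p)"
    using v fermat_int[OF p(1)] coprime_not_dvd_p by (simp add: valid_def)
  moreover have "coprime q (p - 1)"
  proof (rule prime_imp_coprime[OF q])
    show "\<not> q dvd p - 1" using pq prime_gt_1_nat[OF p(1)] by (auto dest: dvd_imp_le)
  qed
  ultimately have t1: "[t = 1] (mod int p)"
    using cong_one_of_coprime_powers[of q "p - 1" t p] cong_p[OF tq] prime_gt_0_nat[OF p(1)] by simp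
  have gq: "[(\<Sum>j<q. t ^ j) = int q] (mod int p)" by (rule sum_powers_cong_one[OF t1])
  have "\<not> int p dvd int q" using p q pq by (simp add: primes_dvd_imp_eq)  (metis primes_dvd_imp_eq less_irrefl)
  then have "coprime (\<Sum>j<q. t ^ j) (int p)"
    unfolding coprime_not_dvd_p using cong_dvd_iff[OF gq] by simp
  then have cop: "coprime (\<Sum>j<q. t ^ j) M" by simp
  have "[(t - 1) * (\<Sum>j<q. t ^ j) = 0 * (\<Sum>j<q. t ^ j)] (mod M)"
    using tq by (simp add: sum_powers_eq cong_diff_iff_cong_0)
  then have "[t - 1 = 0] (mod M)" by (simp only: cong_mult_rcancel[OF cop])
  then show "[t = 1] (mod M)" by (simp only: cong_diff_iff_cong_0)
  have "[s * (\<Sum>j<q. t ^ j) = 0 * (\<Sum>j<q. t ^ j)] (mod M)" using sq by simp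
  then show "[s = 0] (mod M)" by (simp only: cong_mult_rcancel[OF cop])
qed

end

section \<open>Regular embeddings of metacyclic groups\<close>

locale metacyclic_pair = G: metacyclic p n q bG KG G + N: metacyclic p n q b K N
  for p n q bG KG G b K N
begin

abbreviation "Hol \<equiv> holomorph N"

lemma group_Hol: "group Hol" by (rule group_holomorph[OF N.grp])

text \<open>The second coordinate depends on \<open>i\<close> only, and for fixed \<open>i\<close>
  the first is affine in \<open>x\<close>. So bijectivity can be examined for \<open>i\<close> and
  \<open>x\<close> in turn.\<close>

lemma fst_hom_of:
  assumes v: "N.valid D t" and xi: "x < q" "i < p ^ n"
  shows "fst (G.hom_of Hol (N.hol B s D F t) (N.hol y 0 1 f 1) (N.el (int x) (int i))) =
    N.el (B * (\<Sum>j<i. (D * K s) ^ j) + K (s * (\<Sum>j<i. t ^ j)) * (F * (\<Sum>j<i. D ^ j)) +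
      int x * (y + K (s * (\<Sum>j<i. t ^ j)) * f)) (s * (\<Sum>j<i. t ^ j))"
proof -
  let ?g = "\<lambda>x :: int. \<Sum>j<i. x ^ j"
  have el: "N.el (int x) (int i) = (int x, int i)" using xi by (simp add: N.el_def del: of_nat_power)
  have "(int x, int i) \<in> carrier G" using N.el_in[of "int x" "int i"] by (simp add: el N.car G.car)
  then have "G.hom_of Hol (N.hol B s D F t) (N.hol y 0 1 f 1) (N.el (int x) (int i)) =
     N.hol y 0 1 f 1 [^]\<^bsub>Hol\<^esub> x \<otimes>\<^bsub>Hol\<^esub> N.hol B s D F t [^]\<^bsub>Hol\<^esub> i"
    unfolding el G.hom_of_def by simp
  also have "\<dots> = N.hol (int x * y + 1 * K 0 * (B * ?g (D * K s))) (0 + 1 * (s * ?g t)) (1 * D ^ i)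
      (1 * (F * ?g D) + int x * f) (1 * t ^ i)"
    unfolding N.transl_pow N.hol_pow[OF v] by (rule N.hol_mult[OF N.valid_one N.valid_pow[OF v]])
  also have "\<dots> = N.hol (int x * y + B * ?g (D * K s)) (s * ?g t) (D ^ i) (F * ?g D + int x * f) (t ^ i)"
    using cong_add[OF cong_refl cong_mult[OF N.K_zero cong_refl], of "int x * y" "B * ?g (D * K s)"]
    by (intro N.hol_cong) simp_all
  finally show ?thesis by (simp add: N.hol_def algebra_simps)
qed

text \<open>
  The pair \<open>hol B s D F t\<close>, \<open>hol y 0 1 f 1\<close> is the image of the two generators. The element of order
  \<open>q\<close> has one of the scalars \<open>D * K s\<close> and \<open>D\<close> on its coordinate \<open>y\<close> or \<open>f\<close>, and exactly one of
  these coordinates may be nonzero.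
\<close>

definition admissible :: "int \<Rightarrow> int \<Rightarrow> int \<Rightarrow> int \<Rightarrow> int \<Rightarrow> int \<Rightarrow> int \<Rightarrow> bool" where
  "admissible B s D F t y f \<longleftrightarrow> N.valid D t \<and> (b = 0 \<longrightarrow> F = 0 \<and> f = 0) \<and> coprime s (int p) \<and> [t = 1] (mod int p) \<and>
     ([D * K s = 1] (mod int q) \<longrightarrow> [B = 0] (mod int q)) \<and> ([D = 1] (mod int q) \<longrightarrow> [F = 0] (mod int q)) \<and>
     (([f = 0] (mod int q) \<and> \<not> [y = 0] (mod int q) \<and> [D * K s = int G.\<kappa>] (mod int q)) \<or>
      (b \<noteq> 0 \<and> [y = 0] (mod int q) \<and> \<not> [f = 0] (mod int q) \<and> [D = int G.\<kappa>] (mod int q)))"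

definition regular_pair where
  "regular_pair S T \<longleftrightarrow> G.relators Hol S T \<and>
     bij_betw (\<lambda>z. fst (G.hom_of Hol S T z)) (carrier G) (carrier N)"

lemma sum_powers_q: "[x = 1] (mod int q) \<Longrightarrow> [c * (\<Sum>j<p ^ n. x ^ j) = 0] (mod int q) \<Longrightarrow> [c = 0] (mod int q)"
proof -
  assume x: "[x = 1] (mod int q)" and c: "[c * (\<Sum>j<p ^ n. x ^ j) = 0] (mod int q)"
  have "\<not> int q dvd (\<Sum>j<p ^ n. x ^ j)"
    using cong_dvd_iff[OF sum_powers_cong_one[OF x, of "p ^ n"]] N.q_not_dvd_M by simp
  then show "[c = 0] (mod int q)" using c prime_dvd_mult_iff[OF N.prime_q] by (simp only: cong_0_iff simp_thms)
qed

text \<open>The two sides agree in \<open>s\<close>, \<open>D\<close> and \<open>t\<close>, so the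
  relation is an eigenvector condition on \<open>y\<close> and on \<open>f\<close>
  separately.\<close>

lemma relator_iff:
  assumes v: "N.valid D t" and bF: "b = 0 \<Longrightarrow> F = 0 \<and> f = 0"
  shows "N.hol B s D F t \<otimes>\<^bsub>Hol\<^esub> N.hol y 0 1 f 1 = N.hol y 0 1 f 1 [^]\<^bsub>Hol\<^esub> G.\<kappa> \<otimes>\<^bsub>Hol\<^esub> N.hol B s D F t \<longleftrightarrow>
    [y * (D * K s) = y * int G.\<kappa>] (mod int q) \<and> [f * D = f * int G.\<kappa>] (mod int q)"
proof -
  have l: "N.hol B s D F t \<otimes>\<^bsub>Hol\<^esub> N.hol y 0 1 f 1 = N.hol (B + D * K s * y) s D (D * f + F) t"
    using N.hol_mult[OF v N.valid_one, of B s F y 0 f] by simp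
  have "N.hol y 0 1 f 1 [^]\<^bsub>Hol\<^esub> G.\<kappa> \<otimes>\<^bsub>Hol\<^esub> N.hol B s D F t = N.hol (int G.\<kappa> * y + K 0 * B) s D (F + int G.\<kappa> * f) t"
    unfolding N.transl_pow using N.hol_mult[OF N.valid_one v, of "int G.\<kappa> * y" 0 "int G.\<kappa> * f" B s F] by simp
  also have "\<dots> = N.hol (int G.\<kappa> * y + B) s D (F + int G.\<kappa> * f) t"
    using cong_add[OF cong_refl cong_mult[OF N.K_zero cong_refl], of "int G.\<kappa> * y" B] by (intro N.hol_cong) simp_all
  finally have r: "N.hol y 0 1 f 1 [^]\<^bsub>Hol\<^esub> G.\<kappa> \<otimes>\<^bsub>Hol\<^esub> N.hol B s D F t = N.hol (int G.\<kappa> * y + B) s D (F + int G.\<kappa> * f) t" .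
  have i1: "[B + D * K s * y = int G.\<kappa> * y + B] (mod int q) \<longleftrightarrow> [y * (D * K s) = y * int G.\<kappa>] (mod int q)"
    using cong_add_lcancel[of B "D * K s * y" "int G.\<kappa> * y"] by (simp add: mult_ac add_ac)
  have i2: "[D * f + F = F + int G.\<kappa> * f] (mod int q) \<longleftrightarrow> [f * D = f * int G.\<kappa>] (mod int q)"
    using cong_add_lcancel[of F "D * f" "int G.\<kappa> * f"] by (simp add: mult_ac add_ac)
  show ?thesis unfolding l r i1[symmetric] i2[symmetric]
  proof
    assume "N.hol (B + D * K s * y) s D (D * f + F) t = N.hol (int G.\<kappa> * y + B) s D (F + int G.\<kappa> * f) t"
    from N.hol_eq[OF _ this] bF
    show "[B + D * K s * y = int G.\<kappa> * y + B] (mod int q) \<and> [D * f + F = F + int G.\<kappa> * f] (mod int q)" by auto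
  qed (auto intro: N.hol_cong)
qed

lemma regular_pair_admissible:
  assumes "regular_pair S T"
  shows "\<exists>B s D F t y f. admissible B s D F t y f \<and> S = N.hol B s D F t \<and> T = N.hol y 0 1 f 1"
proof -
  have rel: "S \<in> carrier Hol" "T \<in> carrier Hol" "T [^]\<^bsub>Hol\<^esub> q = \<one>\<^bsub>Hol\<^esub>" "S [^]\<^bsub>Hol\<^esub> (p ^ n) = \<one>\<^bsub>Hol\<^esub>"
     "S \<otimes>\<^bsub>Hol\<^esub> T = T [^]\<^bsub>Hol\<^esub> G.\<kappa> \<otimes>\<^bsub>Hol\<^esub> S"
    and bij: "bij_betw (\<lambda>z. fst (G.hom_of Hol S T z)) (carrier G) (carrier N)"
    using assms by (auto simp: regular_pair_def G.relators_def)
  obtain B s D F t where S: "N.valid D t" "b = 0 \<longrightarrow> F = 0" "S = N.hol B s D F t"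
    using N.hol_cases[OF rel(1)] by blast
  obtain y s' D' f t' where T': "N.valid D' t'" "b = 0 \<longrightarrow> f = 0" "T = N.hol y s' D' f t'"
    using N.hol_cases[OF rel(2)] by blast
  have bf: "b = 0 \<Longrightarrow> F = 0 \<and> f = 0" using S T' by simp
  have T: "T = N.hol y 0 1 f 1"
    unfolding T'(3) using N.order_q[OF T'(1)] T' rel(3) by (intro N.hol_cong) auto
  have r: "[y * (D * K s) = y * int G.\<kappa>] (mod int q)" "[f * D = f * int G.\<kappa>] (mod int q)"
    using rel(5) relator_iff[OF S(1) bf] unfolding S T by simp_all
  let ?g = "\<lambda>x :: int. \<Sum>j<p ^ n. x ^ j"
  have "N.hol (B * ?g (D * K s)) (s * ?g t) (D ^ (p ^ n)) (F * ?g D) (t ^ (p ^ n)) = N.hol 0 0 1 0 1"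
    using rel(4) N.hol_pow[OF S(1), where m = "p ^ n"] N.hol_one by (simp add: S)
  note pw = N.hol_eq[OF _ this]
  have pB: "[B * ?g (D * K s) = 0] (mod int q)" and pF: "[F * ?g D = 0] (mod int q)" and pt: "[t ^ (p ^ n) = 1] (mod N.M)"
    using pw S(2) by auto
  have gt: "fst (G.hom_of Hol S T (N.el (int x) (int i))) = 
     N.el (B * (\<Sum>j<i. (D * K s) ^ j) + K (s * (\<Sum>j<i. t ^ j)) * (F * (\<Sum>j<i. D ^ j)) +
      int x * (y + K (s * (\<Sum>j<i. t ^ j)) * f)) (s * (\<Sum>j<i. t ^ j))" if "x < q" "i < p ^ n" for x i
    unfolding S T by (rule fst_hom_of[OF S(1) that])
  \<comment> \<open>Every second coordinate in the image is a multiple of \<open>s\<close>, and 1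
    has to occur.\<close>
  have cs: "coprime s (int p)"
    unfolding N.coprime_not_dvd_p
  proof
    assume ps: "int p dvd s"
    have "N.el 0 1 \<in> (\<lambda>z. fst (G.hom_of Hol S T z)) ` carrier G"
      using bij N.el_in by (simp add: bij_betw_def)
    then obtain z where z: "z \<in> carrier G" "fst (G.hom_of Hol S T z) = N.el 0 1" by auto
    have zz: "nat (fst z) < q" "nat (snd z) < p ^ n" "N.el (int (nat (fst z))) (int (nat (snd z))) = z"
      using z(1) by (auto simp: G.car N.el_def nat_less_iff)
    have "[s * (\<Sum>j<nat (snd z). t ^ j) = 1] (mod N.M)"
      using trans[OF gt[OF zz(1,2), symmetric, unfolded zz(3)] z(2), unfolded N.el_eq] by (rule conjunct2)
    then have "int p dvd s * (\<Sum>j<nat (snd z). t ^ j) \<longleftrightarrow> int p dvd 1" by (rule cong_dvd_iff[OF N.cong_p])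
    then show False using ps prime_gt_1_nat[OF N.p(1)] by simp
  qed
  \<comment> \<open>Otherwise \<open>T\<close> fixes the identity, and the group elements
    \<open>(0, 0)\<close> and \<open>(1, 0)\<close> have the same image.\<close>
  have nz: "\<not> ([y = 0] (mod int q) \<and> [f = 0] (mod int q))"
  proof
    assume "[y = 0] (mod int q) \<and> [f = 0] (mod int q)"
    then have "[y + K 0 * f = 0 + K 0 * 0] (mod int q)" by (intro cong_add cong_mult cong_refl) auto
    then have "fst (G.hom_of Hol S T (N.el (int 1) (int 0))) = fst (G.hom_of Hol S T (N.el (int 0) (int 0)))"
      using gt[of 1 0] gt[of 0 0] N.q_gt_1 N.M_pos by (simp add: N.el_eq)
    moreover have "N.el x i \<in> carrier G" for x i using N.el_in by (simp add: N.car G.car)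
    ultimately have "N.el (int 1) (int 0) = N.el (int 0) (int 0)"
      using bij by (auto simp: bij_betw_def dest: inj_onD)
    then show False using N.q_gt_1 by (simp add: N.el_eq cong_0_iff)
  qed
  \<comment> \<open>The exponents \<open>p ^ n\<close> and \<open>p - 1\<close> both give 1 modulo
    \<open>p\<close> and are coprime.\<close>
  have t1: "[t = 1] (mod int p)"
  proof (rule cong_one_of_coprime_powers)
    show "[t ^ (p ^ n) = 1] (mod int p)" by (rule N.cong_p[OF pt])
    show "[t ^ (p - 1) = 1] (mod int p)"
      using S(1) fermat_int[OF N.p(1)] N.coprime_not_dvd_p by (simp add: N.valid_def)
    show "coprime (p ^ n) (p - 1)" 
    proof -
      have "\<not> p dvd p - 1" using prime_gt_1_nat[OF N.p(1)] by (auto dest: dvd_imp_le)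
      then show ?thesis using prime_imp_coprime[OF N.p(1)] by simp
    qed
    show "p > 0" by (rule prime_gt_0_nat[OF N.p(1)])
  qed
  have yc: "[D * K s = int G.\<kappa>] (mod int q)" if "\<not> [y = 0] (mod int q)"
    using r(1) that by (simp add: N.cong_cancel_q cong_0_iff)
  have fc: "[D = int G.\<kappa>] (mod int q)" if "\<not> [f = 0] (mod int q)"
    using r(2) that by (simp add: N.cong_cancel_q cong_0_iff)
  \<comment> \<open>If both were nonzero, the two eigenvalues \<open>D * K s\<close> and
    \<open>D\<close> would coincide, so \<open>K s\<close> would be 1 and \<open>p ^ b\<close> would
    divide \<open>s\<close>. A nonzero \<open>f\<close> excludes \<open>b = 0\<close>, so this
    contradicts \<open>cs\<close>.\<close>
  have yf: "[y = 0] (mod int q) \<or> [f = 0] (mod int q)"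
  proof (rule ccontr)
    assume c: "\<not> ([y = 0] (mod int q) \<or> [f = 0] (mod int q))"
    then have "[D * K s = D * 1] (mod int q)" using cong_trans[OF yc cong_sym[OF fc]] by simp
    then have "[K s = 1] (mod int q)"
      by (rule iffD1[OF N.cong_cancel_q, rotated]) (use S(1) in \<open>simp add: N.valid_def\<close>)
    then have "[K s = K 0] (mod int q)" by (rule cong_trans[OF _ cong_sym[OF N.K_zero]])
    then have "[s = 0] (mod int (p ^ b))" by (simp only: N.K_eq)
    moreover have "b \<noteq> 0"
    proof
      assume "b = 0"
      then have "f = 0" using bf by simp
      then show False using c by simp
    qed
    ultimately have "int p dvd s" 
      using dvd_trans[OF dvd_power[of b "int p"]] by (simp add: cong_0_iff)
    then show False using iffD1[OF N.coprime_not_dvd_p cs] by contradiction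
  qed
  have bn: "b \<noteq> 0" if "\<not> [f = 0] (mod int q)"
  proof
    assume "b = 0"
    then have "f = 0" using bf by simp
    then show False using that by simp
  qed
  have disj: "([f = 0] (mod int q) \<and> \<not> [y = 0] (mod int q) \<and> [D * K s = int G.\<kappa>] (mod int q)) \<or>
      (b \<noteq> 0 \<and> [y = 0] (mod int q) \<and> \<not> [f = 0] (mod int q) \<and> [D = int G.\<kappa>] (mod int q))"
  proof (cases "[f = 0] (mod int q)")
    case True
    with nz have "\<not> [y = 0] (mod int q)" by simp
    then show ?thesis by (intro disjI1 conjI True yc)
  next
    case False
    with yf have "[y = 0] (mod int q)" by simp
    then show ?thesis by (intro disjI2 conjI False fc bn)
  qed
  have bf': "b = 0 \<longrightarrow> F = 0 \<and> f = 0" using bf by blast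
  have "admissible B s D F t y f"
    unfolding admissible_def by (intro conjI S(1) bf' cs t1 impI sum_powers_q[OF _ pB] sum_powers_q[OF _ pF] disj)
  then show ?thesis using S(3) T by blast
qed

lemma admissible_regular_pair:
  assumes g: "admissible B s D F t y f"
  shows "regular_pair (N.hol B s D F t) (N.hol y 0 1 f 1)"
proof -
  have v: "N.valid D t" and bf: "b = 0 \<Longrightarrow> F = 0 \<and> f = 0" and cs: "coprime s (int p)" and t1: "[t = 1] (mod int p)"
    and AB: "[D * K s = 1] (mod int q) \<Longrightarrow> [B = 0] (mod int q)" and DF: "[D = 1] (mod int q) \<Longrightarrow> [F = 0] (mod int q)"
    using g[unfolded admissible_def] by simp_all
  let ?S = "N.hol B s D F t" and ?T = "N.hol y 0 1 f 1"
  let ?g = "\<lambda>x :: int. \<Sum>j<p ^ n. x ^ j"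
  have \<kappa>M: "[int G.\<kappa> ^ (p ^ n) = 1] (mod int q)"
    using cong_trans[OF G.\<kappa>_pow cong_trans[OF G.K_cong[of "N.M" 0] G.K_zero]] by (simp add: cong_def)
  have KM: "[K s ^ (p ^ n) = 1] (mod int q)"
    using cong_trans[OF cong_sym[OF N.K_pow[of "p ^ n" s]] cong_trans[OF N.K_cong[of "N.M * s" 0] N.K_zero]]
    by (simp add: cong_def)
  \<comment> \<open>\<open>G.\<kappa>\<close> and \<open>K s\<close> have trivial
    \<open>p ^ n\<close>-th powers, and one of \<open>D\<close> and \<open>D * K s\<close> is
    congruent to \<open>G.\<kappa>\<close>.\<close>
  have DM: "[D ^ (p ^ n) = 1] (mod int q)" and AM: "[(D * K s) ^ (p ^ n) = 1] (mod int q)"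
  proof -
    have e: "[(D * K s) ^ (p ^ n) = D ^ (p ^ n)] (mod int q)"
    proof -
      have "[D ^ (p ^ n) * K s ^ (p ^ n) = D ^ (p ^ n) * 1] (mod int q)" by (rule cong_mult[OF cong_refl KM])
      then show ?thesis by (simp add: power_mult_distrib)
    qed
    have "[D * K s = int G.\<kappa>] (mod int q) \<or> [D = int G.\<kappa>] (mod int q)" using g[unfolded admissible_def] by blast
    then have "[D ^ (p ^ n) = 1] (mod int q)"
    proof
      assume "[D * K s = int G.\<kappa>] (mod int q)"
      then show ?thesis by (rule cong_trans[OF cong_sym[OF e] cong_trans[OF cong_pow \<kappa>M]])
    next
      assume "[D = int G.\<kappa>] (mod int q)"
      then show ?thesis by (rule cong_trans[OF cong_pow \<kappa>M])
    qed
    then show "[D ^ (p ^ n) = 1] (mod int q)" "[(D * K s) ^ (p ^ n) = 1] (mod int q)"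
      by (assumption, rule cong_trans[OF e])
  qed
  \<comment> \<open>A geometric sum over a full period vanishes unless the ratio is 1, and then the
    coefficient itself must vanish. This is where the conditions on \<open>B\<close> and
    \<open>F\<close> in \<open>admissible\<close> come from.\<close>
  have van: "[c * ?g x = 0] (mod int q)"
    if "[x ^ (p ^ n) = 1] (mod int q)" "[x = 1] (mod int q) \<Longrightarrow> [c = 0] (mod int q)" for c x
  proof (cases "[x = 1] (mod int q)")
    case False
    have "int q dvd (x - 1) * ?g x" using that(1) by (simp add: sum_powers_eq cong_iff_dvd_diff)
    moreover have "\<not> int q dvd x - 1" using False by (simp add: cong_iff_dvd_diff)
    ultimately have "int q dvd ?g x" by (simp only: prime_dvd_mult_iff[OF N.prime_q] simp_thms)
    then show ?thesis by (simp add: cong_0_iff)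
  next
    case True
    then show ?thesis using that(2) by (simp add: cong_0_iff)
  qed
  have gt: "N.M dvd ?g t"
    using prime_power_dvd_sum_powers[OF N.p t1, of n "p ^ n"] by simp
  have "?S [^]\<^bsub>Hol\<^esub> (p ^ n) = \<one>\<^bsub>Hol\<^esub>"
    unfolding N.hol_pow[OF v] N.hol_one
  proof (rule N.hol_cong)
    show "[B * ?g (D * K s) = 0] (mod int q)" by (rule van[OF AM AB])
    show "[F * ?g D = 0] (mod int q)" by (rule van[OF DM DF])
    show "[s * ?g t = 0] (mod N.M)" using gt by (simp only: cong_0_iff dvd_mult)
    show "[t ^ (p ^ n) = 1] (mod N.M)"
      using dvd_mult[OF gt, of "t - 1"] by (simp only: sum_powers_eq cong_iff_dvd_diff)
  qed (rule DM)
  moreover have "?T [^]\<^bsub>Hol\<^esub> q = \<one>\<^bsub>Hol\<^esub>"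
    unfolding N.transl_pow N.hol_one by (rule N.hol_cong) (simp_all add: cong_0_iff)
  moreover have "?S \<otimes>\<^bsub>Hol\<^esub> ?T = ?T [^]\<^bsub>Hol\<^esub> G.\<kappa> \<otimes>\<^bsub>Hol\<^esub> ?S"
  proof -
    have z: "[u * c = u * d] (mod int q)" if "[u = 0] (mod int q)" for u c d
      using that by (simp add: cong_iff_dvd_diff cong_0_iff dvd_diff)
    have "[y * (D * K s) = y * int G.\<kappa>] (mod int q) \<and> [f * D = f * int G.\<kappa>] (mod int q)"
    proof (cases "[f = 0] (mod int q)")
      case True
      then have "[D * K s = int G.\<kappa>] (mod int q)" using g[unfolded admissible_def] by blast
      then show ?thesis by (intro conjI z True cong_mult[OF cong_refl])
    next
      case False
      then have "[y = 0] (mod int q)" "[D = int G.\<kappa>] (mod int q)" using g[unfolded admissible_def] by blast+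
      then show ?thesis by (intro conjI z cong_mult[OF cong_refl])
    qed
    then show ?thesis using relator_iff[OF v bf] by blast
  qed
  ultimately have rel: "G.relators Hol ?S ?T"
    using N.hol_in[OF v] N.hol_in[OF N.valid_one] by (simp add: G.relators_def)
  \<comment> \<open>The slope of the first coordinate as a function of \<open>x\<close>: exactly one
    summand is nonzero modulo \<open>q\<close>.\<close>
  have unit: "\<not> int q dvd y + K c * f" for c
  proof
    assume a: "int q dvd y + K c * f"
    have "([f = 0] (mod int q) \<and> \<not> [y = 0] (mod int q)) \<or> ([y = 0] (mod int q) \<and> \<not> [f = 0] (mod int q))"
      using g[unfolded admissible_def] by blast
    then show False
    proof
      assume h: "[f = 0] (mod int q) \<and> \<not> [y = 0] (mod int q)"
      then have "int q dvd K c * f" by (simp add: cong_0_iff)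
      then have "int q dvd y" using a by (simp add: dvd_add_left_iff)
      then show False using h by (simp add: cong_0_iff)
    next
      assume h: "[y = 0] (mod int q) \<and> \<not> [f = 0] (mod int q)"
      then have "int q dvd K c * f" using a by (simp add: cong_0_iff dvd_add_right_iff)
      then show False using h N.K_not_dvd prime_dvd_mult_iff[OF N.prime_q] by (simp add: cong_0_iff)
    qed
  qed
  \<comment> \<open>After removal of the units \<open>s\<close> and \<open>t ^ i\<close> the
    difference of the sums is a sum of \<open>j - i\<close> powers, so lifting the exponent makes
    \<open>p ^ n\<close> divide \<open>j - i\<close>.\<close>
  have ginj: "i = j" if ij: "i \<le> j" "j < p ^ n" and eq: "[s * (\<Sum>k<i. t ^ k) = s * (\<Sum>k<j. t ^ k)] (mod N.M)" for i j
  proof -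
    have "coprime s N.M" using cs by simp
    then have "[(\<Sum>k<i. t ^ k) = (\<Sum>k<j. t ^ k)] (mod N.M)" using eq by (simp only: cong_mult_lcancel)
    moreover have "(\<Sum>k<j. t ^ k) = (\<Sum>k<i. t ^ k) + t ^ i * (\<Sum>k<j - i. t ^ k)"
      using sum.nat_group[of "\<lambda>k. t ^ k"] ij(1)
      by (simp add: sum_distrib_left power_add[symmetric] sum.atLeastLessThan_shift_0[of _ i j, simplified] lessThan_atLeast0 sum.atLeastLessThan_concat[symmetric, of 0 i j])
    ultimately have "[(\<Sum>k<i. t ^ k) + 0 = (\<Sum>k<i. t ^ k) + t ^ i * (\<Sum>k<j - i. t ^ k)] (mod N.M)" by simp
    then have "[0 = t ^ i * (\<Sum>k<j - i. t ^ k)] (mod N.M)" by (simp only: cong_add_lcancel)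
    then have "N.M dvd t ^ i * (\<Sum>k<j - i. t ^ k)" by (simp only: cong_sym_eq[of 0] cong_0_iff)
    moreover have "coprime N.M (t ^ i)" using v by (simp add: N.valid_def coprime_commute)
    ultimately have "int p ^ n dvd (\<Sum>k<j - i. t ^ k)" by (simp add: coprime_dvd_mult_right_iff)
    then have "p ^ n dvd j - i" by (simp only: prime_power_dvd_sum_powers[OF N.p t1])
    then show "i = j" using ij by (auto dest: dvd_imp_le)
  qed
  have "inj_on (\<lambda>z. fst (G.hom_of Hol ?S ?T z)) (carrier G)"
  proof (rule inj_onI)
    fix z w assume z: "z \<in> carrier G" and w: "w \<in> carrier G" and eq: "fst (G.hom_of Hol ?S ?T z) = fst (G.hom_of Hol ?S ?T w)"
    define x i x' i' where "x = nat (fst z)" "i = nat (snd z)" "x' = nat (fst w)" "i' = nat (snd w)"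
    note d = this
    have zz: "x < q" "i < p ^ n" "N.el (int x) (int i) = z" and ww: "x' < q" "i' < p ^ n" "N.el (int x') (int i') = w"
      using z w by (auto simp: d G.car N.el_def nat_less_iff)
    note e = eq[folded zz(3) ww(3), unfolded fst_hom_of[OF v zz(1,2)] fst_hom_of[OF v ww(1,2)] N.el_eq]
    have ii: "i = i'"
    proof (cases "i \<le> i'")
      case True
      then show ?thesis using ww(2) e by (intro ginj) auto
    next
      case False
      have "i' = i" using False zz(2) cong_sym[OF conjunct2[OF e]] by (intro ginj) auto
      then show ?thesis by simp
    qed
    have "[int x * (y + K (s * (\<Sum>j<i. t ^ j)) * f) = int x' * (y + K (s * (\<Sum>j<i. t ^ j)) * f)] (mod int q)"
      using e ii by (simp add: cong_add_lcancel)
    then have "[int x = int x'] (mod int q)" using unit by (simp add: mult.commute[of "int _"] N.cong_cancel_q)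
    then show "z = w" using zz(3) ww(3) ii by (simp add: N.el_eq flip: zz(3) ww(3))
  qed
  moreover have "(\<lambda>z. fst (G.hom_of Hol ?S ?T z)) ` carrier G \<subseteq> carrier N"
  proof (rule image_subsetI)
    fix z assume "z \<in> carrier G"
    then have "G.hom_of Hol ?S ?T z \<in> carrier Hol"
      using hom_in_carrier[OF G.hom_of_hom[OF group_Hol rel]] by blast
    then show "fst (G.hom_of Hol ?S ?T z) \<in> carrier N" by (simp only: carrier_holomorph mem_Times_iff)
  qed
  ultimately have "bij_betw (\<lambda>z. fst (G.hom_of Hol ?S ?T z)) (carrier G) (carrier N)"
    using endo_inj_surj[OF G.finite_carrier] by (simp add: bij_betw_def G.car N.car)
  then show ?thesis using rel by (simp add: regular_pair_def)
qed

lemma card_regular_embeddings_eq: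
  "card (regular_embeddings G N) = card {(S, T). regular_pair S T}"
proof (rule bij_betw_same_card)
  show "bij_betw (\<lambda>\<beta>. (\<beta> (G.el 0 1), \<beta> (G.el 1 0))) (regular_embeddings G N) {(S, T). regular_pair S T}"
  proof (rule bij_betw_byWitness[where f' = "\<lambda>(S, T). G.hom_of Hol S T"])
    have u: "G.hom_of Hol (\<beta> (G.el 0 1)) (\<beta> (G.el 1 0)) = \<beta>" if "\<beta> \<in> regular_embeddings G N" for \<beta>
      by (rule G.hom_of_unique[OF group_Hol]) (use that in \<open>simp_all add: regular_embeddings_def\<close>)
    then show "\<forall>\<beta>\<in>regular_embeddings G N. (case (\<beta> (G.el 0 1), \<beta> (G.el 1 0)) of (S, T) \<Rightarrow> G.hom_of Hol S T) = \<beta>"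
      by simp
    show "\<forall>z\<in>{(S, T). regular_pair S T}. ((case z of (S, T) \<Rightarrow> G.hom_of Hol S T) (G.el 0 1), (case z of (S, T) \<Rightarrow> G.hom_of Hol S T) (G.el 1 0)) = z"
      using G.hom_of_gens[OF group_Hol] by (auto simp: regular_pair_def)
    show "(\<lambda>\<beta>. (\<beta> (G.el 0 1), \<beta> (G.el 1 0))) ` regular_embeddings G N \<subseteq> {(S, T). regular_pair S T}"
    proof (rule image_subsetI)
      fix \<beta> assume b: "\<beta> \<in> regular_embeddings G N"
      then have "\<beta> \<in> hom G Hol" "bij_betw (\<lambda>z. fst (\<beta> z)) (carrier G) (carrier N)"
        by (simp_all add: regular_embeddings_def)
      then show "(\<beta> (G.el 0 1), \<beta> (G.el 1 0)) \<in> {(S, T). regular_pair S T}"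
        using G.hom_relators(1)[OF group_Hol] u[OF b] by (simp add: regular_pair_def)
    qed
    show "(\<lambda>(S, T). G.hom_of Hol S T) ` {(S, T). regular_pair S T} \<subseteq> regular_embeddings G N"
      using G.hom_of_hom[OF group_Hol] by (auto simp: regular_pair_def regular_embeddings_def G.hom_of_def)
  qed
qed

end

section \<open>Counting admissible pairs\<close>

lemma card_cong_class:
  assumes "m > 0"
  shows "card {s \<in> {0..<int (m * k)}. [s = c] (mod int m)} = k"
proof -
  have "bij_betw (\<lambda>j. c mod int m + int m * int j) {..<k} {s \<in> {0..<int (m * k)}. [s = c] (mod int m)}"
  proof (rule bij_betwI[where g = "\<lambda>s. nat (s div int m)"])
    show "(\<lambda>j. c mod int m + int m * int j) \<in> {..<k} \<rightarrow> {s \<in> {0..<int (m * k)}. [s = c] (mod int m)}"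
    proof (rule Pi_I)
      fix j assume j: "j \<in> {..<k}"
      have "c mod int m < int m" "0 \<le> c mod int m" using assms by simp_all
      moreover have "int m * int j + int m \<le> int (m * k)"
        using mult_left_mono[of "int j + 1" "int k" "int m"] j by (simp add: algebra_simps)
      ultimately show "c mod int m + int m * int j \<in> {s \<in> {0..<int (m * k)}. [s = c] (mod int m)}"
        by (simp add: cong_def)
    qed
    show "(\<lambda>s. nat (s div int m)) \<in> {s \<in> {0..<int (m * k)}. [s = c] (mod int m)} \<rightarrow> {..<k}"
    proof (rule Pi_I)
      fix s assume s: "s \<in> {s \<in> {0..<int (m * k)}. [s = c] (mod int m)}"
      have "int m * (s div int m) \<le> s" using assms by (simp add: minus_mod_eq_mult_div[symmetric])
      then have "int m * (s div int m) < int m * int k" using s by simp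
      then have "s div int m < int k" using assms by simp
      moreover have "0 \<le> s div int m" using s assms by (simp add: pos_imp_zdiv_nonneg_iff)
      ultimately show "nat (s div int m) \<in> {..<k}" by (simp add: nat_less_iff)
    qed
    show "nat ((c mod int m + int m * int j) div int m) = j" for j
      using assms by simp
    show "c mod int m + int m * int (nat (s div int m)) = s" if "s \<in> {s \<in> {0..<int (m * k)}. [s = c] (mod int m)}" for s
    proof -
      have "c mod int m = s mod int m" using that by (simp add: cong_def)
      moreover have "int (nat (s div int m)) = s div int m" using that assms by (simp add: pos_imp_zdiv_nonneg_iff)
      ultimately show ?thesis by simp
    qed
  qed
  from bij_betw_same_card[OF this] show ?thesis by simp
qed

context metacyclic
begin

definition units where "units = {s \<in> {0..<M}. coprime s (int p)}"

lemma M_eq: "c \<le> n \<Longrightarrow> M = int (p ^ c * p ^ (n - c))"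
  by (simp add: power_add[symmetric])

lemma card_class:
  assumes "c \<le> n"
  shows "card {s \<in> {0..<M}. [s = d] (mod int (p ^ c))} = p ^ (n - c)"
  unfolding M_eq[OF assms] by (rule card_cong_class) (use p in \<open>simp add: prime_gt_0_nat\<close>)

lemma card_units: "card units = totient (p ^ n)"
proof -
  have "int ` totatives (p ^ n) = units"
  proof (intro equalityI subsetI)
    fix s assume "s \<in> int ` totatives (p ^ n)"
    then obtain k where k: "s = int k" "k \<in> totatives (p ^ n)" by auto
    have "1 < p ^ n" using n by (intro one_less_power[OF prime_gt_1_nat[OF p(1)]]) linarith
    then have "k < p ^ n" by (rule totatives_less[OF k(2)])
    moreover have "coprime k p" using k(2) n by (simp add: totatives_def)
    ultimately show "s \<in> units" by (simp add: units_def k(1))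
  next
    fix s assume s: "s \<in> units"
    have "s \<noteq> 0"
    proof
      assume "s = 0"
      then have "coprime 0 (int p)" using s by (simp only: units_def mem_Collect_eq)
      then show False unfolding coprime_not_dvd_p by simp
    qed
    then have "nat s \<in> totatives (p ^ n)"
      using s n coprime_int_iff[of "nat s" p] by (simp add: units_def totatives_def nat_le_iff)
    moreover have "s = int (nat s)" using s by (simp add: units_def)
    ultimately show "s \<in> int ` totatives (p ^ n)" by (rule rev_image_eqI)
  qed
  then have "card units = card (totatives (p ^ n))" by (metis card_image inj_on_of_nat)
  then show ?thesis by (simp add: totient_def)
qed

lemma finite_units: "finite units"
  by (rule finite_subset[of _ "{0..<M}"]) (auto simp: units_def)

lemma cong_p_of_cong_pb: "b \<noteq> 0 \<Longrightarrow> [x = y] (mod int (p ^ b)) \<Longrightarrow> [x = y] (mod int p)"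
  using dvd_power[of b "int p"] by (auto elim: cong_dvd_modulus)

lemma coprime_cong_p: "[x = y] (mod int p) \<Longrightarrow> coprime x (int p) \<longleftrightarrow> coprime y (int p)"
  unfolding coprime_not_dvd_p by (simp only: cong_dvd_iff)

lemma card_units_K:
  assumes "b \<noteq> 0" "coprime c (int p)"
  shows "card {s \<in> units. [K s = K c] (mod int q)} = p ^ (n - b)"
proof -
  have "{s \<in> units. [K s = K c] (mod int q)} = {s \<in> {0..<M}. [s = c] (mod int (p ^ b))}"
  proof -
    have "coprime s (int p)" if "[s = c] (mod int (p ^ b))" for s
      using coprime_cong_p[OF cong_p_of_cong_pb[OF assms(1) that]] assms(2) by simp
    then show ?thesis unfolding K_eq units_def by blast
  qed
  then show ?thesis by (simp only: card_class[OF b])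
qed

text \<open>\<open>D\<close>, \<open>F\<close> and \<open>t\<close> range independently over
  canonical representatives. For \<open>b = 0\<close> there is one \<open>F\<close> and
  \<open>t\<close> is any unit; otherwise \<open>F\<close> is free and \<open>t\<close> runs through
  a single residue class modulo \<open>p ^ b\<close>.\<close>

lemma card_auto:
  "card (auto N) = (if b = 0 then (q - 1) * totient (p ^ n) else (q - 1) * q * p ^ (n - b))"
proof -
  define Z where "Z = (if b = 0 then {0} else {0..<int q})"
  define V where "V = {t \<in> {0..<M}. coprime t (int p) \<and> [t = 1] (mod int (p ^ b))}"
  let ?f = "\<lambda>(D, F, t). aut D F t"
  have Z0: "b = 0 \<Longrightarrow> F = 0" if "F \<in> Z" for F using that by (simp add: Z_def)
  have Zl: "F \<in> {0..<int q}" if "F \<in> Z" for F using that q_pos by (auto simp: Z_def split: if_splits)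
  have inj: "inj_on ?f ({1..<int q} \<times> Z \<times> V)"
  proof (rule inj_onI)
    fix u v assume u: "u \<in> {1..<int q} \<times> Z \<times> V" and v: "v \<in> {1..<int q} \<times> Z \<times> V" and e: "?f u = ?f v"
    obtain D F t where ue: "u = (D, F, t)" by (cases u)
    obtain D' F' t' where ve: "v = (D', F', t')" by (cases v)
    have h: "D \<in> {1..<int q}" "F \<in> Z" "t \<in> V" "D' \<in> {1..<int q}" "F' \<in> Z" "t' \<in> V" and eq: "aut D F t = aut D' F' t'"
      using u v e by (simp_all add: ue ve)
    have "[D = D'] (mod int q) \<and> [F = F'] (mod int q) \<and> [t = t'] (mod M)"
      using eq aut_eq[of F F' D t D' t'] Z0 h by blast
    then show "u = v"
      unfolding ue ve using h Zl[OF h(2)] Zl[OF h(5)] by (simp add: cong_def V_def del: of_nat_power)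
  qed
  have img: "?f ` ({1..<int q} \<times> Z \<times> V) = auto N"
  proof (intro equalityI subsetI)
    fix \<zeta> assume "\<zeta> \<in> ?f ` ({1..<int q} \<times> Z \<times> V)"
    then obtain D F t where h: "D \<in> {1..<int q}" "t \<in> V" "\<zeta> = aut D F t" by auto
    have "\<not> int q dvd D" using h(1) zdvd_not_zless by auto
    then show "\<zeta> \<in> auto N" using h aut_auto by (simp add: valid_def V_def)
  next
    fix \<zeta> assume "\<zeta> \<in> auto N"
    then obtain D F t where h: "valid D t" "b = 0 \<longrightarrow> F = 0" "\<zeta> = aut D F t" using auto_is_aut by blast
    have "D mod int q \<in> {1..<int q}"
      using h(1) q_pos pos_mod_bound[of "int q" D] pos_mod_sign[of "int q" D] by (auto simp: valid_def dvd_eq_mod_eq_0 order.order_iff_strict)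
    moreover have "F mod int q \<in> Z" using h(2) q_pos by (simp add: Z_def)
    moreover have "t mod M \<in> V"
    proof -
      have "[t mod M = t] (mod int (p ^ b))"
        using cong_dvd_modulus[OF cong_mod_self] le_imp_power_dvd[OF b, of p] by (simp only: int_dvd_int_iff)
      then have "[t mod M = 1] (mod int (p ^ b))" using h(1) cong_trans by (auto simp only: valid_def)
      then show ?thesis using h(1) M_pos coprime_cong_p[OF cong_p[OF cong_mod_self]] by (simp add: V_def valid_def del: of_nat_power)
    qed
    moreover have "\<zeta> = ?f (D mod int q, F mod int q, t mod M)"
      unfolding h(3) by (simp only: prod.case) (intro aut_cong cong_sym[OF cong_mod_self])
    ultimately show "\<zeta> \<in> ?f ` ({1..<int q} \<times> Z \<times> V)" by blast
  qed
  have "card (auto N) = card ({1..<int q} \<times> Z \<times> V)"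
    unfolding img[symmetric] by (rule card_image[OF inj])
  also have "\<dots> = (q - 1) * (card Z * card V)"
  proof -
    have "nat (int q - 1) = q - 1" by linarith
    then show ?thesis by (simp add: card_cartesian_product)
  qed
  also have "card V = (if b = 0 then totient (p ^ n) else p ^ (n - b))"
  proof (cases "b = 0")
    case True
    then have "V = units" by (simp add: V_def units_def)
    then show ?thesis using True by (simp add: card_units)
  next
    case False
    have "coprime t (int p)" if "[t = 1] (mod int (p ^ b))" for t
      using coprime_cong_p[OF cong_p_of_cong_pb[OF False that]] by simp
    then have "V = {s \<in> {0..<M}. [s = 1] (mod int (p ^ b))}"
      unfolding V_def by blast
    then show ?thesis using False by (simp only: card_class[OF b] if_False)
  qed
  finally show ?thesis by (simp add: Z_def)
qed

end

context metacyclic_pair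
begin

text \<open>The range of a coordinate \<open>B\<close> or \<open>F\<close> that
  \<open>admissible\<close> sets to zero in the exceptional case \<open>c\<close>.\<close>

definition box where "box c = {x \<in> {0..<int q}. c \<longrightarrow> x = 0}"

lemma card_box: "card (box c) = (if c then 1 else q)"
proof -
  have "box c = (if c then {0} else {0..<int q})" using N.q_pos by (auto simp: box_def)
  then show ?thesis by simp
qed

lemma box_mod: "(c \<Longrightarrow> [x = 0] (mod int q)) \<Longrightarrow> x mod int q \<in> box c"
  using N.q_pos by (simp add: box_def cong_def)

lemma nonzero_mod: "\<not> [x = 0] (mod int q) \<Longrightarrow> x mod int q \<in> {1..<int q}"
  using N.q_pos pos_mod_bound[of "int q" x] pos_mod_sign[of "int q" x] by (auto simp: cong_def order.order_iff_strict)

lemma nonzero_cong: "x \<in> {1..<int q} \<Longrightarrow> \<not> [x = 0] (mod int q)"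
  by (auto simp: cong_def)

text \<open>Together the congruences are one modulo \<open>p ^ max b 1\<close>; for
  \<open>b = 0\<close> it is the regularity condition modulo \<open>p\<close> that counts.\<close>

definition unip where "unip = {t \<in> {0..<N.M}. [t = 1] (mod int p) \<and> [t = 1] (mod int (p ^ b))}"

lemma unip_mod: "[t = 1] (mod int p) \<Longrightarrow> [t = 1] (mod int (p ^ b)) \<Longrightarrow> t mod N.M \<in> unip"
proof -
  assume t: "[t = 1] (mod int p)" "[t = 1] (mod int (p ^ b))"
  have "[t mod N.M = t] (mod int (p ^ b))"
    using cong_dvd_modulus[OF cong_mod_self] le_imp_power_dvd[OF N.b, of p] by (simp only: int_dvd_int_iff)
  then have "[t mod N.M = 1] (mod int (p ^ b))" by (rule cong_trans[OF _ t(2)])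
  moreover have "[t mod N.M = 1] (mod int p)" by (rule cong_trans[OF N.cong_p[OF cong_mod_self] t(1)])
  ultimately show ?thesis using N.M_pos by (simp add: unip_def del: of_nat_power)
qed

lemma finite_box: "finite (box c)"
  by (rule finite_subset[of _ "{0..<int q}"]) (auto simp: box_def)

lemma finite_unip: "finite unip"
  by (rule finite_subset[of _ "{0..<N.M}"]) (auto simp: unip_def)

lemma card_unip: "card unip = p ^ (n - max b 1)"
proof -
  have "[t = 1] (mod int p) \<and> [t = 1] (mod int (p ^ b)) \<longleftrightarrow> [t = 1] (mod int (p ^ max b 1))" for t
  proof (cases "b = 0")
    case False
    then have "max b 1 = b" by simp
    then show ?thesis using N.cong_p_of_cong_pb[OF False, of t 1] by (simp only:) blast
  qed simp
  then have "unip = {t \<in> {0..<N.M}. [t = 1] (mod int (p ^ max b 1))}" by (simp only: unip_def)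
  moreover have "max b 1 \<le> n" using N.b N.n by simp
  ultimately show ?thesis by (simp only: N.card_class)
qed

text \<open>The components are \<open>s\<close>, \<open>B\<close>, \<open>F\<close>,
  \<open>t\<close> and the nonzero one of \<open>y\<close> and \<open>f\<close>. Only the ranges of
  \<open>B\<close> and \<open>F\<close> may depend on \<open>s\<close>.\<close>

definition params where
  "params \<alpha> \<beta> = (SIGMA s : N.units. box (\<alpha> s) \<times> box (\<beta> s) \<times> unip \<times> {1..<int q})"

lemma finite_params: "finite (params \<alpha> \<beta>)"
  unfolding params_def by (intro finite_SigmaI N.finite_units finite_box finite_unip finite_atLeastLessThan_int)

lemma card_params:
  "card (params \<alpha> \<beta>) = (\<Sum>s\<in>N.units. (if \<alpha> s then 1 else q) * (if \<beta> s then 1 else q)) * (p ^ (n - max b 1) * (q - 1))"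
proof -
  have "card (params \<alpha> \<beta>) = (\<Sum>s\<in>N.units. (if \<alpha> s then 1 else q) * ((if \<beta> s then 1 else q) * (p ^ (n - max b 1) * (q - 1))))"
  proof -
    have "card {1..<int q} = q - 1" by simp
    moreover have "finite (box (\<alpha> s) \<times> box (\<beta> s) \<times> unip \<times> {1..<int q})" for s
      by (intro finite_SigmaI finite_box finite_unip finite_atLeastLessThan_int)
    ultimately show ?thesis
      unfolding params_def
      by (subst card_SigmaI[OF N.finite_units]) (intro ballI, assumption, simp only: card_cartesian_product card_box card_unip)
  qed
  then show ?thesis by (simp add: sum_distrib_right mult.assoc)
qed

abbreviation k where "k \<equiv> int G.\<kappa>"

text \<open>\<open>D\<close> is no parameter, since the eigenvalue condition determines it: in the
  family with \<open>y\<close> nonzero, \<open>D * K s = k\<close> gives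
  \<open>D = k * K (- s)\<close>.\<close>

definition pairI where
  "pairI = (\<lambda>(s, B, F, t, y). (N.hol B s (k * K (- s)) F t, N.hol y 0 1 0 1))"

definition pairII where
  "pairII = (\<lambda>(s, B, F, t, f). (N.hol B s k F t, N.hol 0 0 1 f 1))"

text \<open>The exceptional cases \<open>D * K s = 1\<close> and \<open>D = 1\<close>, after
  substituting \<open>D = k * K (- s)\<close>; \<open>b = 0\<close> is the normalisation of
  \<open>F\<close>.\<close>

definition "paramsI = params (\<lambda>s. [k = 1] (mod int q)) (\<lambda>s. b = 0 \<or> [K s = k] (mod int q))"

text \<open>The same two exceptional cases for \<open>D = k\<close>.\<close>

definition "paramsII = params (\<lambda>s. [k * K s = 1] (mod int q)) (\<lambda>s. [k = 1] (mod int q))"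

lemma k_not_dvd: "\<not> int q dvd k"
  using G.K_not_dvd[of 1] cong_dvd_iff[OF G.\<kappa>] by simp

lemma mult_K_cong_iff: "[D * K s = c] (mod int q) \<longleftrightarrow> [D = c * K (- s)] (mod int q)"
proof
  assume a: "[D * K s = c] (mod int q)"
  have "[D * (K s * K (- s)) = D * 1] (mod int q)" by (rule cong_mult[OF cong_refl N.K_unit])
  moreover have "[D * K s * K (- s) = c * K (- s)] (mod int q)" by (rule cong_mult[OF a cong_refl])
  ultimately show "[D = c * K (- s)] (mod int q)" using cong_trans cong_sym by (simp add: mult.assoc) blast
next
  assume a: "[D = c * K (- s)] (mod int q)"
  have "[c * (K s * K (- s)) = c * 1] (mod int q)" by (rule cong_mult[OF cong_refl N.K_unit])
  moreover have "[D * K s = c * K (- s) * K s] (mod int q)" by (rule cong_mult[OF a cong_refl])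
  ultimately show "[D * K s = c] (mod int q)" using cong_trans by (simp add: mult_ac) blast
qed

lemma k_mult_K_minus_cong_1_iff: "[k * K (- s) = 1] (mod int q) \<longleftrightarrow> [K s = k] (mod int q)"
  using mult_K_cong_iff[of 1 s k] by (simp add: cong_sym_eq)

lemma valid_unip: "t \<in> unip \<Longrightarrow> \<not> int q dvd D \<Longrightarrow> N.valid D t"
  using N.coprime_cong_p[of t 1] by (simp add: N.valid_def unip_def)

lemma regular_pairs_eq:
  "{(S, T). regular_pair S T} = pairI ` paramsI \<union> (if b = 0 then {} else pairII ` paramsII)" (is "?R = ?P")
proof (intro equalityI subsetI)
  fix x assume "x \<in> ?R"
  then obtain S T where x: "x = (S, T)" "regular_pair S T" by auto
  then obtain B s D F t y f where g: "admissible B s D F t y f" and S: "S = N.hol B s D F t" and T: "T = N.hol y 0 1 f 1"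
    using regular_pair_admissible by blast
  have v: "N.valid D t" and bf: "b = 0 \<Longrightarrow> F = 0" and cs: "coprime s (int p)" and t1: "[t = 1] (mod int p)"
    and AB: "[D * K s = 1] (mod int q) \<Longrightarrow> [B = 0] (mod int q)" and DF: "[D = 1] (mod int q) \<Longrightarrow> [F = 0] (mod int q)"
    using g[unfolded admissible_def] by simp_all
  have tu: "t mod N.M \<in> unip" using unip_mod[OF t1] v by (simp only: N.valid_def)
  have su: "s mod N.M \<in> N.units"
    using cs N.M_pos N.coprime_cong_p[OF N.cong_p[OF cong_mod_self]] by (simp add: N.units_def del: of_nat_power)
  have Ks: "[K (s mod N.M) = K s] (mod int q)" "[K (- (s mod N.M)) = K (- s)] (mod int q)"
    by (rule N.K_cong[OF cong_mod_self]) (rule N.K_cong, simp add: cong_minus_minus_iff cong_mod_self del: of_nat_power)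
  have "([f = 0] (mod int q) \<and> \<not> [y = 0] (mod int q) \<and> [D * K s = k] (mod int q)) \<or>
      (b \<noteq> 0 \<and> [y = 0] (mod int q) \<and> \<not> [f = 0] (mod int q) \<and> [D = k] (mod int q))"
    using g[unfolded admissible_def] by blast
  then show "x \<in> ?P"
  proof
    assume h: "[f = 0] (mod int q) \<and> \<not> [y = 0] (mod int q) \<and> [D * K s = k] (mod int q)"
    have D: "[D = k * K (- s)] (mod int q)" using h by (simp only: mult_K_cong_iff)
    have "[k = 1] (mod int q) \<Longrightarrow> [B = 0] (mod int q)" using AB h cong_trans by blast
    then have B: "B mod int q \<in> box ([k = 1] (mod int q))" by (rule box_mod)
    have "[F = 0] (mod int q)" if a: "b = 0 \<or> [K (s mod N.M) = k] (mod int q)"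
    proof (cases "b = 0")
      case False
      then have "[K s = k] (mod int q)" using a cong_trans[OF cong_sym[OF Ks(1)]] by blast
      then show ?thesis using DF cong_trans[OF D] k_mult_K_minus_cong_1_iff by blast
    qed (use bf in simp)
    then have F: "F mod int q \<in> box (b = 0 \<or> [K (s mod N.M) = k] (mod int q))" by (rule box_mod)
    have "(s mod N.M, B mod int q, F mod int q, t mod N.M, y mod int q) \<in> paramsI"
      unfolding paramsI_def params_def using h by (intro SigmaI su B F tu nonzero_mod) simp
    then have "pairI (s mod N.M, B mod int q, F mod int q, t mod N.M, y mod int q) \<in> pairI ` paramsI" by (rule imageI)
    moreover have "S = N.hol (B mod int q) (s mod N.M) (k * K (- (s mod N.M))) (F mod int q) (t mod N.M)"
      unfolding S by (intro N.hol_cong cong_sym[OF cong_mod_self] cong_trans[OF D cong_sym[OF cong_mult[OF cong_refl Ks(2)]]])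
    moreover have "T = N.hol (y mod int q) 0 1 0 1"
      unfolding T by (intro N.hol_cong cong_sym[OF cong_mod_self] cong_refl conjunct1[OF h])
    ultimately have "x \<in> pairI ` paramsI" by (simp only: x(1) pairI_def prod.case)
    then show ?thesis by blast
  next
    assume h: "b \<noteq> 0 \<and> [y = 0] (mod int q) \<and> \<not> [f = 0] (mod int q) \<and> [D = k] (mod int q)"
    then have D: "[D = k] (mod int q)" by blast
    have "[B = 0] (mod int q)" if a: "[k * K (s mod N.M) = 1] (mod int q)"
      by (rule AB) (rule cong_trans[OF cong_mult[OF D cong_sym[OF Ks(1)]] a])
    then have B: "B mod int q \<in> box ([k * K (s mod N.M) = 1] (mod int q))" by (rule box_mod)
    have "[k = 1] (mod int q) \<Longrightarrow> [F = 0] (mod int q)" by (rule DF[OF cong_trans[OF D]])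
    then have F: "F mod int q \<in> box ([k = 1] (mod int q))" by (rule box_mod)
    have "(s mod N.M, B mod int q, F mod int q, t mod N.M, f mod int q) \<in> paramsII"
      unfolding paramsII_def params_def using h by (intro SigmaI su B F tu nonzero_mod) simp
    then have "pairII (s mod N.M, B mod int q, F mod int q, t mod N.M, f mod int q) \<in> pairII ` paramsII" by (rule imageI)
    moreover have "S = N.hol (B mod int q) (s mod N.M) k (F mod int q) (t mod N.M)"
      unfolding S by (intro N.hol_cong cong_sym[OF cong_mod_self] D)
    moreover have "T = N.hol 0 0 1 (f mod int q) 1"
      unfolding T by (rule N.hol_cong) (use h in \<open>simp_all add: cong_sym[OF cong_mod_self]\<close>)
    ultimately have "x \<in> pairII ` paramsII" by (simp only: x(1) pairII_def prod.case)
    then show ?thesis using h by simp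
  qed
next
  fix x assume "x \<in> ?P"
  then have "x \<in> pairI ` paramsI \<or> (b \<noteq> 0 \<and> x \<in> pairII ` paramsII)" by (auto split: if_splits)
  then show "x \<in> ?R"
  proof
    assume "x \<in> pairI ` paramsI"
    then obtain u where u: "u \<in> paramsI" "x = pairI u" by blast
    obtain s B F t y where ue: "u = (s, B, F, t, y)" by (cases u)
    have x: "x = (N.hol B s (k * K (- s)) F t, N.hol y 0 1 0 1)" and
      h: "s \<in> N.units" "B \<in> box ([k = 1] (mod int q))" "F \<in> box (b = 0 \<or> [K s = k] (mod int q))" "t \<in> unip" "y \<in> {1..<int q}"
      using u by (simp_all add: ue paramsI_def params_def pairI_def)
    have nz: "\<not> int q dvd k * K (- s)" using k_not_dvd N.K_not_dvd prime_dvd_mult_iff[OF N.prime_q] by blast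
    have e: "[k * K (- s) * K s = k] (mod int q)" by (simp only: mult_K_cong_iff cong_refl)
    have "admissible B s (k * K (- s)) F t y 0"
      unfolding admissible_def k_mult_K_minus_cong_1_iff
    proof (intro conjI impI valid_unip h(4) nz disjI1 e nonzero_cong h(5))
      show "coprime s (int p)" using h(1) by (simp add: N.units_def)
      show "[t = 1] (mod int p)" using h(4) by (simp add: unip_def)
      assume "[k * K (- s) * K s = 1] (mod int q)"
      then have "[k = 1] (mod int q)" by (rule cong_trans[OF cong_sym[OF e]])
      then show "[B = 0] (mod int q)" using h(2) by (simp add: box_def)
    qed (use h(3) in \<open>simp_all add: box_def\<close>)
    then show "x \<in> ?R" using admissible_regular_pair x by blast
  next
    assume b: "b \<noteq> 0 \<and> x \<in> pairII ` paramsII"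
    then obtain u where u: "u \<in> paramsII" "x = pairII u" by blast
    obtain s B F t f where ue: "u = (s, B, F, t, f)" by (cases u)
    have x: "x = (N.hol B s k F t, N.hol 0 0 1 f 1)" and
      h: "s \<in> N.units" "B \<in> box ([k * K s = 1] (mod int q))" "F \<in> box ([k = 1] (mod int q))" "t \<in> unip" "f \<in> {1..<int q}"
      using u by (simp_all add: ue paramsII_def params_def pairII_def)
    have "admissible B s k F t 0 f"
      unfolding admissible_def
    proof (intro conjI impI valid_unip h(4) k_not_dvd disjI2 cong_refl nonzero_cong h(5))
      show "coprime s (int p)" using h(1) by (simp add: N.units_def)
      show "[t = 1] (mod int p)" using h(4) by (simp add: unip_def)
    qed (use b h in \<open>simp_all add: box_def\<close>)
    then show "x \<in> ?R" using admissible_regular_pair x by blast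
  qed
qed

lemma box_eq: "x \<in> box c \<Longrightarrow> y \<in> box d \<Longrightarrow> [x = y] (mod int q) \<Longrightarrow> x = y"
  by (simp add: box_def cong_def)

lemma unip_eq: "x \<in> unip \<Longrightarrow> y \<in> unip \<Longrightarrow> [x = y] (mod N.M) \<Longrightarrow> x = y"
  by (simp add: unip_def cong_def del: of_nat_power)

lemma units_eq: "x \<in> N.units \<Longrightarrow> y \<in> N.units \<Longrightarrow> [x = y] (mod N.M) \<Longrightarrow> x = y"
  by (simp add: N.units_def cong_def del: of_nat_power)

lemma nonzero_eq: "x \<in> {1..<int q} \<Longrightarrow> y \<in> {1..<int q} \<Longrightarrow> [x = y] (mod int q) \<Longrightarrow> x = y"
  by (simp add: cong_def)

lemma inj_pairI: "inj_on pairI paramsI"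
proof (rule inj_onI)
  fix u v assume u: "u \<in> paramsI" and v: "v \<in> paramsI" and eq: "pairI u = pairI v"
  obtain s B F t y where ue: "u = (s, B, F, t, y)" by (cases u)
  obtain s' B' F' t' y' where ve: "v = (s', B', F', t', y')" by (cases v)
  have h: "s \<in> N.units" "B \<in> box ([k = 1] (mod int q))" "F \<in> box (b = 0 \<or> [K s = k] (mod int q))" "t \<in> unip" "y \<in> {1..<int q}"
    using u by (simp_all add: ue paramsI_def params_def)
  have h': "s' \<in> N.units" "B' \<in> box ([k = 1] (mod int q))" "F' \<in> box (b = 0 \<or> [K s' = k] (mod int q))" "t' \<in> unip" "y' \<in> {1..<int q}"
    using v by (simp_all add: ve paramsI_def params_def)
  have e: "N.hol B s (k * K (- s)) F t = N.hol B' s' (k * K (- s')) F' t'" "N.hol y 0 1 0 1 = N.hol y' 0 1 0 1"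
    using eq by (simp_all add: ue ve pairI_def)
  have b0: "b = 0 \<Longrightarrow> F = 0 \<and> F' = 0" using h(3) h'(3) by (simp add: box_def)
  note c = N.hol_eq[OF b0 e(1)]
  have "[y = y'] (mod int q)" by (rule N.hol_eq(1)[OF _ e(2)]) simp
  then show "u = v"
    unfolding ue ve using units_eq[OF h(1) h'(1)] box_eq[OF h(2) h'(2)] box_eq[OF h(3) h'(3)] unip_eq[OF h(4) h'(4)]
      nonzero_eq[OF h(5) h'(5)] c by simp
qed

lemma inj_pairII:
  assumes "b \<noteq> 0" shows "inj_on pairII paramsII"
proof (rule inj_onI)
  fix u v assume u: "u \<in> paramsII" and v: "v \<in> paramsII" and eq: "pairII u = pairII v"
  obtain s B F t y where ue: "u = (s, B, F, t, y)" by (cases u)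
  obtain s' B' F' t' y' where ve: "v = (s', B', F', t', y')" by (cases v)
  have h: "s \<in> N.units" "B \<in> box ([k * K s = 1] (mod int q))" "F \<in> box ([k = 1] (mod int q))" "t \<in> unip" "y \<in> {1..<int q}"
    using u by (simp_all add: ue paramsII_def params_def)
  have h': "s' \<in> N.units" "B' \<in> box ([k * K s' = 1] (mod int q))" "F' \<in> box ([k = 1] (mod int q))" "t' \<in> unip" "y' \<in> {1..<int q}"
    using v by (simp_all add: ve paramsII_def params_def)
  have e: "N.hol B s k F t = N.hol B' s' k F' t'" "N.hol 0 0 1 y 1 = N.hol 0 0 1 y' 1"
    using eq by (simp_all add: ue ve pairII_def)
  have b0: "b = 0 \<Longrightarrow> c = 0 \<and> d = 0" for c d :: int using assms by simp
  note c = N.hol_eq[OF b0 e(1)] N.hol_eq(4)[OF b0 e(2)]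
  show "u = v"
    unfolding ue ve using units_eq[OF h(1) h'(1)] box_eq[OF h(2) h'(2)] box_eq[OF h(3) h'(3)] unip_eq[OF h(4) h'(4)]
      nonzero_eq[OF h(5) h'(5)] c by simp
qed

text \<open>The second entry decides: its coordinate \<open>y\<close> is nonzero in the first family
  and zero in the other.\<close>

lemma disjoint_pairs:
  assumes "b \<noteq> 0" shows "pairI ` paramsI \<inter> pairII ` paramsII = {}"
proof (rule equals0I)
  fix x assume "x \<in> pairI ` paramsI \<inter> pairII ` paramsII"
  then have 1: "x \<in> pairI ` paramsI" and 2: "x \<in> pairII ` paramsII" by blast+
  obtain y where y: "y \<in> {1..<int q}" "snd x = N.hol y 0 1 0 1" using 1 by (auto simp: pairI_def paramsI_def params_def)
  obtain f where f: "snd x = N.hol 0 0 1 f 1" using 2 by (auto simp: pairII_def)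
  have "[y = 0] (mod int q)" by (rule N.hol_eq(1)[of 0 f y 0 1 1 0 0 1 1]) (use assms y f in simp_all)
  then show False using nonzero_cong[OF y(1)] by simp
qed

lemma card_regular_embeddings_params:
  "card (regular_embeddings G N) = card paramsI + (if b = 0 then 0 else card paramsII)"
proof (cases "b = 0")
  case True
  then show ?thesis
    unfolding card_regular_embeddings_eq regular_pairs_eq if_P[OF True] Un_empty_right card_image[OF inj_pairI] by simp
next
  case False
  have "card (pairI ` paramsI \<union> pairII ` paramsII) = card (pairI ` paramsI) + card (pairII ` paramsII)"
    by (rule card_Un_disjoint) (simp_all add: paramsI_def paramsII_def finite_params disjoint_pairs[OF False, unfolded paramsI_def paramsII_def])
  then show ?thesis
    unfolding card_regular_embeddings_eq regular_pairs_eq using False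
    by (simp add: card_image[OF inj_pairI] card_image[OF inj_pairII])
qed

lemma k_cong_1_iff: "[k = 1] (mod int q) \<longleftrightarrow> bG = 0"
proof -
  have "[k = 1] (mod int q) \<longleftrightarrow> [KG 1 = KG 0] (mod int q)"
    using cong_trans[OF G.\<kappa>] cong_trans[OF cong_sym[OF G.\<kappa>]] cong_trans[OF _ G.K_zero] cong_trans[OF _ cong_sym[OF G.K_zero]] by blast
  then show ?thesis
    unfolding G.K_eq using one_less_power[OF prime_gt_1_nat[OF N.p(1)], of bG]
    by (cases "bG = 0") (auto simp: cong_iff_dvd_diff of_nat_power[symmetric] simp del: of_nat_power)
qed

end

section \<open>The cardinalities for each kind of pair\<close>

lemma sum_if_one:
  assumes "finite A"
  shows "(\<Sum>s\<in>A. if P s then 1 else c :: nat) = card {s \<in> A. P s} + (card A - card {s \<in> A. P s}) * c"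
proof -
  have "A \<inter> - {s. P s} = A - {s \<in> A. P s}" "A \<inter> {s. P s} = {s \<in> A. P s}" by auto
  then show ?thesis
    using assms by (simp add: sum.If_cases card_Diff_subset)
qed

context metacyclic_pair
begin

text \<open>The characters \<open>K (m * s)\<close> and \<open>KG m\<close> agree for all natural
  \<open>m\<close>. Since \<open>s\<close> is a unit, comparing the \<open>m\<close> where they are
  trivial yields mutual divisibility of \<open>p ^ b\<close> and \<open>p ^ bG\<close>.\<close>

lemma same_exponent:
  assumes s: "coprime s (int p)" and e: "[K s = k] (mod int q)"
  shows "bG = b"
proof -
  have i: "[int m * s = 0] (mod int (p ^ b)) \<longleftrightarrow> [int m = 0] (mod int (p ^ bG))" for m
  proof -
    have "[K (int m * s) = KG (int m)] (mod int q)"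
      using cong_trans[OF N.K_pow cong_trans[OF cong_pow[OF e]]] G.\<kappa>_pow[of m] by simp
    then have "[K (int m * s) = K 0] (mod int q) \<longleftrightarrow> [KG (int m) = KG 0] (mod int q)"
      using cong_trans[OF N.K_zero cong_sym[OF G.K_zero]] cong_trans cong_sym by meson
    then show ?thesis by (simp only: N.K_eq G.K_eq)
  qed
  have "p ^ bG dvd p ^ b"
    using i[of "p ^ b"] by (simp add: cong_0_iff flip: of_nat_power int_dvd_int_iff)
  moreover have "int (p ^ b) dvd int (p ^ bG) * s"
    using i[of "p ^ bG"] by (simp only: cong_0_iff dvd_refl simp_thms)
  then have "int (p ^ b) dvd int (p ^ bG)" using s by (simp add: coprime_dvd_mult_left_iff coprime_commute)
  then have "p ^ b dvd p ^ bG" by (simp only: int_dvd_int_iff)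
  ultimately have "p ^ bG = p ^ b" by (rule dvd_antisym)
  then show ?thesis using prime_gt_1_nat[OF N.p(1)] by simp
qed

lemma k_mult_K_cong_1_iff: "[k * K s = 1] (mod int q) \<longleftrightarrow> [K (- s) = k] (mod int q)"
  using k_mult_K_minus_cong_1_iff[of "- s"] by simp

text \<open>Only the first family exists here; \<open>F\<close> is normalised to zero, while
  \<open>B\<close> is free because \<open>k\<close> is not 1.\<close>

lemma card_regular_embeddings_cyclic:
  assumes "b = 0" "bG \<noteq> 0"
  shows "card (regular_embeddings G N) = q * totient (p ^ n) * (p ^ (n - 1) * (q - 1))"
  unfolding card_regular_embeddings_params paramsI_def card_params
  using assms by (simp add: k_cong_1_iff N.card_units)

text \<open>With different exponents no unit \<open>s\<close> is exceptional, so the two families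
  have equal size. For \<open>bG = 0\<close> one has \<open>k = 1\<close>, which costs a factor
  \<open>q\<close> in each.\<close>

lemma card_regular_embeddings_ne:
  assumes "b \<noteq> 0" "bG \<noteq> b"
  shows "card (regular_embeddings G N) =
    2 * (totient (p ^ n) * ((if bG = 0 then 1 else q) * q) * (p ^ (n - b) * (q - 1)))"
proof -
  have "\<not> [K s = k] (mod int q)" "\<not> [k * K s = 1] (mod int q)" if "s \<in> N.units" for s
    using that same_exponent[of s] same_exponent[of "- s"] assms(2) unfolding k_mult_K_cong_1_iff N.units_def by auto
  then have 1: "card paramsI = (\<Sum>s\<in>N.units. (if bG = 0 then 1 else q) * q) * (p ^ (n - max b 1) * (q - 1))"
    and 2: "card paramsII = (\<Sum>s\<in>N.units. q * (if bG = 0 then 1 else q)) * (p ^ (n - max b 1) * (q - 1))"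
    unfolding paramsI_def paramsII_def card_params k_cong_1_iff using assms(1) by simp_all
  have "max b 1 = b" using assms(1) by simp
  then show ?thesis
    unfolding card_regular_embeddings_params 1 2 using assms(1) by (simp add: N.card_units)
qed

end

context metacyclic
begin

text \<open>The exceptional \<open>s\<close> are those congruent to 1 modulo \<open>p ^ b\<close> in
  the first family and to -1 in the second. Each of these \<open>p ^ (n - b)\<close> units loses a
  factor \<open>q\<close>.\<close>

lemma card_regular_embeddings_self:
  assumes "b \<noteq> 0"
  shows "card (regular_embeddings N N) =
    2 * (q * (p ^ (n - b) + (totient (p ^ n) - p ^ (n - b)) * q) * (p ^ (n - b) * (q - 1)))"
proof -
  interpret metacyclic_pair p n q b K N b K N by unfold_locales
  have c1: "card {s \<in> units. [K s = k] (mod int q)} = p ^ (n - b)"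
  proof -
    have "[K s = k] (mod int q) \<longleftrightarrow> [K s = K 1] (mod int q)" for s
      using cong_trans[OF _ \<kappa>] cong_trans[OF _ cong_sym[OF \<kappa>]] by blast
    then show ?thesis using card_units_K[OF assms, of 1] by simp
  qed
  have c2: "card {s \<in> units. [k * K s = 1] (mod int q)} = p ^ (n - b)"
  proof -
    have "[k * K s = 1] (mod int q) \<longleftrightarrow> [K s = K (- 1)] (mod int q)" for s
    proof -
      have "[K (- s) = k] (mod int q) \<longleftrightarrow> [K (- s) = K 1] (mod int q)"
        using cong_trans[OF _ \<kappa>] cong_trans[OF _ cong_sym[OF \<kappa>]] by blast
      also have "\<dots> \<longleftrightarrow> [K s = K (- 1)] (mod int q)"
        unfolding K_eq using cong_minus_minus_iff[of s "- 1" "int (p ^ b)"] by simp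
      finally show ?thesis unfolding k_mult_K_cong_1_iff .
    qed
    then show ?thesis using card_units_K[OF assms, of "- 1"] by simp
  qed
  have m: "max b 1 = b" using assms by simp
  have 1: "card paramsI = q * (p ^ (n - b) + (totient (p ^ n) - p ^ (n - b)) * q) * (p ^ (n - b) * (q - 1))"
    unfolding paramsI_def card_params m k_cong_1_iff using assms
    by (simp add: sum_distrib_left[symmetric] sum_if_one[OF finite_units] c1 card_units)
  have 2: "card paramsII = q * (p ^ (n - b) + (totient (p ^ n) - p ^ (n - b)) * q) * (p ^ (n - b) * (q - 1))"
    unfolding paramsII_def card_params m k_cong_1_iff using assms
    by (simp add: sum_distrib_right[symmetric] sum_if_one[OF finite_units] c2 card_units)
  show ?thesis unfolding card_regular_embeddings_params 1 2 using assms by simp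
qed

end

section \<open>The groups $G_b$ and $C$\<close>

text \<open>Turns the hypothesis on the size of the image of an action into its exact kernel:
  \<open>g\<close> takes equal values precisely at arguments congruent modulo the least positive
  period, and one period lists each value once.\<close>

lemma periodic_cong_card:
  fixes g :: "int \<Rightarrow> 'a"
  assumes eq: "\<And>i j. g i = g j \<longleftrightarrow> g (i - j) = g 0" and M: "g (int M) = g 0" "M > 0"
  shows "g i = g j \<longleftrightarrow> [i = j] (mod int (card (g ` {0..<int M})))"
proof -
  define r where "r = (LEAST r. r > 0 \<and> g (int r) = g 0)"
  have r: "r > 0" "g (int r) = g 0"
    using LeastI[of "\<lambda>r. r > 0 \<and> g (int r) = g 0" M] M by (simp_all add: r_def)
  have least: "r \<le> m" if "m > 0" "g (int m) = g 0" for m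
    unfolding r_def by (rule Least_le) (use that in simp)
  have mult: "g (int r * c) = g 0" for c
  proof (induction c rule: int_induct[where k = 0])
    case (step1 c)
    then show ?case using eq[of "int r * (c + 1)" "int r * c"] r(2) by (simp add: algebra_simps)
  next
    case (step2 c)
    then show ?case using eq[of "int r * c" "int r * (c - 1)"] r(2) by (simp add: algebra_simps)
  qed simp
  have red: "g (x mod int r) = g x" for x
  proof -
    have "x - x mod int r = int r * (x div int r)" by (simp add: minus_mod_eq_mult_div)
    then show ?thesis using eq[of x "x mod int r"] mult by simp
  qed
  have zero: "g x = g 0 \<longleftrightarrow> int r dvd x" for x
  proof
    assume "g x = g 0"
    then have e: "g (int (nat (x mod int r))) = g 0" using r(1) red[of x] by simp
    have "nat (x mod int r) < r" using r(1) by (simp add: nat_less_iff)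
    then have "nat (x mod int r) = 0" using least[OF _ e] by linarith
    then show "int r dvd x" using r(1) pos_mod_sign[of "int r" x] by (simp add: dvd_eq_mod_eq_0 del: pos_mod_sign)
  qed (use mult in \<open>auto elim: dvdE\<close>)
  have geq: "g x = g y \<longleftrightarrow> [x = y] (mod int r)" for x y
    unfolding eq[of x y] zero cong_iff_dvd_diff ..
  have "g ` {0..<int M} = g ` {0..<int r}"
  proof (intro equalityI image_subsetI)
    fix x
    have "x mod int r \<in> {0..<int r}" using r(1) by simp
    then show "g x \<in> g ` {0..<int r}" by (rule rev_image_eqI) (simp add: red)
  next
    fix x assume "x \<in> {0..<int r}"
    then show "g x \<in> g ` {0..<int M}" using least[OF M(2,1)] by auto
  qed
  moreover have "inj_on g {0..<int r}"
    by (rule inj_onI) (simp add: geq cong_def)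
  ultimately have "card (g ` {0..<int M}) = r" by (simp add: card_image)
  then show ?thesis using geq by simp
qed

lemma auto_integer_mod_group:
  assumes "q > 1" "\<zeta> \<in> auto (integer_mod_group q)" "x \<in> {0..<int q}"
  shows "\<zeta> x = \<zeta> 1 * x mod int q"
proof -
  have c: "carrier (integer_mod_group q) = {0..<int q}" using assms(1) by (simp add: carrier_integer_mod_group)
  have "\<zeta> (int m) = \<zeta> 1 * int m mod int q" if "m < q" for m
    using that
  proof (induction m)
    case 0
    then show ?case using auto_one[OF group_integer_mod_group assms(2)] by simp
  next
    case (Suc m)
    have "\<zeta> ((int m + 1) mod int q) = (\<zeta> (int m) + \<zeta> 1) mod int q"
      using auto_mult[OF assms(2), of "int m" 1] Suc.prems assms(1) by (simp add: c)
    then show ?case using Suc by (simp add: mod_simps algebra_simps)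
  qed
  from this[of "nat x"] show ?thesis using assms(3) by (simp add: nat_less_iff)
qed

text \<open>An automorphism of the cyclic group of order \<open>q\<close> is multiplication by its
  value at 1; this value is the scalar \<open>K i\<close>. Reduction modulo \<open>p ^ n\<close>
  extends it to all integers.\<close>

lemma metacyclic_semidirect:
  assumes p: "prime p" "odd p" and q: "prime q" and pq: "p < q" and n: "n \<ge> 1" and b: "b \<le> n"
    and hom: "\<theta> \<in> hom (integer_mod_group (p ^ n)) (AutoGroup (integer_mod_group q))"
    and card: "card (\<theta> ` carrier (integer_mod_group (p ^ n))) = p ^ b"
  shows "metacyclic p n q b (\<lambda>i. \<theta> (i mod int (p ^ n)) 1)
    (semidirect_product (integer_mod_group q) (integer_mod_group (p ^ n)) \<theta>)"
proof -
  let ?M = "int (p ^ n)"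
  let ?Q = "integer_mod_group q" and ?P = "integer_mod_group (p ^ n)"
  define g where "g i = \<theta> (i mod ?M)" for i
  have q1: "q > 1" by (rule prime_gt_1_nat[OF q])
  have p0: "p ^ n > 0" using p by (simp add: prime_gt_0_nat)
  have cQ: "carrier ?Q = {0..<int q}" using q1 by (simp add: carrier_integer_mod_group)
  have cP: "carrier ?P = {0..<?M}" 
    by (simp only: carrier_integer_mod_group if_not_P[OF not_sym[OF less_imp_neq[OF p0]]])
  have Min: "i mod ?M \<in> carrier ?P" for i using p0 by (simp add: cP del: of_nat_power)
  have au: "g i \<in> auto ?Q" for i
    using hom_in_carrier[OF hom Min] by (simp add: g_def)
  have gx: "g i x = g i 1 * x mod int q" if "x \<in> {0..<int q}" for i x
    by (rule auto_integer_mod_group[OF q1 au that])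
  have g1: "g i 1 \<in> {0..<int q}" for i
    using auto_closed[OF au, of 1] q1 by (simp add: cQ)
  have add: "[g (i + j) 1 = g i 1 * g j 1] (mod int q)" for i j
  proof -
    have "g (i + j) = g i \<otimes>\<^bsub>AutoGroup ?Q\<^esub> g j"
      using hom_mult[OF hom Min[of i] Min[of j]] by (simp only: g_def mult_integer_mod_group mod_add_eq)
    then have "g (i + j) 1 = g i (g j 1)"
      using q1 au by (simp add: mult_AutoGroup cQ compose_def)
    also have "\<dots> = g i 1 * g j 1 mod int q" by (rule gx[OF g1])
    finally show ?thesis by (simp add: cong_def)
  qed
  have zero: "[g 0 1 = 1] (mod int q)"
  proof -
    have "g 0 = \<one>\<^bsub>AutoGroup ?Q\<^esub>"
      using hom_one[OF hom group_integer_mod_group group.AutoGroup[OF group_integer_mod_group]] by (simp add: g_def)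
    then show ?thesis using q1 by (simp add: cQ)
  qed
  have eq1: "g i = g j \<longleftrightarrow> [g i 1 = g j 1] (mod int q)" for i j
  proof
    assume "[g i 1 = g j 1] (mod int q)"
    then have "g i 1 = g j 1" using g1[of i] g1[of j] by (simp add: cong_def)
    then show "g i = g j"
      using gx by (intro extensionalityI[OF auto_extensional[OF au] auto_extensional[OF au]]) (simp add: cQ)
  qed simp
  have eq: "g i = g j \<longleftrightarrow> g (i - j) = g 0" for i j
  proof -
    have e: "[g i 1 = g (i - j) 1 * g j 1] (mod int q)" using add[of "i - j" j] by simp
    have nz: "coprime (g j 1) (int q)"
    proof -
      have "[g j 1 * g (- j) 1 = 1] (mod int q)" using cong_trans[OF cong_sym[OF add[of j "- j"]]] zero by simp
      then show ?thesis using coprime_iff_invertible_int by blast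
    qed
    have "[g i 1 = g j 1] (mod int q) \<longleftrightarrow> [g (i - j) 1 * g j 1 = 1 * g j 1] (mod int q)"
      using cong_trans[OF e] cong_trans[OF cong_sym[OF e]] by auto
    also have "\<dots> \<longleftrightarrow> [g (i - j) 1 = 1] (mod int q)" using nz by (rule cong_mult_rcancel)
    also have "\<dots> \<longleftrightarrow> [g (i - j) 1 = g 0 1] (mod int q)" using zero cong_trans cong_sym by meson
    finally show ?thesis by (simp only: eq1)
  qed
  have img: "g ` {0..<?M} = \<theta> ` carrier ?P"
    unfolding cP g_def by (rule image_cong) simp_all
  have per: "g i = g j \<longleftrightarrow> [i = j] (mod int (p ^ b))" for i j
    unfolding card[symmetric] img[symmetric] by (rule periodic_cong_card[OF eq _ p0]) (simp add: g_def)
  show ?thesis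
  proof (rule metacyclic.intro, fold g_def)
    show "[g i 1 = g j 1] (mod int q) \<longleftrightarrow> [i = j] (mod int (p ^ b))" for i j
      using per eq1 by simp
    show "group (semidirect_product ?Q ?P \<theta>)"
      by (rule group_semidirect[OF group_integer_mod_group group_integer_mod_group hom])
    show "carrier (semidirect_product ?Q ?P \<theta>) = {0..<int q} \<times> {0..<?M}"
      by (simp only: carrier_semidirect cQ cP)
    show "(x, i) \<otimes>\<^bsub>semidirect_product ?Q ?P \<theta>\<^esub> (y, j) = ((x + g i 1 * y) mod int q, (i + j) mod ?M)"
      if "x \<in> {0..<int q}" "i \<in> {0..<?M}" "y \<in> {0..<int q}" "j \<in> {0..<?M}" for x i y j
    proof -
      have "\<theta> i y = g i 1 * y mod int q" using gx[OF that(3), of i] that(2) by (simp add: g_def)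
      then show ?thesis by (simp add: mod_add_right_eq)
    qed
  qed (fact assms add zero)+
qed

lemma metacyclic_cyclic:
  assumes p: "prime p" "odd p" and q: "prime q" and pq: "p < q" and n: "n \<ge> 1"
  shows "metacyclic p n q 0 (\<lambda>_. 1) (integer_mod_group q \<times>\<times> integer_mod_group (p ^ n))"
  by (intro metacyclic.intro DirProd_group group_integer_mod_group assms)
    (use prime_gt_0_nat[OF p(1)] prime_gt_0_nat[OF q] in \<open>simp_all add: carrier_integer_mod_group\<close>)

text \<open>Chinese remainder theorem, with surjectivity by comparing cardinalities.\<close>

lemma integer_mod_group_mult_iso:
  assumes "coprime m k" "m > 0" "k > 0"
  shows "integer_mod_group (k * m) \<cong> integer_mod_group m \<times>\<times> integer_mod_group k"
proof -
  let ?f = "\<lambda>x. (x mod int m, x mod int k)"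
  have c: "carrier (integer_mod_group m) = {0..<int m}" "carrier (integer_mod_group k) = {0..<int k}"
    "carrier (integer_mod_group (k * m)) = {0..<int (k * m)}"
    using assms by (simp_all add: carrier_integer_mod_group)
  have "?f \<in> hom (integer_mod_group (k * m)) (integer_mod_group m \<times>\<times> integer_mod_group k)"
    using assms by (intro homI) (simp_all add: c mod_mod_cancel mod_add_eq)
  moreover have "inj_on ?f {0..<int (k * m)}"
  proof (rule inj_onI)
    fix x y assume h: "x \<in> {0..<int (k * m)}" "y \<in> {0..<int (k * m)}" "?f x = ?f y"
    then have "[x = y] (mod int m * int k)"
      using assms(1) by (intro coprime_cong_mult) (simp_all add: cong_def)
    then show "x = y" using h(1,2) by (simp add: cong_def mult.commute)
  qed
  moreover have "?f ` {0..<int (k * m)} = {0..<int m} \<times> {0..<int k}"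
  proof (rule card_subset_eq)
    show "?f ` {0..<int (k * m)} \<subseteq> {0..<int m} \<times> {0..<int k}" using assms by auto
    show "card (?f ` {0..<int (k * m)}) = card ({0..<int m} \<times> {0..<int k})"
      unfolding card_image[OF \<open>inj_on ?f {0..<int (k * m)}\<close>] by (simp add: nat_mult_distrib)
  qed simp
  ultimately show ?thesis by (intro is_isoI isoI) (simp_all add: bij_betw_def c)
qed

text \<open>The Galois group is only isomorphic to \<open>G\<close>, so the number of embeddings has
  to be moved from one to the other.\<close>

lemma hopf_galois_count_embeddings:
  assumes gal: "galois_extension_with_group K G" and G: "group G" "finite (carrier G)" and N: "group N" "finite (carrier N)"
  shows "hopf_galois_count K N * card (auto N) = card (regular_embeddings G N)"
proof -
  have g: "finite_galois_extension K" and iso: "Gal K \<cong> G" using gal by (simp_all add: galois_extension_with_group_def)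
  have fin: "finite (carrier (Gal K))" using iso_finite[OF iso] G(2) by simp
  interpret finite_galois K by unfold_locales (fact g fin)+
  show ?thesis
    unfolding hopf_galois_count[OF N] by (rule card_regular_embeddings_cong_left[OF group_Gal G(1) fin N(2) iso])
qed

theorem theorem1p2:
  fixes n p q a :: nat
    and \<theta> :: "nat \<Rightarrow> int \<Rightarrow> int \<Rightarrow> int"
    and G :: "nat \<Rightarrow> (int \<times> int) monoid"
    and C :: "int monoid"
    and K :: "'l::field set"
  assumes "n \<ge> 1"
    and "prime p" and "odd p" and "prime q" and "odd q" and "p < q"
    and "p ^ a dvd q - 1" and "\<not> p ^ (a + 1) dvd q - 1"
    and "\<And>b. b \<in> {1..min n a} \<Longrightarrow>
           \<theta> b \<in> hom (integer_mod_group (p ^ n)) (AutoGroup (integer_mod_group q))"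
    and "\<And>b. b \<in> {1..min n a} \<Longrightarrow> card (\<theta> b ` carrier (integer_mod_group (p ^ n))) = p ^ b"
    and "\<And>b. b \<in> {1..min n a} \<Longrightarrow>
           G b = semidirect_product (integer_mod_group q) (integer_mod_group (p ^ n)) (\<theta> b)"
    and "C = integer_mod_group (p ^ n * q)"
  shows
    "(\<forall>b\<in>{1..min n a}.
        e' (G b) (G b) = 2 * (p ^ (n - b) + q * (totient (p ^ n) - p ^ (n - b))) \<and>
        (galois_extension_with_group K (G b) \<longrightarrow>
           hopf_galois_count K (G b) = 2 * (p ^ (n - b) + q * (totient (p ^ n) - p ^ (n - b))))) \<and>
     (\<forall>b1\<in>{1..min n a}. \<forall>b2\<in>{1..min n a}. b1 \<noteq> b2 \<longrightarrow>
        e' (G b1) (G b2) = 2 * q * p ^ (n + b1 - b2 - 1) * (p - 1) \<and>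
        (galois_extension_with_group K (G b1) \<longrightarrow>
           hopf_galois_count K (G b2) = 2 * q * p ^ (n - 1) * (p - 1))) \<and>
     (\<forall>b\<in>{1..min n a}.
        e' C (G b) = 2 * p ^ (n - b) * q \<and>
        (galois_extension_with_group K C \<longrightarrow>
           hopf_galois_count K (G b) = 2 * (p - 1) * p ^ (n - 1))) \<and>
     (\<forall>b\<in>{1..min n a}.
        e' (G b) C = p ^ (n + b - 2) * (p - 1) \<and>
        (galois_extension_with_group K (G b) \<longrightarrow>
           hopf_galois_count K C = p ^ (n - 1) * q))"
proof -
  note p = assms(2,3) and q = assms(4) and hom = assms(9) and card = assms(10) and G = assms(11) and C = assms(12)
  \<comment> \<open>The product form of \<open>C\<close> is the member \<open>b = 0\<close> of the
    metacyclic family; all counts are invariant under isomorphism.\<close>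
  define C' where "C' = integer_mod_group q \<times>\<times> integer_mod_group (p ^ n)"
  define \<kappa> where "\<kappa> b i = \<theta> b (i mod int (p ^ n)) 1" for b i
  let ?\<phi> = "totient (p ^ n)"
  have p0: "p > 0" and p1: "p > 1" and q1: "q > 1"
    by (rule prime_gt_0_nat[OF p(1)], rule prime_gt_1_nat[OF p(1)], rule prime_gt_1_nat[OF q])
  have \<phi>: "?\<phi> = p ^ (n - 1) * (p - 1)" using assms(1) by (intro totient_prime_power p(1)) simp
  have mG: "metacyclic p n q b (\<kappa> b) (G b)" if "b \<in> {1..min n a}" for b
    unfolding \<kappa>_def G[OF that]
    by (rule metacyclic_semidirect[OF p q assms(6,1) _ hom[OF that] card[OF that]]) (use that in simp)
  have mC: "metacyclic p n q 0 (\<lambda>_. 1) C'"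
    unfolding C'_def by (rule metacyclic_cyclic[OF p q assms(6,1)])
  have gG: "group (G b)" "finite (carrier (G b))" if "b \<in> {1..min n a}" for b
    by (rule metacyclic.grp[OF mG[OF that]], rule metacyclic.finite_carrier[OF mG[OF that]])
  have gC': "group C'" "finite (carrier C')"
    by (rule metacyclic.grp[OF mC], rule metacyclic.finite_carrier[OF mC])
  have gC: "group C" "finite (carrier C)" using p0 q1 by (simp_all add: C carrier_integer_mod_group)
  have "coprime q (p ^ n)" using primes_coprime[OF q p(1)] assms(6) by simp
  then have iso: "C \<cong> C'"
    unfolding C C'_def using p0 q1 by (intro integer_mod_group_mult_iso) simp_all
  have aG: "card (auto (G b)) = (q - 1) * q * p ^ (n - b)" if "b \<in> {1..min n a}" for b
    using metacyclic.card_auto[OF mG[OF that]] that by simp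
  have aC: "card (auto C) = (q - 1) * ?\<phi>"
    using metacyclic.card_auto[OF mC] card_auto_cong[OF gC(1) gC'(1) gC(2) iso] by simp
  have pos: "(q - 1) * q * p ^ (n - b) > 0" "(q - 1) * ?\<phi> > 0" for b
    using p1 q1 by simp_all
  have cancel: "x = y" if "x * c = y * c" "c > 0" for x y c :: nat
    using that by simp
  have pair: "metacyclic_pair p n q b1 (\<kappa> b1) (G b1) b2 (\<kappa> b2) (G b2)"
    if "b1 \<in> {1..min n a}" "b2 \<in> {1..min n a}" for b1 b2
    by (intro metacyclic_pair.intro mG that)
  show ?thesis
  proof (intro conjI ballI impI)
    fix b assume b: "b \<in> {1..min n a}"
    have R: "card (regular_embeddings (G b) (G b)) =
        2 * (p ^ (n - b) + q * (?\<phi> - p ^ (n - b))) * ((q - 1) * q * p ^ (n - b))"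
      using metacyclic.card_regular_embeddings_self[OF mG[OF b]] b by (simp add: algebra_simps)
    show "e' (G b) (G b) = 2 * (p ^ (n - b) + q * (?\<phi> - p ^ (n - b)))"
      using card_regular_embeddings[OF gG[OF b] gG[OF b]] unfolding R aG[OF b] by (rule cancel[OF sym pos(1)])
    show "hopf_galois_count K (G b) = 2 * (p ^ (n - b) + q * (?\<phi> - p ^ (n - b)))"
      if "galois_extension_with_group K (G b)"
      using hopf_galois_count_embeddings[OF that gG[OF b] gG[OF b]] unfolding R aG[OF b] by (rule cancel[OF _ pos(1)])
  next
    fix b1 b2 assume b: "b1 \<in> {1..min n a}" "b2 \<in> {1..min n a}" and ne: "b1 \<noteq> b2"
    have R: "card (regular_embeddings (G b1) (G b2)) = 2 * (?\<phi> * (q * q) * (p ^ (n - b2) * (q - 1)))"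
      using metacyclic_pair.card_regular_embeddings_ne[OF pair[OF b]] b ne by simp
    \<comment> \<open>The truncated subtractions are exact because \<open>b1\<close> is at least 1
      and \<open>b1\<close> and \<open>b2\<close> are at most \<open>n\<close>.\<close>
    have "n - 1 + (n - b2) = (n + b1 - b2 - 1) + (n - b1)" using b by auto
    then have "p ^ (n - 1) * p ^ (n - b2) = p ^ (n + b1 - b2 - 1) * p ^ (n - b1)" by (simp only: power_add[symmetric])
    then have R1: "2 * (?\<phi> * (q * q) * (p ^ (n - b2) * (q - 1))) =
        2 * q * p ^ (n + b1 - b2 - 1) * (p - 1) * ((q - 1) * q * p ^ (n - b1))"
      unfolding \<phi> by (simp only: mult_ac)
    show "e' (G b1) (G b2) = 2 * q * p ^ (n + b1 - b2 - 1) * (p - 1)"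
      using card_regular_embeddings[OF gG[OF b(1)] gG[OF b(2)]] unfolding R R1 aG[OF b(1)] by (rule cancel[OF sym pos(1)])
    show "hopf_galois_count K (G b2) = 2 * q * p ^ (n - 1) * (p - 1)"
      if "galois_extension_with_group K (G b1)"
    proof -
      have "hopf_galois_count K (G b2) * ((q - 1) * q * p ^ (n - b2)) =
          2 * q * p ^ (n - 1) * (p - 1) * ((q - 1) * q * p ^ (n - b2))"
        using hopf_galois_count_embeddings[OF that gG[OF b(1)] gG[OF b(2)]] unfolding R aG[OF b(2)] \<phi> by (simp only: mult_ac)
      then show ?thesis by (rule cancel[OF _ pos(1)])
    qed
  next
    fix b assume b: "b \<in> {1..min n a}"
    have "card (regular_embeddings C' (G b)) = 2 * (?\<phi> * q * (p ^ (n - b) * (q - 1)))"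
      using metacyclic_pair.card_regular_embeddings_ne[OF metacyclic_pair.intro[OF mC mG[OF b]]] b by simp
    then have R: "card (regular_embeddings C (G b)) = 2 * (?\<phi> * q * (p ^ (n - b) * (q - 1)))"
      using card_regular_embeddings_cong_left[OF gC(1) gC'(1) gC(2) gG(2)[OF b] iso] by simp
    have "e' C (G b) * ((q - 1) * ?\<phi>) = 2 * p ^ (n - b) * q * ((q - 1) * ?\<phi>)"
      using card_regular_embeddings[OF gC gG[OF b]] unfolding R aC by (simp only: mult_ac)
    then show "e' C (G b) = 2 * p ^ (n - b) * q" by (rule cancel[OF _ pos(2)])
    show "hopf_galois_count K (G b) = 2 * (p - 1) * p ^ (n - 1)"
      if "galois_extension_with_group K C"
    proof -
      have "hopf_galois_count K (G b) * ((q - 1) * q * p ^ (n - b)) =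
          2 * (p - 1) * p ^ (n - 1) * ((q - 1) * q * p ^ (n - b))"
        using hopf_galois_count_embeddings[OF that gC gG[OF b]] unfolding R aG[OF b] \<phi> by (simp only: mult_ac)
      then show ?thesis by (rule cancel[OF _ pos(1)])
    qed
  next
    fix b assume b: "b \<in> {1..min n a}"
    have "card (regular_embeddings (G b) C') = q * ?\<phi> * (p ^ (n - 1) * (q - 1))"
      using metacyclic_pair.card_regular_embeddings_cyclic[OF metacyclic_pair.intro[OF mG[OF b] mC]] b by simp
    then have R: "card (regular_embeddings (G b) C) = q * ?\<phi> * (p ^ (n - 1) * (q - 1))"
      using card_regular_embeddings_cong_right[OF gC(1) gC'(1) gG[OF b] gC(2) iso] by simp
    \<comment> \<open>Here exactness of \<open>n + b - 2\<close> needs that both \<open>n\<close>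
      and \<open>b\<close> are at least 1.\<close>
    have "n - 1 + (n - 1) = (n + b - 2) + (n - b)" using b by auto
    then have "p ^ (n - 1) * p ^ (n - 1) = p ^ (n + b - 2) * p ^ (n - b)" by (simp only: power_add[symmetric])
    then have R1: "q * ?\<phi> * (p ^ (n - 1) * (q - 1)) = p ^ (n + b - 2) * (p - 1) * ((q - 1) * q * p ^ (n - b))"
      unfolding \<phi> by (simp only: mult_ac)
    show "e' (G b) C = p ^ (n + b - 2) * (p - 1)"
      using card_regular_embeddings[OF gG[OF b] gC] unfolding R R1 aG[OF b] by (rule cancel[OF sym pos(1)])
    show "hopf_galois_count K C = p ^ (n - 1) * q"
      if "galois_extension_with_group K (G b)"
    proof -
      have "hopf_galois_count K C * ((q - 1) * ?\<phi>) = p ^ (n - 1) * q * ((q - 1) * ?\<phi>)"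
        using hopf_galois_count_embeddings[OF that gG[OF b] gC] unfolding R aC by (simp only: mult_ac)
      then show ?thesis by (rule cancel[OF _ pos(2)])
    qed
  qed
qed

end
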